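(* Let $(X,\nu)$ be a standard Borel space with a continuous finite measure, and let $\Pi$ be a measure on $(0,\infty)$ with $\int_0^\infty(1-e^{-s})\,d\Pi(s)<\infty$ such that the measure $t^2\,d\Pi(t)$ has finite moments of all orders and its moment problem is definite (determinate). Let $\eta_\Pi$ be the generalized subordinator on $(X,\nu)$ with Lévy measure $\Pi$, let $\alpha^{L^2(\mathbb R,\Pi)}$ be the Gaussian white noise on $(X\times\mathbb R,\nu\times\Pi)$, and let $\Phi:L^2(\alpha^{L^2(\mathbb R,\Pi)})\to L^2(\eta_\Pi)$ be the canonical isometry, determined by $$\Phi\big(e^{\langle h,\cdot\rangle-\frac{\|h\|^2}{2}}\big)(\eta)=\prod_i(1+h(x_i,t_i))\cdot e^{-\int_X\int_{\mathbb R} h(x,t)\,d\nu(x)\,d\Pi(t)},\qquad \eta=\sum_it_i\delta_{x_i},$$ for real-valued $h\in L^2\cap L^1(X\times\mathbb R,\nu\times\Pi)$. Let $\{P_k(t)\}_{k\ge0}$ be the family of orthogonal polynomials with respect to the measure $t^2\,d\Pi(t)$ ($\deg P_k=k$). Then in terms of orthogonal decompositions $\Phi$ takes the form $$\Phi\,\mathfrak H^{(n)}_{f_1,\dots,f_n}=\mathfrak C^{(n)}_{f_1,\dots,f_n},$$ where $f_k(x,t)=a_k(x)\,t\,P_{k-1}(t)$ with $a_k\in L^2(X,\nu)$, $k=1,\dots,n$.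
   Context: Generalized subordinator with Lévy measure $\Pi$: the random discrete measure $\eta=\sum_it_i\delta_{x_i}$ on $X$, where $\omega=\{(x_i,t_i)\}$ is the Poisson process on $X\times(0,\infty)$ with mean measure $\nu\times\Pi$; $L^2(\eta_\Pi)$ is the space of square integrable functionals of $\eta$, identified with the $L^2$ space over this Poisson process. Gaussian white noise on a measure space $(Y,\mu)$: the generalized random process on real $L^2(Y,\mu)$ with $\mathbb E e^{i\langle h,\cdot\rangle}=e^{-\|h\|^2/2}$. Put $Y=X\times\mathbb R$, $\mu=\nu\times\Pi$; functions $f_i\in L^2(Y,\mu)$ are real-valued. Let $\mathfrak S_n$ be the symmetric group, $\mathrm{Inv}_n$ the set of its involutions (all cycles of length at most two, including the identity), $C_k(g)$ the set of cycles of length $k$ of $g$, $c(g)$ the total number of cycles of $g$ (fixed points included). Generalized Hermite functional: $\mathfrak H^{(n)}_{f_1,\dots,f_n}(\cdot)=\sum_{g\in\mathrm{Inv}_n}\prod_{i\in C_1(g)}\langle f_i,\cdot\rangle\prod_{\{j,k\}\in C_2(g)}\big(-\int_Yf_jf_k\,d\mu\big)$. Generalized Charlier functional: $\mathfrak C^{(n)}_{f_1,\dots,f_n}=\sum_{g\in\mathfrak S_n}(-1)^{n-c(g)}\prod_{i\in C_1(g)}\big(\sum_{y\in\omega}f_i(y)-\int_Yf_i\,d\mu\big)\prod_{k\ge2}\prod_{(i_1\dots i_k)\in C_k(g)}\sum_{y\in\omega}f_{i_1}(y)\cdots f_{i_k}(y)$. *)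

theory Defs
  imports "HOL-Probability.Probability" "HOL-Combinatorics.Orbits"
    "HOL-Computational_Algebra.Polynomial"
begin

section \<open>Measure-theoretic notions\<close>

definition standard_borel :: "'a measure \<Rightarrow> bool" where
  "standard_borel M \<longleftrightarrow>
     (\<exists>T. completely_metrizable_space T \<and> second_countable T \<and>
          space M = topspace T \<and> sets M = sigma_sets (topspace T) {U. openin T U})"

definition continuous_measure :: "'a measure \<Rightarrow> bool" where
  "continuous_measure M \<longleftrightarrow> (\<forall>x\<in>space M. emeasure M {x} = 0)"

text \<open>Elements of $L^2$ are represented by functions; equality in $L^2$ is equality almost
  everywhere. The scalars are those of any real normed field, so that the real and the complex
  $L^2$ spaces are both covered.\<close>

definition L2 :: "'a measure \<Rightarrow> ('a \<Rightarrow> 'k::{real_normed_field, second_countable_topology}) set" where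
  "L2 M = {F \<in> borel_measurable M. integrable M (\<lambda>w. (norm (F w))\<^sup>2)}"

definition L2_norm_sq :: "'a measure \<Rightarrow> ('a \<Rightarrow> 'k::{real_normed_field, second_countable_topology}) \<Rightarrow> real" where
  "L2_norm_sq M F = (\<integral>w. (norm (F w))\<^sup>2 \<partial>M)"

definition generated_algebra ::
    "'w measure \<Rightarrow> 'i set \<Rightarrow> ('i \<Rightarrow> 'w \<Rightarrow> 'b::topological_space) \<Rightarrow> 'w measure" where
  "generated_algebra M I X = sigma (space M) {X i -` B \<inter> space M | i B. i \<in> I \<and> B \<in> sets borel}"

text \<open>Square integrable functionals of the random process $(X_i)_{i\in I}$: those that are
  measurable with respect to it, up to modification on a null set.\<close>

definition L2_functionals ::
    "'w measure \<Rightarrow> 'i set \<Rightarrow> ('i \<Rightarrow> 'w \<Rightarrow> 'b::topological_space) \<Rightarrow>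
     ('w \<Rightarrow> 'k::{real_normed_field, second_countable_topology}) set" where
  "L2_functionals M I X =
     {F \<in> L2 M. \<exists>F'\<in>borel_measurable (generated_algebra M I X). AE w in M. F w = F' w}"

text \<open>Linear isometry between two spaces of classes of square integrable functions, acting on
  representatives.\<close>

definition L2_isometry ::
    "'v measure \<Rightarrow> ('v \<Rightarrow> 'k) set \<Rightarrow> 'w measure \<Rightarrow> ('w \<Rightarrow> 'k) set \<Rightarrow>
     (('v \<Rightarrow> 'k) \<Rightarrow> 'w \<Rightarrow> 'k::{real_normed_field, second_countable_topology}) \<Rightarrow> bool" where
  "L2_isometry M \<H> N \<K> \<Phi> \<longleftrightarrow>
     (\<forall>F\<in>\<H>. \<Phi> F \<in> \<K>) \<and>
     (\<forall>F\<in>\<H>. \<forall>G\<in>\<H>. (AE v in M. F v = G v) \<longrightarrow> (AE w in N. \<Phi> F w = \<Phi> G w)) \<and>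
     (\<forall>F\<in>\<H>. \<forall>G\<in>\<H>. \<forall>a b. AE w in N. \<Phi> (\<lambda>v. a * F v + b * G v) w = a * \<Phi> F w + b * \<Phi> G w) \<and>
     (\<forall>F\<in>\<H>. L2_norm_sq N (\<Phi> F) = L2_norm_sq M F)"

text \<open>Unordered product, the multiplicative counterpart of \<^const>\<open>infsum\<close>; it is meaningful
  only if the net of finite partial products converges.\<close>

definition infprod :: "('a \<Rightarrow> real) \<Rightarrow> 'a set \<Rightarrow> real" where
  "infprod f A = Lim (finite_subsets_at_top A) (\<lambda>F. \<Prod>x\<in>F. f x)"


section \<open>Random processes\<close>

definition gaussian_white_noise ::
    "'w measure \<Rightarrow> 'y measure \<Rightarrow> (('y \<Rightarrow> real) \<Rightarrow> 'w \<Rightarrow> real) \<Rightarrow> bool" where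
  "gaussian_white_noise M \<mu> W \<longleftrightarrow>
     prob_space M \<and>
     (\<forall>h\<in>L2 \<mu>. W h \<in> borel_measurable M) \<and>
     (\<forall>h\<in>L2 \<mu>. \<forall>g\<in>L2 \<mu>. \<forall>a b. AE w in M. W (\<lambda>y. a * h y + b * g y) w = a * W h w + b * W g w) \<and>
     (\<forall>h\<in>L2 \<mu>. (\<integral>w. exp (\<i> * complex_of_real (W h w)) \<partial>M)
                  = complex_of_real (exp (- L2_norm_sq \<mu> h / 2)))"

abbreviation L2_white_noise ::
    "'w measure \<Rightarrow> 'y measure \<Rightarrow> (('y \<Rightarrow> real) \<Rightarrow> 'w \<Rightarrow> real) \<Rightarrow>
     ('w \<Rightarrow> 'k::{real_normed_field, second_countable_topology}) set" where
  "L2_white_noise M \<mu> W \<equiv> L2_functionals M (L2 \<mu>) W"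

definition num_points :: "('w \<Rightarrow> 'y set) \<Rightarrow> 'y set \<Rightarrow> 'w \<Rightarrow> ennreal" where
  "num_points Z A w = emeasure (count_space UNIV) (Z w \<inter> A)"

text \<open>A Poisson process is a random set of points. Simple configurations suffice because the
  mean measures considered below have no atoms.\<close>

definition poisson_process :: "'w measure \<Rightarrow> 'y measure \<Rightarrow> ('w \<Rightarrow> 'y set) \<Rightarrow> bool" where
  "poisson_process M \<mu> Z \<longleftrightarrow>
     prob_space M \<and>
     (\<forall>w\<in>space M. Z w \<subseteq> space \<mu>) \<and>
     (\<forall>A\<in>sets \<mu>. num_points Z A \<in> borel_measurable M) \<and>
     (\<forall>A\<in>sets \<mu>. emeasure \<mu> A < \<infinity> \<longrightarrow>
        (\<forall>k::nat. measure M {w \<in> space M. num_points Z A w = of_nat k}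
                    = exp (- measure \<mu> A) * measure \<mu> A ^ k / fact k)) \<and>
     (\<forall>(A :: nat \<Rightarrow> 'y set) I. finite I \<and> A ` I \<subseteq> sets \<mu> \<and> disjoint_family_on A I \<longrightarrow>
        prob_space.indep_vars M (\<lambda>_. borel) (\<lambda>i. num_points Z (A i)) I)"

text \<open>A measure on $(0,\infty)$ is represented as a Borel measure on the real line that does
  not charge $(-\infty,0]$.\<close>

definition levy_measure :: "real measure \<Rightarrow> bool" where
  "levy_measure \<Lambda> \<longleftrightarrow> sets \<Lambda> = sets borel \<and> emeasure \<Lambda> {..0} = 0 \<and>
     (\<integral>\<^sup>+ s. ennreal (1 - exp (- s)) \<partial>\<Lambda>) < \<infinity>"

text \<open>The discrete measure $\sum_i t_i\delta_{x_i}$ of the configuration $\{(x_i,t_i)\}$;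
  only the measurable structure of $\nu$ enters.\<close>

definition discrete_measure :: "'x measure \<Rightarrow> ('x \<times> real) set \<Rightarrow> 'x measure" where
  "discrete_measure \<nu> Z = distr (density (count_space Z) (\<lambda>(x, t). ennreal t)) \<nu> fst"

definition generalized_subordinator ::
    "'w measure \<Rightarrow> 'x measure \<Rightarrow> real measure \<Rightarrow> ('w \<Rightarrow> ('x \<times> real) set) \<Rightarrow> ('w \<Rightarrow> 'x measure) \<Rightarrow> bool" where
  "generalized_subordinator M \<nu> \<Lambda> Z \<eta> \<longleftrightarrow>
     poisson_process M (\<nu> \<Otimes>\<^sub>M \<Lambda>) Z \<and>
     (\<forall>w\<in>space M. Z w \<subseteq> space \<nu> \<times> {0<..}) \<and>
     (\<forall>w\<in>space M. \<eta> w = discrete_measure \<nu> (Z w))"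

abbreviation L2_random_measure ::
    "'w measure \<Rightarrow> 'x measure \<Rightarrow> ('w \<Rightarrow> 'x measure) \<Rightarrow>
     ('w \<Rightarrow> 'k::{real_normed_field, second_countable_topology}) set" where
  "L2_random_measure M \<nu> \<eta> \<equiv> L2_functionals M (sets \<nu>) (\<lambda>B w. emeasure (\<eta> w) B)"

definition canonical_isometry ::
    "'v measure \<Rightarrow> (('x \<times> real \<Rightarrow> real) \<Rightarrow> 'v \<Rightarrow> real) \<Rightarrow>
     'w measure \<Rightarrow> 'x measure \<Rightarrow> real measure \<Rightarrow> ('w \<Rightarrow> ('x \<times> real) set) \<Rightarrow> ('w \<Rightarrow> 'x measure) \<Rightarrow>
     (('v \<Rightarrow> 'k) \<Rightarrow> 'w \<Rightarrow> 'k::{real_normed_field, second_countable_topology}) \<Rightarrow> bool" where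
  "canonical_isometry M W N \<nu> \<Lambda> Z \<eta> \<Phi> \<longleftrightarrow>
     L2_isometry M (L2_white_noise M (\<nu> \<Otimes>\<^sub>M \<Lambda>) W) N (L2_random_measure N \<nu> \<eta>) \<Phi> \<and>
     (\<forall>h \<in> L2 (\<nu> \<Otimes>\<^sub>M \<Lambda>). integrable (\<nu> \<Otimes>\<^sub>M \<Lambda>) h \<longrightarrow>
        (AE w in N. \<Phi> (\<lambda>v. of_real (exp (W h v - L2_norm_sq (\<nu> \<Otimes>\<^sub>M \<Lambda>) h / 2))) w
           = of_real (infprod (\<lambda>y. 1 + h y) (Z w) * exp (- (\<integral>y. h y \<partial>(\<nu> \<Otimes>\<^sub>M \<Lambda>))))))"


section \<open>Moments and orthogonal polynomials\<close>

definition finite_moments :: "real measure \<Rightarrow> bool" where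
  "finite_moments \<rho> \<longleftrightarrow> (\<forall>n::nat. integrable \<rho> (\<lambda>t. t ^ n))"

definition moment_determinate :: "real measure \<Rightarrow> bool" where
  "moment_determinate \<rho> \<longleftrightarrow>
     (\<forall>\<sigma>. sets \<sigma> = sets borel \<and> finite_moments \<sigma> \<and>
          (\<forall>n::nat. (\<integral>t. t ^ n \<partial>\<sigma>) = (\<integral>t. t ^ n \<partial>\<rho>)) \<longrightarrow> \<sigma> = \<rho>)"

definition orthogonal_polynomials :: "real measure \<Rightarrow> (nat \<Rightarrow> real poly) \<Rightarrow> bool" where
  "orthogonal_polynomials \<rho> P \<longleftrightarrow>
     (\<forall>k. P k \<noteq> 0 \<and> degree (P k) = k) \<and>
     (\<forall>j k. j \<noteq> k \<longrightarrow> (\<integral>t. poly (P j) t * poly (P k) t \<partial>\<rho>) = 0)"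


section \<open>Generalized Hermite and Charlier functionals\<close>

text \<open>A cycle of a permutation of $\{1,\dots,n\}$ is represented by its underlying set, the
  functionals below being insensitive to the cyclic order. Fixed points are cycles of length 1.\<close>

definition cycles_of :: "nat \<Rightarrow> (nat \<Rightarrow> nat) \<Rightarrow> nat set set" where
  "cycles_of n g = orbit g ` {1..n}"

definition cycles_of_length :: "nat \<Rightarrow> nat \<Rightarrow> (nat \<Rightarrow> nat) \<Rightarrow> nat set set" where
  "cycles_of_length k n g = {c \<in> cycles_of n g. card c = k}"

definition involutions :: "nat \<Rightarrow> (nat \<Rightarrow> nat) set" where
  "involutions n = {g. g permutes {1..n} \<and> (\<forall>c\<in>cycles_of n g. card c \<le> 2)}"

definition hermite_functional ::
    "'y measure \<Rightarrow> (('y \<Rightarrow> real) \<Rightarrow> 'w \<Rightarrow> real) \<Rightarrow> nat \<Rightarrow> (nat \<Rightarrow> 'y \<Rightarrow> real) \<Rightarrow> 'w \<Rightarrow> real" where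
  "hermite_functional \<mu> W n f w =
     (\<Sum>g\<in>involutions n.
        (\<Prod>c\<in>cycles_of_length 1 n g. \<Prod>i\<in>c. W (f i) w) *
        (\<Prod>c\<in>cycles_of_length 2 n g. - (\<integral>y. (\<Prod>j\<in>c. f j y) \<partial>\<mu>)))"

definition charlier_functional ::
    "'y measure \<Rightarrow> ('w \<Rightarrow> 'y set) \<Rightarrow> nat \<Rightarrow> (nat \<Rightarrow> 'y \<Rightarrow> real) \<Rightarrow> 'w \<Rightarrow> real" where
  "charlier_functional \<mu> Z n f w =
     (\<Sum>g | g permutes {1..n}.
        (-1) ^ (n - card (cycles_of n g)) *
        (\<Prod>c\<in>cycles_of_length 1 n g. \<Prod>i\<in>c. (\<Sum>\<^sub>\<infinity>y\<in>Z w. f i y) - (\<integral>y. f i y \<partial>\<mu>)) *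
        (\<Prod>k=2..n. \<Prod>c\<in>cycles_of_length k n g. \<Sum>\<^sub>\<infinity>y\<in>Z w. \<Prod>i\<in>c. f i y))"

end

theory Submission
  imports Defs
begin

text \<open>Both functionals are sums over permutations of products of weights of cycles, and both are
  mixed derivatives at $0$ in $s_1,\dots,s_n$: the Hermite functional of
  $e^{\langle h,\cdot\rangle-\|h\|^2/2}$ and the Charlier functional of
  $\prod_y(1+h(y))\,e^{-\int h\,d\mu}$, where $h=\sum_is_if_i$. Indeed, inserting a new element into a
  permutation either creates a fixed point or enlarges a cycle $c$ in one of $|c|$ ways, and this is
  what the product rule does to $\sum_g\prod_cw_c\cdot U$ as soon as $\partial_jw_c=|c|\,w_{c\cup\{j\}}$
  and $\partial_jU=w_{\{j\}}U$.

  Replacing the mixed derivative by the $n$-fold difference quotient with step $\varepsilon$ gives a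
  finite linear combination of exponentials, on which $\Phi$ is known. As $\varepsilon\to0$, on the
  Gaussian side the quotients converge in $L^2$, by the mean value theorem and exponential moments; on
  the Poisson side pointwise convergence suffices, since an $L^2$ limit agrees with an almost sure
  limit. Thus only $f_i\in L^1\cap L^2$ matters.\<close>

section \<open>Sums over permutations\<close>

text \<open>Permutations appear because, for either density U, the mixed derivative of ln U over a
  set c of directions is (|c| - 1)! w_c, and (|c| - 1)! is the number of cyclic orders on c.
  Expanding the derivatives of exp(ln U) over set partitions therefore gives a sum over
  permutations. On the Gaussian side ln U is quadratic and only cycles of length at most two
  survive; on the Poisson side ln(1 + h) has derivatives of every order.

  Integrability makes the two sides asymmetric. Products of more than two of the f_i need not be
  integrable, and as the f_i may be unbounded, 1 + h may change sign however small the step is. So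
  the Poisson limit is taken for one fixed configuration, over whose points the f_i are summable and
  hence bounded, from some step on that depends on the configuration. Domination is sought on the
  Gaussian side alone. There the mean value theorem yields limit and dominating function at once,
  and its intermediate points may depend on the random outcome without being measurable.\<close>

definition perm_sum :: "('i set \<Rightarrow> 'a::comm_ring_1) \<Rightarrow> 'i set \<Rightarrow> 'a" where
  "perm_sum w A = (\<Sum>g | g permutes A. \<Prod>c\<in>orbit g ` A. w c)"

section \<open>Orbits of a permutation as its cycles\<close>

lemma orbit_outside:
  assumes "g permutes A" "x \<notin> A"
  shows "orbit g x = {x}"
  using assms by (simp add: orbit_eq_singleton_iff permutes_not_in)

text \<open>\<open>orbit g x\<close> starts at \<open>g x\<close>, so it contains \<open>x\<close>
  only if some iterate returns there; for a permutation of a finite set it does.\<close>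

lemma self_in_orbit_permutes:
  assumes "g permutes A" "finite A"
  shows "x \<in> orbit g x"
proof (rule permutation_self_in_orbit)
  show "permutation g" unfolding permutation_permutes using assms by (intro exI[of _ A]) simp
qed

lemma orbits_eq_or_disjoint:
  assumes "g permutes A" "finite A"
  shows "orbit g x = orbit g y \<or> orbit g x \<inter> orbit g y = {}"
proof (rule disjCI)
  assume "orbit g x \<inter> orbit g y \<noteq> {}"
  then obtain z where z: "z \<in> orbit g x" "z \<in> orbit g y" by blast
  have "orbit g u = orbit g z" if "z \<in> orbit g u" for u
  proof
    have "u \<in> orbit g z" by (rule orbit_swap[OF self_in_orbit_permutes[OF assms] that])
    then show "orbit g u \<subseteq> orbit g z" using orbit_trans[of _ g u z] by (intro subsetI)
    show "orbit g z \<subseteq> orbit g u" using orbit_trans[OF _ that] by (intro subsetI)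
  qed
  from this[OF z(1)] this[OF z(2)] show "orbit g x = orbit g y" by simp
qed

lemma orbit_eq_if_in:
  assumes "g permutes A" "finite A" "y \<in> orbit g x"
  shows "orbit g y = orbit g x"
proof -
  have "y \<in> orbit g x \<inter> orbit g y" using self_in_orbit_permutes[OF assms(1,2)] assms(3) by simp
  then have "orbit g x \<inter> orbit g y \<noteq> {}" by (metis empty_iff)
  then show ?thesis using orbits_eq_or_disjoint[OF assms(1,2), of x y] by simp
qed

text \<open>Composing with the transposition of \<open>j\<close> and \<open>b\<close> inserts \<open>j\<close> in front of \<open>b\<close> into the cycle
  of \<open>b\<close>.\<close>

lemma orbit_transpose_insert:
  assumes g: "g permutes A" and fin: "finite A" and j: "j \<notin> A" and b: "b \<in> A"
  defines "g' \<equiv> Transposition.transpose j b \<circ> g"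
  shows "orbit g' b = insert j (orbit g b)"
    and "x \<in> A \<Longrightarrow> x \<notin> orbit g b \<Longrightarrow> orbit g' x = orbit g x"
    and "orbit g' j = insert j (orbit g b)"
proof -
  have g': "g' permutes insert j A"
    unfolding g'_def
    by (rule permutes_compose[OF permutes_subset[OF g] permutes_swap_id]) (use b in auto)
  have gj: "g j = j" using g j by (simp add: permutes_not_in)
  have eq: "g' y = g y" if "y \<in> A" "g y \<noteq> b" for y
  proof -
    have "g y \<in> A" using permutes_in_image[OF g] that by simp
    then have "g y \<noteq> j" using j by blast
    then show ?thesis using that unfolding g'_def by (simp add: transpose_apply_other)
  qed
  have eqb: "g' y = j" if "g y = b" for y using that unfolding g'_def by simp
  have g'j: "g' j = b" using gj unfolding g'_def by simp
  have bb: "b \<in> orbit g b" by (rule self_in_orbit_permutes[OF g fin])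
  have b'b': "b \<in> orbit g' b" by (rule self_in_orbit_permutes[OF g']) (use fin in simp)
  \<comment> \<open>The orbit under \<open>g\<close> is followed step by step. On \<open>A\<close>
    the two maps differ only at the predecessor of \<open>b\<close>, where \<open>g\<close> returns
    to \<open>b\<close>, which is in the orbit under \<open>g'\<close> anyway.\<close>
  have sub: "y \<in> orbit g' b" if "y \<in> orbit g b" for y
    using that
  proof induction
    case base
    then show ?case using b'b' eq[OF b] orbit.base[of g' b] by (cases "g b = b") auto
  next
    case (step y)
    have "y \<in> A" using step(1) permutes_orbit_subset[OF g b] by blast
    then show ?case using b'b' eq[of y] orbit.step[OF step(2)] by (cases "g y = b") auto
  qed
  \<comment> \<open>\<open>y\<close> is the predecessor of \<open>b\<close> on its cycle;
    \<open>g'\<close> sends it to \<open>j\<close>, and this is how \<open>j\<close> enters the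
    cycle.\<close>
  obtain y where y: "y \<in> orbit g b" "g y = b"
    using bb
  proof cases
    case base
    from that[OF bb this[symmetric]] show ?thesis .
  next
    case (step y)
    from that[OF step(2) step(1)[symmetric]] show ?thesis .
  qed
  have jin: "j \<in> orbit g' b" using orbit.step[OF sub[OF y(1)]] eqb[OF y(2)] by simp
  have up: "y \<in> insert j (orbit g b)" if "y \<in> orbit g' b" for y
    using that
  proof induction
    case base
    then show ?case using eqb eq[OF b] orbit.base[of g b] by (cases "g b = b") auto
  next
    case (step y)
    show ?case
    proof (cases "y = j")
      case True then show ?thesis using g'j bb by simp
    next
      case False
      then have yo: "y \<in> orbit g b" using step by simp
      then have "y \<in> A" using permutes_orbit_subset[OF g b] by blast
      then show ?thesis using eq[of y] eqb orbit.step[OF yo] by (cases "g y = b") auto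
    qed
  qed
  show *: "orbit g' b = insert j (orbit g b)" using sub up jin by blast
  show "orbit g' j = insert j (orbit g b)"
    using orbit_eq_if_in[OF g' _ jin] * fin by simp
  show "orbit g' x = orbit g x" if x: "x \<in> A" "x \<notin> orbit g b"
  proof -
    have bx: "b \<notin> orbit g x"
      using x orbit_eq_if_in[OF g fin, of b x] self_in_orbit_permutes[OF g fin, of x] by auto
    have "g' y = g y" if y: "y \<in> orbit g x" for y
    proof (rule eq)
      show "y \<in> A" using y permutes_orbit_subset[OF g x(1)] by blast
      show "g y \<noteq> b" using orbit.step[OF y] bx by auto
    qed
    moreover have "g \<in> orbit g x \<rightarrow> orbit g x" by (simp add: orbit.step)
    ultimately show ?thesis
      using orbit_cong0[of x "orbit g x" g g'] self_in_orbit_permutes[OF g fin, of x] by auto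
  qed
qed

text \<open>The weights see cycles as sets only, so it is enough to know which set replaces
  which.\<close>

lemma orbits_transpose_insert:
  assumes g: "g permutes A" and fin: "finite A" and j: "j \<notin> A" and b: "b \<in> A"
  shows "orbit (Transposition.transpose j b \<circ> g) ` insert j A =
    insert (insert j (orbit g b)) (orbit g ` A - {orbit g b})"
proof -
  let ?g = "Transposition.transpose j b \<circ> g"
  note o = orbit_transpose_insert[OF assms]
  have in_eq: "orbit ?g x = insert j (orbit g b)" if "x \<in> A" "x \<in> orbit g b" for x
  proof -
    have "?g permutes insert j A"
      by (rule permutes_compose[OF permutes_subset[OF g] permutes_swap_id]) (use b in auto)
    then show ?thesis using orbit_eq_if_in[of ?g "insert j A" x b] that o(1) fin by simp
  qed
  have neq: "orbit g x \<noteq> orbit g b" if "x \<notin> orbit g b" for x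
    using self_in_orbit_permutes[OF g fin, of x] that by auto
  have bb: "b \<in> orbit g b" by (rule self_in_orbit_permutes[OF g fin])
  have "orbit ?g ` A = insert (insert j (orbit g b)) (orbit g ` A - {orbit g b})"
  proof (intro equalityI subsetI)
    fix c assume "c \<in> orbit ?g ` A"
    then obtain x where x: "x \<in> A" "c = orbit ?g x" by (rule imageE)
    show "c \<in> insert (insert j (orbit g b)) (orbit g ` A - {orbit g b})"
    proof (cases "x \<in> orbit g b")
      case True then show ?thesis using in_eq[OF x(1)] x(2) by simp
    next
      case False then show ?thesis using o(2)[OF x(1)] x neq by simp
    qed
  next
    fix c assume "c \<in> insert (insert j (orbit g b)) (orbit g ` A - {orbit g b})"
    then consider "c = orbit ?g b" | x where "x \<in> A" "c = orbit g x" "orbit g x \<noteq> orbit g b"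
      using in_eq[OF b bb] by auto
    then show "c \<in> orbit ?g ` A"
    proof cases
      case 1 then show ?thesis using b by simp
    next
      case (2 x)
      then have "x \<notin> orbit g b" using orbit_eq_if_in[OF g fin] by metis
      then show ?thesis using o(2)[OF 2(1)] 2 by (metis image_eqI)
    qed
  qed
  then show ?thesis using o(3) by simp
qed

lemma perm_sum_insert:
  fixes w :: "'i set \<Rightarrow> 'a::comm_ring_1"
  assumes fin: "finite A" and j: "j \<notin> A"
  shows "perm_sum w (insert j A) = w {j} * perm_sum w A +
    (\<Sum>g | g permutes A. \<Sum>c\<in>orbit g ` A.
        of_nat (card c) * w (insert j c) * (\<Prod>d\<in>orbit g ` A - {c}. w d))"
proof -
  let ?h = "\<lambda>p. \<Prod>c\<in>orbit p ` insert j A. w c"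
  have fixj: "?h (Transposition.transpose j j \<circ> q) = w {j} * (\<Prod>c\<in>orbit q ` A. w c)" if q: "q permutes A" for q
  proof -
    have "{j} \<notin> orbit q ` A" using permutes_orbit_subset[OF q] j by blast
    then show ?thesis using orbit_outside[OF q j] fin by simp
  qed
  have ins: "?h (Transposition.transpose j b \<circ> q) = w (insert j (orbit q b)) * (\<Prod>d\<in>orbit q ` A - {orbit q b}. w d)"
    if q: "q permutes A" and b: "b \<in> A" for q b
  proof -
    \<comment> \<open>Cycles are collected in a set, so the product gains a factor only if the
      enlarged cycle is not there already; it is new because it contains \<open>j\<close>.\<close>
    have "insert j (orbit q b) \<notin> orbit q ` A - {orbit q b}"
      using permutes_orbit_subset[OF q] j by blast
    then show ?thesis using orbits_transpose_insert[OF q fin j b] fin by simp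
  qed
  have group: "(\<Sum>b\<in>A. w (insert j (orbit q b)) * (\<Prod>d\<in>orbit q ` A - {orbit q b}. w d)) =
     (\<Sum>c\<in>orbit q ` A. of_nat (card c) * w (insert j c) * (\<Prod>d\<in>orbit q ` A - {c}. w d))"
    if q: "q permutes A" for q
  proof -
    have "(\<Sum>b\<in>A. w (insert j (orbit q b)) * (\<Prod>d\<in>orbit q ` A - {orbit q b}. w d)) =
      (\<Sum>c\<in>orbit q ` A. \<Sum>b | b \<in> A \<and> orbit q b = c.
          w (insert j (orbit q b)) * (\<Prod>d\<in>orbit q ` A - {orbit q b}. w d))"
      by (rule sum.group[symmetric]) (use fin in auto)
    also have "\<dots> = (\<Sum>c\<in>orbit q ` A. of_nat (card c) * w (insert j c) * (\<Prod>d\<in>orbit q ` A - {c}. w d))"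
    proof (rule sum.cong[OF refl])
      fix c assume c: "c \<in> orbit q ` A"
      \<comment> \<open>The elements \<open>b\<close> in front of which an insertion enlarges
        \<open>c\<close> are exactly those of \<open>c\<close>; hence the factor
        \<open>card c\<close>.\<close>
      then have "{b \<in> A. orbit q b = c} = c"
        using orbit_eq_if_in[OF q fin] self_in_orbit_permutes[OF q fin] permutes_orbit_subset[OF q]
        by fastforce
      moreover have "(\<Sum>b | b \<in> A \<and> orbit q b = c. w (insert j (orbit q b)) * (\<Prod>d\<in>orbit q ` A - {orbit q b}. w d))
         = (\<Sum>b | b \<in> A \<and> orbit q b = c. w (insert j c) * (\<Prod>d\<in>orbit q ` A - {c}. w d))"
        by (rule sum.cong) auto
      ultimately show "(\<Sum>b | b \<in> A \<and> orbit q b = c. w (insert j (orbit q b)) * (\<Prod>d\<in>orbit q ` A - {orbit q b}. w d))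
         = of_nat (card c) * w (insert j c) * (\<Prod>d\<in>orbit q ` A - {c}. w d)"
        by (simp add: mult.assoc)
    qed
    finally show ?thesis .
  qed
  \<comment> \<open>Each permutation of \<open>insert j A\<close> is
    \<open>transpose j b \<circ> q\<close> for exactly one \<open>b\<close> and one \<open>q\<close>
    permuting \<open>A\<close>; the case \<open>b = j\<close> leaves \<open>j\<close> fixed.\<close>
  have "perm_sum w (insert j A) = (\<Sum>b\<in>insert j A. \<Sum>q | q permutes A. ?h (Transposition.transpose j b \<circ> q))"
    unfolding perm_sum_def by (rule sum_over_permutations_insert[OF fin j])
  also have "\<dots> = (\<Sum>q | q permutes A. ?h (Transposition.transpose j j \<circ> q)) + (\<Sum>b\<in>A. \<Sum>q | q permutes A. ?h (Transposition.transpose j b \<circ> q))"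
    using fin j by simp
  also have "(\<Sum>b\<in>A. \<Sum>q | q permutes A. ?h (Transposition.transpose j b \<circ> q)) = (\<Sum>q | q permutes A. \<Sum>b\<in>A. ?h (Transposition.transpose j b \<circ> q))"
    by (rule sum.swap)
  also have "\<dots> = (\<Sum>q | q permutes A. \<Sum>c\<in>orbit q ` A.
        of_nat (card c) * w (insert j c) * (\<Prod>d\<in>orbit q ` A - {c}. w d))"
  proof (rule sum.cong[OF refl])
    fix q assume "q \<in> {q. q permutes A}"
    then have q: "q permutes A" by simp
    have "(\<Sum>b\<in>A. ?h (Transposition.transpose j b \<circ> q)) = (\<Sum>b\<in>A. w (insert j (orbit q b)) * (\<Prod>d\<in>orbit q ` A - {orbit q b}. w d))"
      using ins[OF q] by (intro sum.cong) auto
    then show "(\<Sum>b\<in>A. ?h (Transposition.transpose j b \<circ> q)) = (\<Sum>c\<in>orbit q ` A.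
        of_nat (card c) * w (insert j c) * (\<Prod>d\<in>orbit q ` A - {c}. w d))"
      using group[OF q] by simp
  qed
  also have "(\<Sum>q | q permutes A. ?h (Transposition.transpose j j \<circ> q)) = (\<Sum>q | q permutes A. w {j} * (\<Prod>c\<in>orbit q ` A. w c))"
    by (rule sum.cong[OF refl]) (use fixj in simp)
  also have "\<dots> = w {j} * perm_sum w A"
    unfolding perm_sum_def by (simp add: sum_distrib_left)
  finally show ?thesis .
qed

lemma perm_sum_derivative:
  fixes w :: "real \<Rightarrow> 'i set \<Rightarrow> real"
  assumes fin: "finite A" and j: "j \<notin> A"
    and w: "\<And>B. B \<subseteq> A \<Longrightarrow> B \<noteq> {} \<Longrightarrow>
      ((\<lambda>t. w t B) has_real_derivative real (card B) * w x (insert j B)) (at x)"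
    and U: "(U has_real_derivative w x {j} * U x) (at x)"
  shows "((\<lambda>t. perm_sum (w t) A * U t) has_real_derivative perm_sum (w x) (insert j A) * U x) (at x)"
proof -
  have "((\<lambda>t. perm_sum (w t) A) has_real_derivative
     (\<Sum>g | g permutes A. \<Sum>c\<in>orbit g ` A.
        real (card c) * w x (insert j c) * (\<Prod>d\<in>orbit g ` A - {c}. w x d))) (at x)"
    unfolding perm_sum_def
  proof (rule DERIV_sum)
    fix g assume "g \<in> {g. g permutes A}"
    then have g: "g permutes A" by simp
    show "((\<lambda>t. \<Prod>c\<in>orbit g ` A. w t c) has_real_derivative
       (\<Sum>c\<in>orbit g ` A. real (card c) * w x (insert j c) * (\<Prod>d\<in>orbit g ` A - {c}. w x d))) (at x)"
      by (rule has_field_derivative_prod, rule w)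
         (use permutes_orbit_subset[OF g] orbit_nonempty[of g] in fast)+
  qed
  from DERIV_mult[OF this U] show ?thesis
    by (rule DERIV_cong) (simp add: perm_sum_insert[OF fin j] algebra_simps)
qed

section \<open>A mean value theorem for mixed differences\<close>

text \<open>The iterated forward difference in inclusion-exclusion form: if \<open>F C\<close> is
  the value of a function at the vertex of a cube whose raised coordinates are \<open>C\<close>,
  this is the difference taken once in every direction of \<open>A\<close>.\<close>

definition alternating_sum :: "'i set \<Rightarrow> ('i set \<Rightarrow> 'a) \<Rightarrow> 'a::comm_ring_1" where
  "alternating_sum A F = (\<Sum>C\<in>Pow A. (-1) ^ card (A - C) * F C)"

text \<open>Subsets are sorted by whether they contain \<open>j\<close>, so that the difference in
  direction \<open>j\<close> is taken of the differences in the directions of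
  \<open>A\<close>.\<close>

lemma alternating_sum_insert:
  assumes "finite A" "j \<notin> A"
  shows "alternating_sum (insert j A) F = alternating_sum A (\<lambda>C. F (insert j C)) - alternating_sum A F"
proof -
  have inj: "inj_on (insert j) (Pow A)" using assms by (auto simp: inj_on_def)
  have "alternating_sum (insert j A) F =
     (\<Sum>C\<in>Pow A. (-1) ^ card (insert j A - C) * F C) +
     (\<Sum>C\<in>insert j ` Pow A. (-1) ^ card (insert j A - C) * F C)"
    unfolding alternating_sum_def Pow_insert using assms
    by (intro sum.union_disjoint) auto
  also have "(\<Sum>C\<in>Pow A. (-1) ^ card (insert j A - C) * F C) = - alternating_sum A F"
    unfolding alternating_sum_def sum_negf[symmetric]
  proof (rule sum.cong[OF refl])
    fix C assume "C \<in> Pow A"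
    then have "insert j A - C = insert j (A - C)" "finite (A - C)" "j \<notin> A - C" using assms by auto
    then show "(-1) ^ card (insert j A - C) * F C = - ((-1) ^ card (A - C) * F C)" by simp
  qed
  also have "(\<Sum>C\<in>insert j ` Pow A. (-1) ^ card (insert j A - C) * F C) =
     alternating_sum A (\<lambda>C. F (insert j C))"
    unfolding alternating_sum_def sum.reindex[OF inj] o_def
  proof (rule sum.cong[OF refl])
    fix C assume "C \<in> Pow A"
    then have "insert j A - insert j C = A - C" using assms by auto
    then show "(-1) ^ card (insert j A - insert j C) * F (insert j C) = (-1) ^ card (A - C) * F (insert j C)"
      by simp
  qed
  finally show ?thesis by simp
qed

text \<open>\<open>B\<close> holds the directions already differentiated, \<open>A\<close> those
  still to be differenced. The one-variable mean value theorem moves a direction from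
  \<open>A\<close> to \<open>B\<close> for a factor \<epsilon>. The family \<open>V\<close> plays
  the part of the mixed derivatives: each member is given as a partial derivative of a smaller one,
  indexed by sets, so the order of differentiation never has to be discussed.\<close>

lemma mean_value_cube_aux:
  fixes V :: "'i set \<Rightarrow> ('i \<Rightarrow> real) \<Rightarrow> real"
  assumes "finite A" "A \<inter> B = {}" "A \<union> B \<subseteq> I" "0 < \<epsilon>" "\<forall>i. s i \<in> {0..\<epsilon>}"
    and V: "\<And>B j s. B \<subseteq> I \<Longrightarrow> j \<in> I - B \<Longrightarrow> \<forall>i. s i \<in> {0..\<epsilon>} \<Longrightarrow>
        ((\<lambda>t. V B (s(j := t))) has_real_derivative V (insert j B) s) (at (s j))"
  shows "\<exists>\<xi>. (\<forall>i. \<xi> i \<in> {0..\<epsilon>}) \<and>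
     alternating_sum A (\<lambda>C. V B (\<lambda>i. if i \<in> A then if i \<in> C then \<epsilon> else 0 else s i)) = \<epsilon> ^ card A * V (A \<union> B) \<xi>"
  using assms(1,2,3,5)
proof (induction A arbitrary: B s rule: finite_induct)
  case empty
  then show ?case by (intro exI[of _ s]) (auto simp: alternating_sum_def)
next
  case (insert j A)
  let ?p = "\<lambda>A s C i. if i \<in> A then if i \<in> C then \<epsilon> else 0 else s i"
  let ?\<phi> = "\<lambda>B t. alternating_sum A (\<lambda>C. V B (?p A (s(j := t)) C))"
  have deriv: "(?\<phi> B has_real_derivative ?\<phi> (insert j B) t) (at t)" if t: "0 \<le> t" "t \<le> \<epsilon>" for t
    unfolding alternating_sum_def
  proof (rule DERIV_sum, rule DERIV_cmult)
    fix C assume "C \<in> Pow A"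
    have "((\<lambda>t'. V B ((?p A (s(j := t)) C)(j := t'))) has_real_derivative V (insert j B) (?p A (s(j := t)) C))
       (at ((?p A (s(j := t)) C) j))"
      by (rule V) (use insert.prems insert.hyps t \<open>0 < \<epsilon>\<close> in auto)
    moreover have "(?p A (s(j := t)) C)(j := t') = ?p A (s(j := t')) C" for t'
      using insert.hyps by auto
    ultimately show "((\<lambda>t. V B (?p A (s(j := t)) C)) has_real_derivative V (insert j B) (?p A (s(j := t)) C)) (at t)"
      using insert.hyps by simp
  qed
  obtain t where t: "0 < t" "t < \<epsilon>" "?\<phi> B \<epsilon> - ?\<phi> B 0 = (\<epsilon> - 0) * ?\<phi> (insert j B) t"
    using MVT2[OF \<open>0 < \<epsilon>\<close>, of "?\<phi> B" "?\<phi> (insert j B)"] deriv by blast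
  \<comment> \<open>The intermediate value \<open>t\<close> becomes the coordinate \<open>j\<close>
    of \<open>s\<close>, and \<open>j\<close> joins \<open>B\<close>; this is why both vary in the
    induction.\<close>
  have "\<exists>\<xi>. (\<forall>i. \<xi> i \<in> {0..\<epsilon>}) \<and> ?\<phi> (insert j B) t = \<epsilon> ^ card A * V (A \<union> insert j B) \<xi>"
    by (rule insert.IH) (use insert.prems insert.hyps t in auto)
  then obtain \<xi> where \<xi>: "\<forall>i. \<xi> i \<in> {0..\<epsilon>}" "?\<phi> (insert j B) t = \<epsilon> ^ card A * V (A \<union> insert j B) \<xi>"
    by blast
  have 1: "alternating_sum A (\<lambda>C. V B (?p (insert j A) s (insert j C))) = ?\<phi> B \<epsilon>"
    unfolding alternating_sum_def
    by (intro sum.cong arg_cong2[of _ _ _ _ "(*)"] arg_cong[of _ _ "V B"] ext) (use insert.hyps in auto)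
  have 2: "alternating_sum A (\<lambda>C. V B (?p (insert j A) s C)) = ?\<phi> B 0"
    unfolding alternating_sum_def
    by (intro sum.cong arg_cong2[of _ _ _ _ "(*)"] arg_cong[of _ _ "V B"] ext) (use insert.hyps in auto)
  have "alternating_sum (insert j A) (\<lambda>C. V B (?p (insert j A) s C)) = ?\<phi> B \<epsilon> - ?\<phi> B 0"
    unfolding alternating_sum_insert[OF insert.hyps] 1 2 ..
  also have "\<dots> = \<epsilon> ^ card (insert j A) * V (insert j A \<union> B) \<xi>"
    using t \<xi> insert.hyps by simp
  finally show ?case using \<xi> by blast
qed

lemma mean_value_cube:
  fixes w :: "('i \<Rightarrow> real) \<Rightarrow> 'i set \<Rightarrow> real" and U :: "('i \<Rightarrow> real) \<Rightarrow> real"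
  assumes fin: "finite I" and \<epsilon>: "0 < \<epsilon>"
    and w: "\<And>B j s. B \<subseteq> I \<Longrightarrow> B \<noteq> {} \<Longrightarrow> j \<in> I - B \<Longrightarrow> \<forall>i. s i \<in> {0..\<epsilon>} \<Longrightarrow>
        ((\<lambda>t. w (s(j := t)) B) has_real_derivative real (card B) * w s (insert j B)) (at (s j))"
    and U: "\<And>j s. j \<in> I \<Longrightarrow> \<forall>i. s i \<in> {0..\<epsilon>} \<Longrightarrow>
        ((\<lambda>t. U (s(j := t))) has_real_derivative w s {j} * U s) (at (s j))"
  shows "\<exists>\<xi>. (\<forall>i. \<xi> i \<in> {0..\<epsilon>}) \<and>
    alternating_sum I (\<lambda>C. U (\<lambda>i. if i \<in> C then \<epsilon> else 0)) = \<epsilon> ^ card I * (perm_sum (w \<xi>) I * U \<xi>)"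
proof -
  \<comment> \<open>The candidate for the mixed derivative of \<open>U\<close> in the directions of
    \<open>B\<close>. Over the empty set the sum is 1, from the identity alone, so the family starts
    at \<open>U\<close> itself.\<close>
  let ?V = "\<lambda>B s. perm_sum (w s) B * U s"
  have "\<exists>\<xi>. (\<forall>i. \<xi> i \<in> {0..\<epsilon>}) \<and>
     alternating_sum I (\<lambda>C. ?V {} (\<lambda>i. if i \<in> I then if i \<in> C then \<epsilon> else 0 else 0)) = \<epsilon> ^ card I * ?V (I \<union> {}) \<xi>"
  proof (rule mean_value_cube_aux[where I = I])
    fix B j and s :: "'i \<Rightarrow> real" assume h: "B \<subseteq> I" "j \<in> I - B" "\<forall>i. s i \<in> {0..\<epsilon>}"
    have "((\<lambda>t. ?V B (s(j := t))) has_real_derivative ?V (insert j B) (s(j := s j))) (at (s j))"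
    proof (rule perm_sum_derivative)
      show "finite B" "j \<notin> B" using h fin finite_subset by auto
      show "((\<lambda>t. w (s(j := t)) B') has_real_derivative real (card B') * w (s(j := s j)) (insert j B')) (at (s j))"
        if "B' \<subseteq> B" "B' \<noteq> {}" for B'
        using w[of B' j s] h that by auto
      show "((\<lambda>t. U (s(j := t))) has_real_derivative w (s(j := s j)) {j} * U (s(j := s j))) (at (s j))"
        using U[of j s] h by auto
    qed
    then show "((\<lambda>t. ?V B (s(j := t))) has_real_derivative ?V (insert j B) s) (at (s j))" by simp
  qed (use assms in auto)
  moreover have "perm_sum w {} = 1" for w :: "'i set \<Rightarrow> real" by (simp add: perm_sum_def)
  moreover have "alternating_sum I (\<lambda>C. U (\<lambda>i. if i \<in> I then if i \<in> C then \<epsilon> else 0 else 0))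
      = alternating_sum I (\<lambda>C. U (\<lambda>i. if i \<in> C then \<epsilon> else 0))"
    unfolding alternating_sum_def
    by (intro sum.cong arg_cong2[of _ _ _ _ "(*)"] arg_cong[of _ _ U] ext) auto
  ultimately show ?thesis by simp
qed

section \<open>Difference quotients on the Poisson side\<close>

text \<open>The sign $(-1)^{n-c(g)}$ is distributed over the cycles of \<open>g\<close>. Evaluated at the functions
  $f_i/(1+h)$ instead of $f_i$, the weights satisfy $\partial_jw_c=|c|\,w_{c\cup\{j\}}$.\<close>

definition charlier_weight ::
    "('i \<Rightarrow> 'y \<Rightarrow> real) \<Rightarrow> ('i \<Rightarrow> real) \<Rightarrow> 'y set \<Rightarrow> 'i set \<Rightarrow> real" where
  "charlier_weight f m Z B =
     (-1) ^ (card B - 1) * (\<Sum>\<^sub>\<infinity>y\<in>Z. \<Prod>i\<in>B. f i y) - (if card B = 1 then \<Sum>i\<in>B. m i else 0)"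

text \<open>Centred at \<open>s j\<close>, so that derivatives at this point are read off from an
  affine function of \<open>t - s j\<close>.\<close>

lemma sum_update_linear:
  fixes s g :: "'i \<Rightarrow> real"
  assumes "finite I" "j \<in> I"
  shows "(\<Sum>k\<in>I. (s(j := t)) k * g k) = (\<Sum>k\<in>I. s k * g k) + (t - s j) * g j"
proof -
  have "(\<Sum>k\<in>I. (s(j := t)) k * g k) - (\<Sum>k\<in>I. s k * g k) = (\<Sum>k\<in>I. if k = j then (t - s j) * g j else 0)"
    unfolding sum_subtractf[symmetric] by (rule sum.cong) (auto simp: algebra_simps)
  then show ?thesis using assms by simp
qed

text \<open>Logarithmic differentiation: ln U has derivative equal to the sum of f_j / (1 + h) over
  \<open>F\<close> minus \<open>m j\<close>, which is the weight of a one-element cycle at the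
  functions f_i / (1 + h).\<close>

lemma DERIV_charlier_density:
  fixes f :: "'i \<Rightarrow> 'y \<Rightarrow> real" and m :: "'i \<Rightarrow> real"
  assumes fin: "finite I" and j: "j \<in> I" and F: "finite F"
    and pos: "\<And>y. y \<in> F \<Longrightarrow> 1 + (\<Sum>k\<in>I. s k * f k y) > 0"
  defines "U \<equiv> \<lambda>s. (\<Prod>y\<in>F. 1 + (\<Sum>k\<in>I. s k * f k y)) * exp (- (\<Sum>k\<in>I. s k * m k))"
  shows "((\<lambda>t. U (s(j := t))) has_real_derivative
      charlier_weight (\<lambda>i y. f i y / (1 + (\<Sum>k\<in>I. s k * f k y))) m F {j} * U s) (at (s j))"
proof -
  let ?h = "\<lambda>y. 1 + (\<Sum>k\<in>I. s k * f k y)"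
  have U: "U (s(j := t)) = (\<Prod>y\<in>F. ?h y + (t - s j) * f j y) * exp (- ((\<Sum>k\<in>I. s k * m k) + (t - s j) * m j))" for t
    unfolding U_def sum_update_linear[OF fin j] by (simp add: add.assoc)
  have P: "((\<lambda>t. \<Prod>y\<in>F. ?h y + (t - s j) * f j y) has_real_derivative
     (\<Sum>y\<in>F. f j y * (\<Prod>z\<in>F - {y}. ?h z + (s j - s j) * f j z))) (at (s j))"
    by (rule has_field_derivative_prod) (auto intro!: derivative_eq_intros)
  \<comment> \<open>The product rule omits the factor at \<open>y\<close>; it is restored by
    dividing by it, which positivity permits.\<close>
  have "f j y * (\<Prod>z\<in>F - {y}. ?h z + (s j - s j) * f j z) = f j y / ?h y * (\<Prod>y\<in>F. ?h y)" if "y \<in> F" for y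
    using prod.remove[OF F that, of ?h] pos[OF that] by simp
  then have "(\<Sum>y\<in>F. f j y * (\<Prod>z\<in>F - {y}. ?h z + (s j - s j) * f j z)) = (\<Sum>y\<in>F. f j y / ?h y) * (\<Prod>y\<in>F. ?h y)"
    by (simp add: sum_distrib_right)
  with P have P': "((\<lambda>t. \<Prod>y\<in>F. ?h y + (t - s j) * f j y) has_real_derivative
     (\<Sum>y\<in>F. f j y / ?h y) * (\<Prod>y\<in>F. ?h y)) (at (s j))" by simp
  have E: "((\<lambda>t. exp (- ((\<Sum>k\<in>I. s k * m k) + (t - s j) * m j))) has_real_derivative
      - m j * exp (- (\<Sum>k\<in>I. s k * m k))) (at (s j))"
    by (auto intro!: derivative_eq_intros)
  show ?thesis
    unfolding U
    by (rule DERIV_cong[OF DERIV_mult[OF P' E]])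
       (use F in \<open>simp add: charlier_weight_def U_def algebra_simps\<close>)
qed

lemma DERIV_divide_affine_power:
  fixes c q g x :: real
  assumes "c \<noteq> 0"
  shows "((\<lambda>t. q / (c + (t - x) * g) ^ n) has_real_derivative - (real n * (q * g / c ^ Suc n))) (at x)"
proof (cases n)
  case (Suc k)
  have "((\<lambda>t. q * inverse (c + (t - x) * g) ^ n) has_real_derivative
      q * (real n * (- (inverse c * g * inverse c) * inverse c ^ k))) (at x)"
    by (rule derivative_eq_intros refl | use assms Suc in simp)+
  then show ?thesis by (simp add: Suc divide_inverse power_inverse mult_ac)
qed simp

text \<open>The summand of a cycle \<open>B\<close> is the product of its f_i divided by (1 +
  h)^|B|. Differentiating in direction \<open>j\<close> multiplies it by -|B| f_j / (1 + h): the
  factor |B|, the new index and the change of sign all come from there. The mean \<open>m i\<close>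
  of a singleton is constant and drops out.\<close>

lemma DERIV_charlier_weight:
  fixes f :: "'i \<Rightarrow> 'y \<Rightarrow> real" and m :: "'i \<Rightarrow> real"
  assumes fin: "finite I" and j: "j \<in> I - B" and B: "B \<subseteq> I" "B \<noteq> {}" and F: "finite F"
    and pos: "\<And>y. y \<in> F \<Longrightarrow> 1 + (\<Sum>k\<in>I. s k * f k y) > 0"
  defines "w \<equiv> \<lambda>s. charlier_weight (\<lambda>i y. f i y / (1 + (\<Sum>k\<in>I. s k * f k y))) m F"
  shows "((\<lambda>t. w (s(j := t)) B) has_real_derivative real (card B) * w s (insert j B)) (at (s j))"
proof -
  let ?h = "\<lambda>y. 1 + (\<Sum>k\<in>I. s k * f k y)"
  have jI: "j \<in> I" and jB: "j \<notin> B" and finB: "finite B" using j B fin finite_subset by auto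
  then have cB: "card B > 0" and cj: "card (insert j B) = Suc (card B)" using B by auto
  \<comment> \<open>The sign has the exponent \<open>card B - 1\<close> in natural subtraction; a
    successor makes it comparable with the sign for \<open>insert j B\<close>.\<close>
  obtain b where b: "card B = Suc b" using cB gr0_conv_Suc by blast
  let ?m = "if card B = 1 then \<Sum>i\<in>B. m i else 0"
  have w: "w (s(j := t)) B = (-1) ^ (card B - 1) * (\<Sum>y\<in>F. (\<Prod>i\<in>B. f i y) / (?h y + (t - s j) * f j y) ^ card B) - ?m" for t
    unfolding w_def charlier_weight_def sum_update_linear[OF fin jI]
    using F by (simp add: prod_dividef add.assoc)
  have D: "((\<lambda>t. (\<Prod>i\<in>B. f i y) / (?h y + (t - s j) * f j y) ^ card B) has_real_derivative
      - (real (card B) * ((\<Prod>i\<in>insert j B. f i y) / ?h y ^ card (insert j B)))) (at (s j))"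
    if "y \<in> F" for y
    by (rule DERIV_cong[OF DERIV_divide_affine_power]) (use pos[OF that] jB finB in \<open>auto simp: mult_ac\<close>)
  show ?thesis
    unfolding w
    by (rule DERIV_cong[OF DERIV_diff[OF DERIV_cmult[OF DERIV_sum[OF D]] DERIV_const]])
       (use F finB jB B in \<open>simp_all add: w_def charlier_weight_def prod_dividef b sum_negf sum_distrib_left
            mult.left_commute del: prod.insert\<close>)
qed

text \<open>Evaluates a linear form at the vertex of the cube whose raised coordinates are
  \<open>C\<close>.\<close>

lemma sum_indicator_scaled:
  fixes g :: "'i \<Rightarrow> real"
  assumes "finite I" "C \<subseteq> I"
  shows "(\<Sum>k\<in>I. (if k \<in> C then e else 0) * g k) = e * (\<Sum>k\<in>C. g k)"
proof -
  have "(\<Sum>k\<in>I. (if k \<in> C then e else 0) * g k) = (\<Sum>k\<in>I. if k \<in> C then e * g k else 0)"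
    by (rule sum.cong) auto
  also have "\<dots> = (\<Sum>k\<in>I \<inter> C. e * g k)" using assms by (simp add: sum.inter_restrict)
  also have "I \<inter> C = C" using assms by auto
  finally show ?thesis by (simp add: sum_distrib_left)
qed

lemma charlier_mean_value:
  fixes f :: "'i \<Rightarrow> 'y \<Rightarrow> real"
  assumes fin: "finite I" and F: "finite F" and \<epsilon>: "0 < \<epsilon>"
    and small: "\<And>y. y \<in> F \<Longrightarrow> \<epsilon> * (\<Sum>k\<in>I. \<bar>f k y\<bar>) < 1"
  shows "\<exists>\<xi>. (\<forall>i. \<xi> i \<in> {0..\<epsilon>}) \<and>
    alternating_sum I (\<lambda>C. (\<Prod>y\<in>F. 1 + \<epsilon> * (\<Sum>k\<in>C. f k y)) * exp (- (\<epsilon> * (\<Sum>k\<in>C. m k)))) =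
      \<epsilon> ^ card I * (perm_sum (charlier_weight (\<lambda>i y. f i y / (1 + (\<Sum>k\<in>I. \<xi> k * f k y))) m F) I *
        ((\<Prod>y\<in>F. 1 + (\<Sum>k\<in>I. \<xi> k * f k y)) * exp (- (\<Sum>k\<in>I. \<xi> k * m k))))"
proof -
  let ?U = "\<lambda>s. (\<Prod>y\<in>F. 1 + (\<Sum>k\<in>I. s k * f k y)) * exp (- (\<Sum>k\<in>I. s k * m k))"
  let ?w = "\<lambda>s. charlier_weight (\<lambda>i y. f i y / (1 + (\<Sum>k\<in>I. s k * f k y))) m F"
  \<comment> \<open>Positivity is needed on the whole cube and not just at its vertices, since the
    mean value theorem moves through its interior.\<close>
  have pos: "1 + (\<Sum>k\<in>I. s k * f k y) > 0" if s: "\<forall>i. s i \<in> {0..\<epsilon>}" and y: "y \<in> F" for s y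
  proof -
    have "\<bar>\<Sum>k\<in>I. s k * f k y\<bar> \<le> (\<Sum>k\<in>I. \<epsilon> * \<bar>f k y\<bar>)"
      by (rule order_trans[OF sum_abs sum_mono]) (use s in \<open>auto simp: abs_mult intro: mult_right_mono\<close>)
    also have "\<dots> < 1" using small[OF y] by (simp add: sum_distrib_left)
    finally show ?thesis by simp
  qed
  have w: "((\<lambda>t. ?w (s(j := t)) B) has_real_derivative real (card B) * ?w s (insert j B)) (at (s j))"
    if "B \<subseteq> I" "B \<noteq> {}" "j \<in> I - B" "\<forall>i. s i \<in> {0..\<epsilon>}" for B j s
    by (rule DERIV_charlier_weight[OF fin that(3,1,2) F pos[OF that(4)]])
  have U: "((\<lambda>t. ?U (s(j := t))) has_real_derivative ?w s {j} * ?U s) (at (s j))"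
    if "j \<in> I" "\<forall>i. s i \<in> {0..\<epsilon>}" for j s
    by (rule DERIV_charlier_density[OF fin that(1) F pos[OF that(2)]])
  obtain \<xi> where \<xi>: "\<forall>i. \<xi> i \<in> {0..\<epsilon>}"
    "alternating_sum I (\<lambda>C. ?U (\<lambda>i. if i \<in> C then \<epsilon> else 0)) = \<epsilon> ^ card I * (perm_sum (?w \<xi>) I * ?U \<xi>)"
    using mean_value_cube[OF fin \<epsilon>, of ?w ?U, OF w U] by blast
  have "(\<Sum>k\<in>I. (if k \<in> C then \<epsilon> else 0) * g k) = \<epsilon> * (\<Sum>k\<in>C. g k)" if "C \<in> Pow I" for C and g :: "'i \<Rightarrow> real"
    using sum_indicator_scaled[OF fin] that by blast
  then have "alternating_sum I (\<lambda>C. ?U (\<lambda>i. if i \<in> C then \<epsilon> else 0)) =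
      alternating_sum I (\<lambda>C. (\<Prod>y\<in>F. 1 + \<epsilon> * (\<Sum>k\<in>C. f k y)) * exp (- (\<epsilon> * (\<Sum>k\<in>C. m k))))"
    unfolding alternating_sum_def by (intro sum.cong refl) simp
  with \<xi> show ?thesis by (intro exI[of _ \<xi>]) simp
qed

section \<open>Unordered products and absolutely summable families\<close>

lemma abs_ln_one_plus_le:
  fixes x :: real
  assumes "\<bar>x\<bar> \<le> 1/2"
  shows "\<bar>ln (1 + x)\<bar> \<le> 2 * \<bar>x\<bar>"
proof -
  have "\<bar>ln (1 + x) - x\<bar> \<le> 2 * x\<^sup>2" using assms by (rule abs_ln_one_plus_x_minus_x_bound)
  also have "2 * x\<^sup>2 \<le> \<bar>x\<bar>"
    using mult_right_mono[OF assms, of "\<bar>x\<bar>"] by (simp add: power2_eq_square)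
  finally show ?thesis by linarith
qed

text \<open>Logarithms turn the product into an absolutely summable family: the bound 1/2 keeps the
  factors positive and makes ln(1 + h) comparable to h. As \<open>infprod\<close> is a
  \<open>Lim\<close>, a limit has to be exhibited before its value means anything.\<close>

lemma infprod_tendsto:
  fixes h :: "'y \<Rightarrow> real"
  assumes h: "(\<lambda>y. \<bar>h y\<bar>) summable_on Z" and small: "\<And>y. y \<in> Z \<Longrightarrow> \<bar>h y\<bar> \<le> 1/2"
  shows "((\<lambda>F. \<Prod>y\<in>F. 1 + h y) \<longlongrightarrow> infprod (\<lambda>y. 1 + h y) Z) (finite_subsets_at_top Z)"
proof -
  have "(\<lambda>y. \<bar>ln (1 + h y)\<bar>) summable_on Z"
    by (rule summable_on_comparison_test[OF summable_on_cmult_right[OF h, of 2]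
          abs_ln_one_plus_le[OF small] abs_ge_zero])
  then have "(\<lambda>y. ln (1 + h y)) summable_on Z"
    by (subst summable_on_iff_abs_summable_on_real) simp
  then have "((\<lambda>F. exp (\<Sum>y\<in>F. ln (1 + h y))) \<longlongrightarrow> exp (\<Sum>\<^sub>\<infinity>y\<in>Z. ln (1 + h y))) (finite_subsets_at_top Z)"
    by (intro tendsto_exp infsum_tendsto)
  moreover have "\<forall>\<^sub>F F in finite_subsets_at_top Z. exp (\<Sum>y\<in>F. ln (1 + h y)) = (\<Prod>y\<in>F. 1 + h y)"
  proof (rule eventually_finite_subsets_at_top_weakI)
    fix F assume F: "finite F" "F \<subseteq> Z"
    have "1 + h y > 0" if "y \<in> F" for y
    proof -
      have "\<bar>h y\<bar> \<le> 1/2" using small F that by blast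
      then show ?thesis by arith
    qed
    then show "exp (\<Sum>y\<in>F. ln (1 + h y)) = (\<Prod>y\<in>F. 1 + h y)"
      unfolding exp_sum[OF F(1)] by (intro prod.cong refl exp_ln)
  qed
  ultimately have L: "((\<lambda>F. \<Prod>y\<in>F. 1 + h y) \<longlongrightarrow> exp (\<Sum>\<^sub>\<infinity>y\<in>Z. ln (1 + h y))) (finite_subsets_at_top Z)"
    by (rule Lim_transform_eventually)
  show ?thesis unfolding infprod_def tendsto_Lim[OF finite_subsets_at_top_neq_bot L] by (rule L)
qed

lemma abs_le_infsum_abs:
  fixes f :: "'y \<Rightarrow> real"
  assumes "(\<lambda>y. \<bar>f y\<bar>) summable_on Z" "y \<in> Z"
  shows "\<bar>f y\<bar> \<le> (\<Sum>\<^sub>\<infinity>y\<in>Z. \<bar>f y\<bar>)"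
  using finite_sum_le_infsum[of "\<lambda>y. \<bar>f y\<bar>" Z "{y}"] assms by auto

text \<open>A summable family is bounded by its sum, so each further factor costs only a constant.
  For a fixed configuration this gives the sums attached to cycles of any length, although the
  products of the functions need not be integrable for the mean measure.\<close>

lemma summable_on_abs_prod:
  fixes f :: "'i \<Rightarrow> 'y \<Rightarrow> real"
  assumes "finite B" "B \<noteq> {}" "\<And>i. i \<in> B \<Longrightarrow> (\<lambda>y. \<bar>f i y\<bar>) summable_on Z"
  shows "(\<lambda>y. \<bar>\<Prod>i\<in>B. f i y\<bar>) summable_on Z"
  using assms
proof (induction rule: finite_ne_induct)
  case (insert i B)
  let ?M = "\<Sum>\<^sub>\<infinity>y\<in>Z. \<bar>f i y\<bar>"
  have B: "(\<lambda>y. \<bar>\<Prod>i\<in>B. f i y\<bar>) summable_on Z" using insert.IH insert.prems by blast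
  have "\<bar>\<Prod>i\<in>insert i B. f i y\<bar> \<le> ?M * \<bar>\<Prod>i\<in>B. f i y\<bar>" if "y \<in> Z" for y
    unfolding prod.insert[OF insert.hyps(1,3)] abs_mult
    by (rule mult_right_mono[OF abs_le_infsum_abs[OF _ that]]) (use insert.prems in auto)
  then show ?case
    by (rule summable_on_comparison_test[OF summable_on_cmult_right[OF B]]) auto
qed auto

lemma tendsto_perm_sum:
  fixes w :: "'a \<Rightarrow> 'i set \<Rightarrow> real"
  assumes "\<And>B. B \<subseteq> A \<Longrightarrow> B \<noteq> {} \<Longrightarrow> ((\<lambda>x. w x B) \<longlongrightarrow> w' B) \<F>"
  shows "((\<lambda>x. perm_sum (w x) A) \<longlongrightarrow> perm_sum w' A) \<F>"
  unfolding perm_sum_def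
proof (intro tendsto_sum tendsto_prod)
  fix g c assume g: "g \<in> {g. g permutes A}" and c: "c \<in> orbit g ` A"
  show "((\<lambda>x. w x c) \<longlongrightarrow> w' c) \<F>"
  proof (rule assms)
    from c obtain x where x: "c = orbit g x" "x \<in> A" by (rule imageE)
    show "c \<noteq> {}" unfolding x(1) by (rule orbit_nonempty)
    show "c \<subseteq> A" unfolding x(1) by (rule permutes_orbit_subset[OF _ x(2)]) (use g in simp)
  qed
qed

text \<open>Both 1 and \<open>1 / (1 + h) ^ b\<close> lie between
  \<open>1 / (1 + \<delta>) ^ b\<close> and \<open>1 / (1 - \<delta>) ^ b\<close>; they differ by at
  most the length of this interval, which depends on \<delta> and \<open>b\<close> alone.\<close>

lemma inverse_power_deviation:
  fixes h \<delta> :: real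
  assumes "\<bar>h\<bar> \<le> \<delta>" "\<delta> < 1"
  shows "\<bar>1 / (1 + h) ^ b - 1\<bar> \<le> 1 / (1 - \<delta>) ^ b - 1 / (1 + \<delta>) ^ b"
proof -
  have between: "1 / (1 + \<delta>) ^ b \<le> 1 / (1 + x) ^ b" "1 / (1 + x) ^ b \<le> 1 / (1 - \<delta>) ^ b"
    if "\<bar>x\<bar> \<le> \<delta>" for x :: real
    using that assms by (intro divide_left_mono power_mono mult_pos_pos zero_less_power; auto simp: abs_le_iff)+
  have "1 / (1 + \<delta>) ^ b \<le> 1" "1 \<le> 1 / (1 - \<delta>) ^ b"
    using between[of 0] assms by simp_all
  with between[OF assms(1)] show ?thesis unfolding abs_le_iff by linarith
qed

text \<open>The mean value theorem is applied to finite subsets \<open>F\<close> of \<open>Z\<close>, chosen anew for every step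
  size, so that the infinite product need not be differentiated.\<close>

lemma charlier_difference_tendsto:
  fixes f :: "'i \<Rightarrow> 'y \<Rightarrow> real" and m :: "'i \<Rightarrow> real" and \<epsilon> :: "nat \<Rightarrow> real"
  assumes fin: "finite I" and summ: "\<And>i. i \<in> I \<Longrightarrow> (\<lambda>y. \<bar>f i y\<bar>) summable_on Z"
    and pos: "\<And>k. 0 < \<epsilon> k" and lim: "\<epsilon> \<longlonglongrightarrow> 0"
  shows "(\<lambda>k. alternating_sum I (\<lambda>C. infprod (\<lambda>y. 1 + \<epsilon> k * (\<Sum>i\<in>C. f i y)) Z *
      exp (- (\<epsilon> k * (\<Sum>i\<in>C. m i)))) / \<epsilon> k ^ card I) \<longlonglongrightarrow> perm_sum (charlier_weight f m Z) I"
proof -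
  \<comment> \<open>\<open>S\<close> dominates every partial sum of the \<open>f i\<close>, and its
    total \<open>K\<close> bounds it at each point of \<open>Z\<close>. Thus
    \<open>\<epsilon> k * K\<close> controls all perturbations of the factors uniformly in the
    point.\<close>
  define S where "S y = (\<Sum>i\<in>I. \<bar>f i y\<bar>)" for y
  define K where "K = (\<Sum>\<^sub>\<infinity>y\<in>Z. S y)"
  define w where "w \<xi> F = charlier_weight (\<lambda>i y. f i y / (1 + (\<Sum>i\<in>I. \<xi> i * f i y))) m F" for \<xi> F
  define U where "U \<xi> F = (\<Prod>y\<in>F. 1 + (\<Sum>i\<in>I. \<xi> i * f i y)) * exp (- (\<Sum>i\<in>I. \<xi> i * m i))" for \<xi> F
  define D where "D k = alternating_sum I (\<lambda>C. infprod (\<lambda>y. 1 + \<epsilon> k * (\<Sum>i\<in>C. f i y)) Z *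
      exp (- (\<epsilon> k * (\<Sum>i\<in>C. m i))))" for k
  define DF where "DF k F = alternating_sum I (\<lambda>C. (\<Prod>y\<in>F. 1 + \<epsilon> k * (\<Sum>i\<in>C. f i y)) *
      exp (- (\<epsilon> k * (\<Sum>i\<in>C. m i))))" for k F
  have S: "S summable_on Z" unfolding S_def using fin summ
    by (induction rule: finite_induct) (auto intro: summable_on_add)
  have S0: "0 \<le> S y" for y unfolding S_def by (simp add: sum_nonneg)
  have sumS: "(\<Sum>y\<in>F. S y) \<le> K" if "finite F" "F \<subseteq> Z" for F
    unfolding K_def by (rule finite_sum_le_infsum[OF S that]) (rule S0)
  have SK: "S y \<le> K" if "y \<in> Z" for y using sumS[of "{y}"] that by simp
  have K0: "0 \<le> K" using sumS[of "{}"] by simp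
  have fS: "\<bar>\<Sum>i\<in>C. f i y\<bar> \<le> S y" if "C \<subseteq> I" for C y
    unfolding S_def by (rule order_trans[OF sum_abs sum_mono2]) (use fin that in auto)
  have hS: "\<bar>\<Sum>i\<in>I. \<xi> i * f i y\<bar> \<le> e * S y" if "\<forall>i. \<xi> i \<in> {0..e}" for \<xi> e y
    unfolding S_def sum_distrib_left
    by (rule order_trans[OF sum_abs sum_mono]) (use that in \<open>auto simp: abs_mult intro: mult_right_mono\<close>)

  \<comment> \<open>\<open>fst p\<close> is the finite set and \<open>snd p\<close> the intermediate
    point found on it; as a pair they are chosen together for every \<open>k\<close>. The set is
    taken large enough for all cycle sums and for the difference quotient.\<close>
  have ex: "\<exists>p. finite (fst p) \<and> fst p \<subseteq> Z \<and>
      (\<forall>B\<in>Pow I - {{}}. \<bar>(\<Sum>y\<in>fst p. \<Prod>i\<in>B. f i y) - (\<Sum>\<^sub>\<infinity>y\<in>Z. \<Prod>i\<in>B. f i y)\<bar> < \<epsilon> k) \<and>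
      (\<forall>i. snd p i \<in> {0..\<epsilon> k}) \<and>
      \<bar>D k / \<epsilon> k ^ card I - perm_sum (w (snd p) (fst p)) I * U (snd p) (fst p)\<bar> < \<epsilon> k"
    if small: "\<epsilon> k * K < 1/2" for k
  proof -
    let ?\<F> = "finite_subsets_at_top Z"
    have ev1: "\<forall>\<^sub>F F in ?\<F>. \<forall>B\<in>Pow I - {{}}.
        \<bar>(\<Sum>y\<in>F. \<Prod>i\<in>B. f i y) - (\<Sum>\<^sub>\<infinity>y\<in>Z. \<Prod>i\<in>B. f i y)\<bar> < \<epsilon> k"
    proof (rule eventually_ball_finite)
      show "\<forall>B\<in>Pow I - {{}}. \<forall>\<^sub>F F in ?\<F>.
        \<bar>(\<Sum>y\<in>F. \<Prod>i\<in>B. f i y) - (\<Sum>\<^sub>\<infinity>y\<in>Z. \<Prod>i\<in>B. f i y)\<bar> < \<epsilon> k"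
      proof
        fix B assume B: "B \<in> Pow I - {{}}"
        then have "(\<lambda>y. \<bar>\<Prod>i\<in>B. f i y\<bar>) summable_on Z"
          using fin finite_subset by (intro summable_on_abs_prod summ) auto
        then have "(\<lambda>y. \<Prod>i\<in>B. f i y) summable_on Z"
          by (subst summable_on_iff_abs_summable_on_real) simp
        from tendstoD[OF infsum_tendsto[OF this] pos]
        show "\<forall>\<^sub>F F in ?\<F>. \<bar>(\<Sum>y\<in>F. \<Prod>i\<in>B. f i y) - (\<Sum>\<^sub>\<infinity>y\<in>Z. \<Prod>i\<in>B. f i y)\<bar> < \<epsilon> k"
          by (simp add: dist_real_def)
      qed
    qed (use fin in simp)
    have "((\<lambda>F. DF k F) \<longlongrightarrow> D k) ?\<F>"
      unfolding DF_def D_def alternating_sum_def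
    proof (intro tendsto_sum tendsto_mult tendsto_const)
      fix C assume "C \<in> Pow I"
      then have b: "\<bar>\<epsilon> k * (\<Sum>i\<in>C. f i y)\<bar> \<le> \<epsilon> k * S y" for y
        using fS[of C y] pos[of k] by (simp add: abs_mult)
      show "((\<lambda>F. \<Prod>y\<in>F. 1 + \<epsilon> k * (\<Sum>i\<in>C. f i y)) \<longlongrightarrow>
          infprod (\<lambda>y. 1 + \<epsilon> k * (\<Sum>i\<in>C. f i y)) Z) ?\<F>"
      proof (rule infprod_tendsto)
        show "(\<lambda>y. \<bar>\<epsilon> k * (\<Sum>i\<in>C. f i y)\<bar>) summable_on Z"
          by (rule summable_on_comparison_test[OF summable_on_cmult_right[OF S] b abs_ge_zero])
        show "\<bar>\<epsilon> k * (\<Sum>i\<in>C. f i y)\<bar> \<le> 1/2" if "y \<in> Z" for y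
          using b[of y] mult_left_mono[OF SK[OF that], of "\<epsilon> k"] pos[of k] small by linarith
      qed
    qed
    \<comment> \<open>The tolerance carries \<open>\<epsilon> k ^ card I\<close> because the
      difference is divided by it later, which leaves the error \<open>\<epsilon> k\<close>.\<close>
    moreover have "0 < \<epsilon> k ^ card I * \<epsilon> k" using pos[of k] by simp
    ultimately have ev2: "\<forall>\<^sub>F F in ?\<F>. dist (DF k F) (D k) < \<epsilon> k ^ card I * \<epsilon> k" by (rule tendstoD)
    have ev3: "\<forall>\<^sub>F F in ?\<F>. finite F \<and> F \<subseteq> Z"
      by (rule eventually_finite_subsets_at_top_weakI) simp
    obtain F where F: "\<forall>B\<in>Pow I - {{}}. \<bar>(\<Sum>y\<in>F. \<Prod>i\<in>B. f i y) - (\<Sum>\<^sub>\<infinity>y\<in>Z. \<Prod>i\<in>B. f i y)\<bar> < \<epsilon> k"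
      "dist (DF k F) (D k) < \<epsilon> k ^ card I * \<epsilon> k" "finite F" "F \<subseteq> Z"
      using eventually_happens'[OF finite_subsets_at_top_neq_bot
          eventually_conj[OF ev1 eventually_conj[OF ev2 ev3]]] by blast
    have "\<epsilon> k * (\<Sum>i\<in>I. \<bar>f i y\<bar>) < 1" if "y \<in> F" for y
    proof -
      have "\<epsilon> k * S y \<le> \<epsilon> k * K"
        using F(4) that pos[of k] by (intro mult_left_mono SK) auto
      then show ?thesis using small unfolding S_def by linarith
    qed
    from charlier_mean_value[where f = f and m = m, OF fin F(3) pos this]
    obtain \<xi> where \<xi>: "\<forall>i. \<xi> i \<in> {0..\<epsilon> k}" "DF k F = \<epsilon> k ^ card I * (perm_sum (w \<xi> F) I * U \<xi> F)"
      unfolding w_def U_def DF_def by blast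
    have "\<bar>D k / \<epsilon> k ^ card I - perm_sum (w \<xi> F) I * U \<xi> F\<bar> = \<bar>D k - DF k F\<bar> / \<epsilon> k ^ card I"
      using pos[of k] unfolding \<xi>(2) by (simp add: abs_divide field_simps flip: abs_mult)
    also have "\<dots> < \<epsilon> k"
      using F(2) pos[of k] by (simp add: dist_real_def abs_minus_commute pos_divide_less_eq mult.commute)
    finally show ?thesis using F \<xi> by (intro exI[of _ "(F, \<xi>)"]) simp
  qed
  then obtain p where p: "\<And>k. \<epsilon> k * K < 1/2 \<Longrightarrow> finite (fst (p k)) \<and> fst (p k) \<subseteq> Z \<and>
      (\<forall>B\<in>Pow I - {{}}. \<bar>(\<Sum>y\<in>fst (p k). \<Prod>i\<in>B. f i y) - (\<Sum>\<^sub>\<infinity>y\<in>Z. \<Prod>i\<in>B. f i y)\<bar> < \<epsilon> k) \<and>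
      (\<forall>i. snd (p k) i \<in> {0..\<epsilon> k}) \<and>
      \<bar>D k / \<epsilon> k ^ card I - perm_sum (w (snd (p k)) (fst (p k))) I * U (snd (p k)) (fst (p k))\<bar> < \<epsilon> k"
    by metis
  define F where "F k = fst (p k)" for k
  define \<xi> where "\<xi> k = snd (p k)" for k
  define h where "h k y = (\<Sum>i\<in>I. \<xi> k i * f i y)" for k y
  note p = p[folded F_def \<xi>_def]
  have \<delta>: "(\<lambda>k. \<epsilon> k * K) \<longlonglongrightarrow> 0" by (rule tendsto_mult_left_zero[OF lim])
  have ev: "\<forall>\<^sub>F k in sequentially. \<epsilon> k * K < 1/2"
    by (rule order_tendstoD(2)[OF \<delta>]) simp
  have h: "\<bar>h k y\<bar> \<le> \<epsilon> k * S y" "\<bar>h k y\<bar> \<le> \<epsilon> k * K" if "\<epsilon> k * K < 1/2" "y \<in> F k" for k y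
  proof -
    have \<xi>: "\<forall>i. \<xi> k i \<in> {0..\<epsilon> k}" and "F k \<subseteq> Z" using p[OF that(1)] by auto
    then have "S y \<le> K" using SK that by blast
    then have "\<epsilon> k * S y \<le> \<epsilon> k * K" using pos[of k] by simp
    moreover show "\<bar>h k y\<bar> \<le> \<epsilon> k * S y" unfolding h_def using hS[OF \<xi>] .
    ultimately show "\<bar>h k y\<bar> \<le> \<epsilon> k * K" by linarith
  qed
  \<comment> \<open>There are two errors: dropping the denominators, controlled by
    \<open>?c k\<close> uniformly over \<open>F k\<close>, and passing from \<open>F k\<close> to
    \<open>Z\<close>, which costs less than \<open>\<epsilon> k\<close> by the choice of
    \<open>F k\<close>.\<close>
  have w: "(\<lambda>k. w (\<xi> k) (F k) B) \<longlonglongrightarrow> charlier_weight f m Z B" if B: "B \<subseteq> I" "B \<noteq> {}" for B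
  proof -
    define b where "b = card B"
    define G where "G = (\<Sum>\<^sub>\<infinity>y\<in>Z. \<bar>\<Prod>i\<in>B. f i y\<bar>)"
    have summB: "(\<lambda>y. \<bar>\<Prod>i\<in>B. f i y\<bar>) summable_on Z"
      using fin finite_subset B by (intro summable_on_abs_prod summ) auto
    let ?c = "\<lambda>k. 1 / (1 - \<epsilon> k * K) ^ b - 1 / (1 + \<epsilon> k * K) ^ b"
    have "(\<lambda>k. G * ?c k + \<epsilon> k) \<longlonglongrightarrow> G * (1 / (1 - 0) ^ b - 1 / (1 + 0) ^ b) + 0"
      by (intro tendsto_intros \<delta> lim) auto
    then have lim0: "(\<lambda>k. G * ?c k + \<epsilon> k) \<longlonglongrightarrow> 0" by simp
    have "\<forall>\<^sub>F k in sequentially. norm ((\<Sum>y\<in>F k. \<Prod>i\<in>B. f i y / (1 + h k y)) - (\<Sum>\<^sub>\<infinity>y\<in>Z. \<Prod>i\<in>B. f i y))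
        \<le> G * ?c k + \<epsilon> k"
      using ev
    proof eventually_elim
      case (elim k)
      have F: "finite (F k)" "F k \<subseteq> Z" using p[OF elim] by auto
      have c0: "0 \<le> ?c k"
        using inverse_power_deviation[of "\<epsilon> k * K" "\<epsilon> k * K" b] pos[of k] K0 elim by force
      have "\<bar>(\<Sum>y\<in>F k. \<Prod>i\<in>B. f i y / (1 + h k y)) - (\<Sum>y\<in>F k. \<Prod>i\<in>B. f i y)\<bar>
          = \<bar>\<Sum>y\<in>F k. (\<Prod>i\<in>B. f i y) * (1 / (1 + h k y) ^ b - 1)\<bar>"
        by (simp add: sum_subtractf[symmetric] prod_dividef b_def algebra_simps)
      also have "\<dots> \<le> (\<Sum>y\<in>F k. \<bar>\<Prod>i\<in>B. f i y\<bar> * ?c k)"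
        unfolding abs_mult
      proof (rule order_trans[OF sum_abs], rule sum_mono)
        fix y assume "y \<in> F k"
        then have "\<bar>1 / (1 + h k y) ^ b - 1\<bar> \<le> ?c k"
          using h(2)[OF elim] elim by (intro inverse_power_deviation) auto
        then show "\<bar>(\<Prod>i\<in>B. f i y) * (1 / (1 + h k y) ^ b - 1)\<bar> \<le> \<bar>\<Prod>i\<in>B. f i y\<bar> * ?c k"
          unfolding abs_mult by (rule mult_left_mono) simp
      qed
      also have "\<dots> = (\<Sum>y\<in>F k. \<bar>\<Prod>i\<in>B. f i y\<bar>) * ?c k" by (simp only: sum_distrib_right)
      also have "\<dots> \<le> G * ?c k"
        unfolding G_def by (rule mult_right_mono[OF finite_sum_le_infsum[OF summB F] c0]) simp
      finally have "\<bar>(\<Sum>y\<in>F k. \<Prod>i\<in>B. f i y / (1 + h k y)) - (\<Sum>y\<in>F k. \<Prod>i\<in>B. f i y)\<bar> \<le> G * ?c k" .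
      moreover have "\<bar>(\<Sum>y\<in>F k. \<Prod>i\<in>B. f i y) - (\<Sum>\<^sub>\<infinity>y\<in>Z. \<Prod>i\<in>B. f i y)\<bar> < \<epsilon> k"
        using p[OF elim] B by auto
      ultimately show ?case unfolding real_norm_def by linarith
    qed
    from Lim_null_comparison[OF this lim0]
    have "(\<lambda>k. \<Sum>y\<in>F k. \<Prod>i\<in>B. f i y / (1 + h k y)) \<longlonglongrightarrow> (\<Sum>\<^sub>\<infinity>y\<in>Z. \<Prod>i\<in>B. f i y)"
      by (rule LIM_zero_cancel)
    then have "(\<lambda>k. (-1) ^ (card B - 1) * (\<Sum>y\<in>F k. \<Prod>i\<in>B. f i y / (1 + h k y)) - (if card B = 1 then \<Sum>i\<in>B. m i else 0))
        \<longlonglongrightarrow> charlier_weight f m Z B"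
      unfolding charlier_weight_def by (intro tendsto_diff tendsto_mult tendsto_const)
    moreover have "\<forall>\<^sub>F k in sequentially. (-1) ^ (card B - 1) * (\<Sum>y\<in>F k. \<Prod>i\<in>B. f i y / (1 + h k y)) -
        (if card B = 1 then \<Sum>i\<in>B. m i else 0) = w (\<xi> k) (F k) B"
      using ev by eventually_elim (use p in \<open>simp add: w_def charlier_weight_def h_def\<close>)
    ultimately show ?thesis by (rule Lim_transform_eventually)
  qed
  \<comment> \<open>The sets \<open>F k\<close> vary with \<open>k\<close> and their sizes are not
    controlled, but the logarithm of the product is at most \<open>2 * (\<epsilon> k * K)\<close> in
    absolute value for any of them.\<close>
  have U: "(\<lambda>k. U (\<xi> k) (F k)) \<longlonglongrightarrow> 1"
  proof -
    have "(\<lambda>k. \<Sum>y\<in>F k. ln (1 + h k y)) \<longlonglongrightarrow> 0"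
    proof (rule Lim_null_comparison)
      show "\<forall>\<^sub>F k in sequentially. norm (\<Sum>y\<in>F k. ln (1 + h k y)) \<le> 2 * (\<epsilon> k * K)"
        using ev
      proof eventually_elim
        case (elim k)
        have F: "finite (F k)" "F k \<subseteq> Z" using p[OF elim] by auto
        have "norm (\<Sum>y\<in>F k. ln (1 + h k y)) \<le> (\<Sum>y\<in>F k. 2 * (\<epsilon> k * S y))"
        proof (rule order_trans[OF norm_sum], rule sum_mono)
          fix y assume y: "y \<in> F k"
          have "\<bar>ln (1 + h k y)\<bar> \<le> 2 * \<bar>h k y\<bar>"
            using h(2)[OF elim y] elim by (intro abs_ln_one_plus_le) linarith
          then show "norm (ln (1 + h k y)) \<le> 2 * (\<epsilon> k * S y)"
            using h(1)[OF elim y] by simp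
        qed
        also have "\<dots> = 2 * (\<epsilon> k * (\<Sum>y\<in>F k. S y))" by (simp only: sum_distrib_left)
        also have "\<dots> \<le> 2 * (\<epsilon> k * K)" using sumS[OF F] pos[of k] by simp
        finally show ?case .
      qed
      show "(\<lambda>k. 2 * (\<epsilon> k * K)) \<longlonglongrightarrow> 0" using tendsto_mult_right_zero[OF \<delta>, of 2] by simp
    qed
    note L = this
    have "(\<lambda>k. \<Sum>i\<in>I. \<xi> k i * m i) \<longlonglongrightarrow> (\<Sum>i\<in>I. 0 * m i)"
    proof (intro tendsto_sum tendsto_mult tendsto_const)
      fix i
      show "(\<lambda>k. \<xi> k i) \<longlonglongrightarrow> 0"
        by (rule Lim_null_comparison[OF _ lim], use ev in eventually_elim) (use p in auto)
    qed
    from tendsto_mult[OF tendsto_exp[OF L] tendsto_exp[OF tendsto_minus[OF this]]]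
    have "(\<lambda>k. exp (\<Sum>y\<in>F k. ln (1 + h k y)) * exp (- (\<Sum>i\<in>I. \<xi> k i * m i))) \<longlonglongrightarrow> exp 0 * exp (- (\<Sum>i\<in>I. 0 * m i))" .
    then have "(\<lambda>k. exp (\<Sum>y\<in>F k. ln (1 + h k y)) * exp (- (\<Sum>i\<in>I. \<xi> k i * m i))) \<longlonglongrightarrow> 1" by simp
    moreover have "\<forall>\<^sub>F k in sequentially. exp (\<Sum>y\<in>F k. ln (1 + h k y)) * exp (- (\<Sum>i\<in>I. \<xi> k i * m i)) = U (\<xi> k) (F k)"
      using ev
    proof eventually_elim
      case (elim k)
      have "finite (F k)" using p[OF elim] by auto
      moreover have "1 + h k y > 0" if "y \<in> F k" for y using h(2)[OF elim that] elim by linarith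
      ultimately show ?case by (simp add: U_def h_def exp_sum)
    qed
    ultimately show ?thesis by (rule Lim_transform_eventually)
  qed
  have "(\<lambda>k. perm_sum (w (\<xi> k) (F k)) I * U (\<xi> k) (F k)) \<longlonglongrightarrow> perm_sum (charlier_weight f m Z) I * 1"
    by (intro tendsto_mult tendsto_perm_sum w U)
  moreover have "(\<lambda>k. D k / \<epsilon> k ^ card I - perm_sum (w (\<xi> k) (F k)) I * U (\<xi> k) (F k)) \<longlonglongrightarrow> 0"
    by (rule Lim_null_comparison[OF _ lim], use ev in eventually_elim) (use p in force)
  ultimately have "(\<lambda>k. D k / \<epsilon> k ^ card I) \<longlonglongrightarrow> perm_sum (charlier_weight f m Z) I * 1"
    using tendsto_add by fastforce
  then show ?thesis unfolding D_def by simp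
qed

section \<open>Difference quotients on the Gaussian side\<close>

text \<open>The permutations that are not involutions have a cycle of weight $0$.\<close>

definition hermite_weight :: "('i set \<Rightarrow> real) \<Rightarrow> ('i \<Rightarrow> real) \<Rightarrow> 'i set \<Rightarrow> real" where
  "hermite_weight \<beta> x B =
     (if card B = 1 then \<Prod>i\<in>B. x i else if card B = 2 then - \<beta> B else 0)"

lemma hermite_weight_singleton [simp]: "hermite_weight \<beta> x {i} = x i"
  by (simp add: hermite_weight_def)

text \<open>The weight of a singleton is affine in \<open>s\<close>, and its slope
  \<open>- b i j\<close> is the weight of the pair. Pair weights do not depend on \<open>s\<close>,
  which matches the zero weight of larger sets.\<close>

lemma DERIV_hermite_weight:
  fixes b :: "'i \<Rightarrow> 'i \<Rightarrow> real" and x :: "'i \<Rightarrow> real"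
  assumes fin: "finite I" and j: "j \<in> I - B" and B: "B \<subseteq> I" "B \<noteq> {}"
    and \<beta>: "\<And>i j. i \<in> I \<Longrightarrow> j \<in> I \<Longrightarrow> i \<noteq> j \<Longrightarrow> \<beta> {i, j} = b i j"
  defines "w \<equiv> \<lambda>s. hermite_weight \<beta> (\<lambda>i. x i - (\<Sum>k\<in>I. s k * b i k))"
  shows "((\<lambda>t. w (s(j := t)) B) has_real_derivative real (card B) * w s (insert j B)) (at (s j))"
proof -
  have jI: "j \<in> I" and jB: "j \<notin> B" and finB: "finite B" using j B fin finite_subset by auto
  then have cj: "card (insert j B) = Suc (card B)" and "card B > 0" using B by auto
  then consider "card B = 1" | "card B = 2" | "card B > 2" by linarith
  then show ?thesis
  proof cases
    case 1
    then obtain i where i: "B = {i}" by (auto simp: card_1_singleton_iff)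
    then have iI: "i \<in> I" and ij: "i \<noteq> j" using B jB by auto
    have "((\<lambda>t. x i - ((\<Sum>k\<in>I. s k * b i k) + (t - s j) * b i j)) has_real_derivative - b i j) (at (s j))"
      by (auto intro!: derivative_eq_intros)
    moreover have "w s (insert j B) = - b i j"
      using \<beta>[OF jI iI] \<beta>[OF iI jI ij] ij i by (simp add: w_def hermite_weight_def insert_commute)
    moreover have "w (s(j := t)) B = x i - ((\<Sum>k\<in>I. s k * b i k) + (t - s j) * b i j)" for t
      unfolding i w_def hermite_weight_singleton sum_update_linear[OF fin jI] ..
    ultimately show ?thesis using i by simp
  next
    case 2
    then show ?thesis using cj by (simp add: w_def hermite_weight_def)
  next
    case 3
    then show ?thesis using cj by (simp add: w_def hermite_weight_def)
  qed
qed

text \<open>Symmetry of \<open>b\<close> doubles the part of the quadratic form that is linear in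
  \<open>t - s j\<close>, and this cancels the 1/2 in the exponent; the quadratic part has
  derivative 0 at \<open>s j\<close>.\<close>

lemma DERIV_hermite_density:
  fixes b :: "'i \<Rightarrow> 'i \<Rightarrow> real" and x :: "'i \<Rightarrow> real"
  assumes fin: "finite I" and j: "j \<in> I" and sym: "\<And>i j. b i j = b j i"
  defines "U \<equiv> \<lambda>s. exp ((\<Sum>i\<in>I. s i * x i) - (\<Sum>i\<in>I. s i * (\<Sum>k\<in>I. s k * b i k)) / 2)"
  shows "((\<lambda>t. U (s(j := t))) has_real_derivative (x j - (\<Sum>k\<in>I. s k * b j k)) * U s) (at (s j))"
proof -
  let ?q = "\<lambda>i. \<Sum>k\<in>I. s k * b i k"
  have "(\<Sum>i\<in>I. (s(j := t)) i * (\<Sum>k\<in>I. (s(j := t)) k * b i k)) =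
     (\<Sum>i\<in>I. s i * ?q i) + 2 * (t - s j) * ?q j + (t - s j)\<^sup>2 * b j j" for t
  proof -
    have "(\<Sum>i\<in>I. (s(j := t)) i * (\<Sum>k\<in>I. (s(j := t)) k * b i k)) =
       (\<Sum>i\<in>I. (s(j := t)) i * (?q i + (t - s j) * b i j))"
      by (simp only: sum_update_linear[OF fin j])
    also have "\<dots> = (\<Sum>i\<in>I. s i * (?q i + (t - s j) * b i j)) + (t - s j) * (?q j + (t - s j) * b j j)"
      by (rule sum_update_linear[OF fin j])
    also have "(\<Sum>i\<in>I. s i * (?q i + (t - s j) * b i j)) = (\<Sum>i\<in>I. s i * ?q i) + (t - s j) * ?q j"
      using sym by (simp add: algebra_simps sum.distrib sum_subtractf sum_distrib_left)
    finally show ?thesis by (simp add: algebra_simps power2_eq_square)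
  qed
  then have U: "U (s(j := t)) = exp ((\<Sum>i\<in>I. s i * x i) + (t - s j) * x j -
      ((\<Sum>i\<in>I. s i * ?q i) + 2 * (t - s j) * ?q j + (t - s j)\<^sup>2 * b j j) / 2)" for t
    unfolding U_def sum_update_linear[OF fin j] by simp
  have "((\<lambda>t. exp (A + (t - s j) * c - (Q + 2 * (t - s j) * q + (t - s j)\<^sup>2 * d) / 2)) has_real_derivative
     (c - q) * exp (A - Q / 2)) (at (s j))" for A c Q q d
    by (auto intro!: derivative_eq_intros)
  then show ?thesis unfolding U unfolding U_def .
qed

text \<open>\<open>x\<close> stands for one realization of the noise on the functions and
  \<open>b\<close> for their Gram matrix, so the values at the vertices are normalized exponentials.
  \<open>\<beta>\<close> lives on sets and is tied to \<open>b\<close> only off the diagonal: in the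
  application its value on a singleton is the integral of one function, not of its square.\<close>

lemma hermite_mean_value:
  fixes b :: "'i \<Rightarrow> 'i \<Rightarrow> real" and x :: "'i \<Rightarrow> real"
  assumes fin: "finite I" and \<epsilon>: "0 < \<epsilon>" and sym: "\<And>i j. b i j = b j i"
    and \<beta>: "\<And>i j. i \<in> I \<Longrightarrow> j \<in> I \<Longrightarrow> i \<noteq> j \<Longrightarrow> \<beta> {i, j} = b i j"
  shows "\<exists>\<xi>. (\<forall>i. \<xi> i \<in> {0..\<epsilon>}) \<and>
    alternating_sum I (\<lambda>C. exp (\<epsilon> * (\<Sum>i\<in>C. x i) - \<epsilon>\<^sup>2 * (\<Sum>i\<in>C. \<Sum>k\<in>C. b i k) / 2)) =
      \<epsilon> ^ card I * (perm_sum (hermite_weight \<beta> (\<lambda>i. x i - (\<Sum>k\<in>I. \<xi> k * b i k))) I *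
        exp ((\<Sum>i\<in>I. \<xi> i * x i) - (\<Sum>i\<in>I. \<xi> i * (\<Sum>k\<in>I. \<xi> k * b i k)) / 2))"
proof -
  let ?U = "\<lambda>s. exp ((\<Sum>i\<in>I. s i * x i) - (\<Sum>i\<in>I. s i * (\<Sum>k\<in>I. s k * b i k)) / 2)"
  let ?w = "\<lambda>s. hermite_weight \<beta> (\<lambda>i. x i - (\<Sum>k\<in>I. s k * b i k))"
  have w: "((\<lambda>t. ?w (s(j := t)) B) has_real_derivative real (card B) * ?w s (insert j B)) (at (s j))"
    if "B \<subseteq> I" "B \<noteq> {}" "j \<in> I - B" "\<forall>i. s i \<in> {0..\<epsilon>}" for B j s
    by (rule DERIV_hermite_weight[where \<beta> = \<beta> and b = b, OF fin that(3,1,2) \<beta>])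
  have U: "((\<lambda>t. ?U (s(j := t))) has_real_derivative ?w s {j} * ?U s) (at (s j))"
    if "j \<in> I" "\<forall>i. s i \<in> {0..\<epsilon>}" for j s
    unfolding hermite_weight_singleton by (rule DERIV_hermite_density[OF fin that(1) sym])
  obtain \<xi> where \<xi>: "\<forall>i. \<xi> i \<in> {0..\<epsilon>}"
    "alternating_sum I (\<lambda>C. ?U (\<lambda>i. if i \<in> C then \<epsilon> else 0)) = \<epsilon> ^ card I * (perm_sum (?w \<xi>) I * ?U \<xi>)"
    using mean_value_cube[OF fin \<epsilon>, of ?w ?U, OF w U] by blast
  have S: "(\<Sum>k\<in>I. (if k \<in> C then \<epsilon> else 0) * g k) = \<epsilon> * (\<Sum>k\<in>C. g k)" if "C \<in> Pow I" for C and g :: "'i \<Rightarrow> real"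
    using sum_indicator_scaled[OF fin] that by blast
  have "alternating_sum I (\<lambda>C. ?U (\<lambda>i. if i \<in> C then \<epsilon> else 0)) =
      alternating_sum I (\<lambda>C. exp (\<epsilon> * (\<Sum>i\<in>C. x i) - \<epsilon>\<^sup>2 * (\<Sum>i\<in>C. \<Sum>k\<in>C. b i k) / 2))"
    unfolding alternating_sum_def
  proof (rule sum.cong[OF refl])
    fix C assume C: "C \<in> Pow I"
    have "(\<Sum>i\<in>I. (if i \<in> C then \<epsilon> else 0) * (\<Sum>k\<in>I. (if k \<in> C then \<epsilon> else 0) * b i k)) =
       \<epsilon>\<^sup>2 * (\<Sum>i\<in>C. \<Sum>k\<in>C. b i k)"
      unfolding S[OF C] sum_distrib_left[symmetric] power2_eq_square mult.assoc ..
    then show "(-1) ^ card (I - C) * ?U (\<lambda>i. if i \<in> C then \<epsilon> else 0) =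
       (-1) ^ card (I - C) * exp (\<epsilon> * (\<Sum>i\<in>C. x i) - \<epsilon>\<^sup>2 * (\<Sum>i\<in>C. \<Sum>k\<in>C. b i k) / 2)"
      unfolding S[OF C] by simp
  qed
  with \<xi> show ?thesis by (intro exI[of _ \<xi>]) simp
qed

text \<open>A permutation has at most \<open>card A\<close> cycles, and \<open>1 \<le> R\<close>
  allows the exponent to be rounded up to that number.\<close>

lemma abs_perm_sum_le:
  fixes w :: "'i set \<Rightarrow> real"
  assumes fin: "finite A" and R: "1 \<le> R" and w: "\<And>B. B \<subseteq> A \<Longrightarrow> \<bar>w B\<bar> \<le> R"
  shows "\<bar>perm_sum w A\<bar> \<le> fact (card A) * R ^ card A"
proof -
  have "\<bar>perm_sum w A\<bar> \<le> (\<Sum>g | g permutes A. R ^ card A)"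
    unfolding perm_sum_def
  proof (rule order_trans[OF sum_abs], rule sum_mono)
    fix g assume "g \<in> {g. g permutes A}"
    then have g: "g permutes A" by simp
    have "\<bar>\<Prod>c\<in>orbit g ` A. w c\<bar> \<le> (\<Prod>c\<in>orbit g ` A. R)"
      unfolding abs_prod by (rule prod_mono) (use w permutes_orbit_subset[OF g] in auto)
    also have "\<dots> \<le> R ^ card A"
      using R fin card_image_le[OF fin, of "orbit g"] by (simp add: power_increasing)
    finally show "\<bar>\<Prod>c\<in>orbit g ` A. w c\<bar> \<le> R ^ card A" .
  qed
  also have "\<dots> = fact (card A) * R ^ card A"
    using card_permutations[OF refl fin] by simp
  finally show ?thesis .
qed

text \<open>\<open>R\<close> bounds every weight on the unit cube and also the exponent of the
  density. By \<open>R \<le> exp R\<close>, at most n = \<open>card I\<close> weights times the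
  density give at most exp((n + 1) R), and n! counts the permutations. The bound is thus an
  exponential of the sum of the \<open>\<bar>x i\<bar>\<close>, of the kind whose moments are finite
  in the Gaussian case.\<close>

lemma hermite_difference:
  fixes b :: "'i \<Rightarrow> 'i \<Rightarrow> real" and x :: "'i \<Rightarrow> real"
  assumes fin: "finite I" and \<epsilon>: "\<And>k. 0 < \<epsilon> k" "\<And>k. \<epsilon> k \<le> 1" "\<epsilon> \<longlonglongrightarrow> 0" and sym: "\<And>i j. b i j = b j i"
    and \<beta>: "\<And>i j. i \<in> I \<Longrightarrow> j \<in> I \<Longrightarrow> i \<noteq> j \<Longrightarrow> \<beta> {i, j} = b i j"
  defines "D \<equiv> \<lambda>k. alternating_sum I (\<lambda>C. exp (\<epsilon> k * (\<Sum>i\<in>C. x i) -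
      (\<epsilon> k)\<^sup>2 * (\<Sum>i\<in>C. \<Sum>j\<in>C. b i j) / 2)) / \<epsilon> k ^ card I"
    and "R \<equiv> 1 + (\<Sum>i\<in>I. \<bar>x i\<bar>) + (\<Sum>i\<in>I. \<Sum>j\<in>I. \<bar>b i j\<bar>)"
  shows "\<bar>D k\<bar> \<le> fact (card I) * exp (real (Suc (card I)) * R)"
    and "D \<longlonglongrightarrow> perm_sum (hermite_weight \<beta> x) I"
    and "\<bar>perm_sum (hermite_weight \<beta> x) I\<bar> \<le> fact (card I) * exp (real (Suc (card I)) * R)"
proof -
  let ?w = "\<lambda>s. hermite_weight \<beta> (\<lambda>i. x i - (\<Sum>k\<in>I. s k * b i k))"
  let ?U = "\<lambda>s. exp ((\<Sum>i\<in>I. s i * x i) - (\<Sum>i\<in>I. s i * (\<Sum>k\<in>I. s k * b i k)) / 2)"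
  have "\<exists>\<xi>. (\<forall>i. \<xi> i \<in> {0..\<epsilon> k}) \<and> D k = perm_sum (?w \<xi>) I * ?U \<xi>" for k
  proof -
    obtain \<xi> where \<xi>: "\<forall>i. \<xi> i \<in> {0..\<epsilon> k}"
      "alternating_sum I (\<lambda>C. exp (\<epsilon> k * (\<Sum>i\<in>C. x i) - (\<epsilon> k)\<^sup>2 * (\<Sum>i\<in>C. \<Sum>j\<in>C. b i j) / 2)) =
        \<epsilon> k ^ card I * (perm_sum (?w \<xi>) I * ?U \<xi>)"
      using hermite_mean_value[where \<beta> = \<beta> and b = b and x = x, OF fin \<epsilon>(1)[of k] sym \<beta>] by blast
    have "\<epsilon> k ^ card I \<noteq> 0" using \<epsilon>(1)[of k] by simp
    then have "D k = perm_sum (?w \<xi>) I * ?U \<xi>" unfolding D_def \<xi>(2) by (rule nonzero_mult_div_cancel_left)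
    with \<xi>(1) show ?thesis by blast
  qed
  then have "\<exists>\<xi>. \<forall>k. (\<forall>i. \<xi> k i \<in> {0..\<epsilon> k}) \<and> D k = perm_sum (?w (\<xi> k)) I * ?U (\<xi> k)"
    by (intro choice allI)
  then obtain \<xi> where \<xi>: "\<And>k i. \<xi> k i \<in> {0..\<epsilon> k}" and D: "\<And>k. D k = perm_sum (?w (\<xi> k)) I * ?U (\<xi> k)"
    by blast
  have R1: "1 \<le> R" unfolding R_def by (simp add: sum_nonneg)
  have xR: "\<bar>x i\<bar> + (\<Sum>j\<in>I. \<bar>b i j\<bar>) \<le> R" if "i \<in> I" for i
    unfolding R_def
    using member_le_sum[OF that, of "\<lambda>i. \<bar>x i\<bar>"] member_le_sum[OF that, of "\<lambda>i. \<Sum>j\<in>I. \<bar>b i j\<bar>"] fin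
    by (simp add: sum_nonneg)
  have bR: "\<bar>b i j\<bar> \<le> R" if "i \<in> I" "j \<in> I" for i j
    using xR[OF that(1)] member_le_sum[OF that(2), of "\<lambda>j. \<bar>b i j\<bar>"] fin by simp
  have bs: "\<bar>\<Sum>k\<in>I. s k * b i k\<bar> \<le> (\<Sum>k\<in>I. \<bar>b i k\<bar>)" if "\<And>k. s k \<in> {0..1}" for s i
    by (rule order_trans[OF sum_abs sum_mono]) (use that in \<open>auto simp: abs_mult intro: mult_left_le_one_le\<close>)
  \<comment> \<open>Proved on the whole unit cube: at \<open>\<xi> k\<close> it bounds the
    quotients, at the origin it bounds their limit.\<close>
  have bound: "\<bar>perm_sum (?w s) I * ?U s\<bar> \<le> fact (card I) * exp (real (Suc (card I)) * R)"
    if s: "\<And>k. s k \<in> {0..1}" for s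
  proof -
    have "\<bar>?w s B\<bar> \<le> R" if B: "B \<subseteq> I" for B
    proof -
      consider i where "B = {i}" | i j where "B = {i, j}" "i \<noteq> j" | "card B \<noteq> 1" "card B \<noteq> 2"
        by (cases "card B = 1"; cases "card B = 2") (auto simp: card_1_singleton_iff card_2_iff)
      then show ?thesis
      proof cases
        case 1
        then show ?thesis using xR[of i] bs[of s i, OF s] B by auto
      next
        case 2
        then show ?thesis using bR[of i j] \<beta>[of i j] B by (simp add: hermite_weight_def)
      next
        case 3
        then show ?thesis using R1 by (simp add: hermite_weight_def)
      qed
    qed
    from abs_perm_sum_le[OF fin R1 this]
    have P: "\<bar>perm_sum (?w s) I\<bar> \<le> fact (card I) * R ^ card I" .
    have "R \<le> exp R" using exp_ge_add_one_self[of R] by linarith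
    then have "R ^ card I \<le> exp R ^ card I" using R1 by (intro power_mono) auto
    also have "\<dots> = exp (real (card I) * R)" by (rule exp_of_nat_mult[symmetric])
    finally have E: "R ^ card I \<le> exp (real (card I) * R)" .
    have P': "\<bar>perm_sum (?w s) I\<bar> \<le> fact (card I) * exp (real (card I) * R)"
      by (rule order_trans[OF P mult_left_mono[OF E]]) simp
    have "\<bar>\<Sum>i\<in>I. s i * x i\<bar> \<le> (\<Sum>i\<in>I. \<bar>x i\<bar>)"
      by (rule order_trans[OF sum_abs sum_mono]) (use s in \<open>auto simp: abs_mult intro: mult_left_le_one_le\<close>)
    moreover have "\<bar>\<Sum>i\<in>I. s i * (\<Sum>k\<in>I. s k * b i k)\<bar> \<le> (\<Sum>i\<in>I. \<Sum>j\<in>I. \<bar>b i j\<bar>)"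
    proof (rule order_trans[OF sum_abs sum_mono])
      fix i
      have "\<bar>s i * (\<Sum>k\<in>I. s k * b i k)\<bar> \<le> 1 * (\<Sum>j\<in>I. \<bar>b i j\<bar>)"
        unfolding abs_mult using s[of i] bs[of s i, OF s] by (intro mult_mono) auto
      then show "\<bar>s i * (\<Sum>k\<in>I. s k * b i k)\<bar> \<le> (\<Sum>j\<in>I. \<bar>b i j\<bar>)" by simp
    qed
    ultimately have "(\<Sum>i\<in>I. s i * x i) - (\<Sum>i\<in>I. s i * (\<Sum>k\<in>I. s k * b i k)) / 2 \<le> R"
      unfolding R_def by (simp add: abs_le_iff)
    then have U: "?U s \<le> exp R" by simp
    have "\<bar>perm_sum (?w s) I\<bar> * ?U s \<le> (fact (card I) * exp (real (card I) * R)) * exp R"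
      by (rule mult_mono[OF P' U]) auto
    then show ?thesis by (simp add: abs_mult algebra_simps exp_add)
  qed
  show "\<bar>D k\<bar> \<le> fact (card I) * exp (real (Suc (card I)) * R)"
    unfolding D by (rule bound) (use \<xi>[of k] \<epsilon>(2)[of k] in \<open>auto intro: order_trans\<close>)
  have \<xi>0: "(\<lambda>k. \<xi> k i) \<longlonglongrightarrow> 0" for i
    by (rule Lim_null_comparison[OF _ \<epsilon>(3)]) (use \<xi> in \<open>auto intro!: always_eventually\<close>)
  have "D \<longlonglongrightarrow> perm_sum (?w (\<lambda>_. 0)) I * ?U (\<lambda>_. 0)"
    unfolding D[abs_def] hermite_weight_def
  proof (intro tendsto_mult tendsto_perm_sum)
    show "(\<lambda>k. ?U (\<xi> k)) \<longlonglongrightarrow> ?U (\<lambda>_. 0)" by (intro tendsto_intros \<xi>0) simp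
    fix B
    show "(\<lambda>k. if card B = 1 then \<Prod>i\<in>B. x i - (\<Sum>l\<in>I. \<xi> k l * b i l) else if card B = 2 then - \<beta> B else 0)
       \<longlonglongrightarrow> (if card B = 1 then \<Prod>i\<in>B. x i - (\<Sum>l\<in>I. 0 * b i l) else if card B = 2 then - \<beta> B else 0)"
    proof (cases "card B = 1")
      case True
      show ?thesis
        unfolding if_P[OF True]
        by (intro tendsto_prod tendsto_diff tendsto_const tendsto_sum tendsto_mult \<xi>0)
    qed simp
  qed
  then show "D \<longlonglongrightarrow> perm_sum (hermite_weight \<beta> x) I" by simp
  show "\<bar>perm_sum (hermite_weight \<beta> x) I\<bar> \<le> fact (card I) * exp (real (Suc (card I)) * R)"
    using bound[of "\<lambda>_. 0"] by simp
qed

section \<open>Square integrable functionals and their isometries\<close>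

lemma norm_lincomb_sq_le:
  fixes a b x y :: "'k::real_normed_field"
  shows "(norm (a * x + b * y))\<^sup>2 \<le> 2 * (norm a)\<^sup>2 * (norm x)\<^sup>2 + 2 * (norm b)\<^sup>2 * (norm y)\<^sup>2"
proof -
  have "norm (a * x + b * y) \<le> norm a * norm x + norm b * norm y"
    using norm_triangle_ineq[of "a * x" "b * y"] by (simp add: norm_mult)
  then have "(norm (a * x + b * y))\<^sup>2 \<le> (norm a * norm x + norm b * norm y)\<^sup>2"
    by (rule power_mono) simp
  also have "\<dots> \<le> 2 * (norm a * norm x)\<^sup>2 + 2 * (norm b * norm y)\<^sup>2"
    using sum_squares_bound[of "norm a * norm x" "norm b * norm y"] by (simp add: power2_sum)
  finally show ?thesis by (simp add: power_mult_distrib)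
qed

lemma L2_lincomb:
  fixes F G :: "'a \<Rightarrow> 'k::{real_normed_field, second_countable_topology}"
  assumes "F \<in> L2 M" "G \<in> L2 M"
  shows "(\<lambda>v. a * F v + b * G v) \<in> L2 M"
proof -
  have [measurable]: "F \<in> borel_measurable M" "G \<in> borel_measurable M"
    and int: "integrable M (\<lambda>w. (norm (F w))\<^sup>2)" "integrable M (\<lambda>w. (norm (G w))\<^sup>2)"
    using assms by (auto simp: L2_def)
  have "integrable M (\<lambda>v. (norm (a * F v + b * G v))\<^sup>2)"
  proof (rule Bochner_Integration.integrable_bound)
    show "integrable M (\<lambda>v. 2 * (norm a)\<^sup>2 * (norm (F v))\<^sup>2 + 2 * (norm b)\<^sup>2 * (norm (G v))\<^sup>2)"
      using int by simp
    show "AE v in M. norm ((norm (a * F v + b * G v))\<^sup>2) \<le>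
        norm (2 * (norm a)\<^sup>2 * (norm (F v))\<^sup>2 + 2 * (norm b)\<^sup>2 * (norm (G v))\<^sup>2)"
      by (intro AE_I2) (use norm_lincomb_sq_le in \<open>auto simp: abs_of_nonneg\<close>)
  qed measurable
  then show ?thesis by (simp add: L2_def)
qed

lemma L2_sum:
  fixes h :: "'i \<Rightarrow> 'y \<Rightarrow> real"
  assumes "finite I" "\<And>i. i \<in> I \<Longrightarrow> h i \<in> L2 \<mu>"
  shows "(\<lambda>y. \<Sum>i\<in>I. c i * h i y) \<in> L2 \<mu>"
  using assms
proof (induction rule: finite_induct)
  case empty
  then show ?case by (simp add: L2_def)
next
  case (insert i I)
  have "(\<lambda>y. c i * h i y + 1 * (\<Sum>i\<in>I. c i * h i y)) \<in> L2 \<mu>"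
    using insert by (intro L2_lincomb) auto
  then show ?case using insert by simp
qed

lemma L2_mult_integrable:
  fixes g h :: "'y \<Rightarrow> real"
  assumes "g \<in> L2 \<mu>" "h \<in> L2 \<mu>"
  shows "integrable \<mu> (\<lambda>y. g y * h y)"
proof (rule Bochner_Integration.integrable_bound)
  have [measurable]: "g \<in> borel_measurable \<mu>" "h \<in> borel_measurable \<mu>" using assms by (auto simp: L2_def)
  show "integrable \<mu> (\<lambda>y. (norm (g y))\<^sup>2 + (norm (h y))\<^sup>2)" using assms by (simp add: L2_def)
  show "(\<lambda>y. g y * h y) \<in> borel_measurable \<mu>" by measurable
  show "AE y in \<mu>. norm (g y * h y) \<le> norm ((norm (g y))\<^sup>2 + (norm (h y))\<^sup>2)"
  proof (intro AE_I2)
    fix y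
    have "2 * (\<bar>g y\<bar> * \<bar>h y\<bar>) \<le> \<bar>g y\<bar>\<^sup>2 + \<bar>h y\<bar>\<^sup>2"
      using sum_squares_bound[of "\<bar>g y\<bar>" "\<bar>h y\<bar>"] by (simp add: mult.assoc)
    moreover have "0 \<le> \<bar>g y\<bar> * \<bar>h y\<bar>" by simp
    ultimately show "norm (g y * h y) \<le> norm ((norm (g y))\<^sup>2 + (norm (h y))\<^sup>2)"
      unfolding real_norm_def abs_mult power2_abs abs_of_nonneg[OF sum_power2_ge_zero] by linarith
  qed
qed

section \<open>Isometries acting on representatives\<close>

lemma L2_isometry_in_range:
  assumes "L2_isometry M \<H> N \<K> \<Phi>" "F \<in> \<H>"
  shows "\<Phi> F \<in> \<K>"
proof -
  have "\<forall>F\<in>\<H>. \<Phi> F \<in> \<K>" using assms(1) unfolding L2_isometry_def by (elim conjE)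
  from this[rule_format, OF assms(2)] show ?thesis .
qed

lemma L2_isometry_cong:
  assumes "L2_isometry M \<H> N \<K> \<Phi>" "F \<in> \<H>" "G \<in> \<H>" "AE v in M. F v = G v"
  shows "AE w in N. \<Phi> F w = \<Phi> G w"
proof -
  have "\<forall>F\<in>\<H>. \<forall>G\<in>\<H>. (AE v in M. F v = G v) \<longrightarrow> (AE w in N. \<Phi> F w = \<Phi> G w)"
    using assms(1) unfolding L2_isometry_def by (elim conjE)
  from this[rule_format, OF assms(2-4)] show ?thesis .
qed

lemma L2_isometry_lincomb:
  assumes "L2_isometry M \<H> N \<K> \<Phi>" "F \<in> \<H>" "G \<in> \<H>"
  shows "AE w in N. \<Phi> (\<lambda>v. a * F v + b * G v) w = a * \<Phi> F w + b * \<Phi> G w"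
proof -
  have "\<forall>F\<in>\<H>. \<forall>G\<in>\<H>. \<forall>a b. AE w in N. \<Phi> (\<lambda>v. a * F v + b * G v) w = a * \<Phi> F w + b * \<Phi> G w"
    using assms(1) unfolding L2_isometry_def by (elim conjE)
  from this[rule_format, OF assms(2,3)] show ?thesis .
qed

lemma L2_isometry_norm:
  assumes "L2_isometry M \<H> N \<K> \<Phi>" "F \<in> \<H>"
  shows "L2_norm_sq N (\<Phi> F) = L2_norm_sq M F"
proof -
  have "\<forall>F\<in>\<H>. L2_norm_sq N (\<Phi> F) = L2_norm_sq M F"
    using assms(1) unfolding L2_isometry_def by (elim conjE)
  from this[rule_format, OF assms(2)] show ?thesis .
qed

text \<open>The linearity clause speaks of combinations of two functionals, so the induction starts
  at one summand, completed by 0 times itself.\<close>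

lemma L2_isometry_sum:
  fixes \<Phi> :: "('v \<Rightarrow> 'k::{real_normed_field, second_countable_topology}) \<Rightarrow> 'w \<Rightarrow> 'k"
  assumes iso: "L2_isometry M \<H> N \<K> \<Phi>"
    and closed: "\<And>F G a b. F \<in> \<H> \<Longrightarrow> G \<in> \<H> \<Longrightarrow> (\<lambda>v. a * F v + b * G v) \<in> \<H>"
    and fin: "finite S" and ne: "S \<noteq> {}" and F: "\<And>s. s \<in> S \<Longrightarrow> F s \<in> \<H>"
  shows "(\<lambda>v. \<Sum>s\<in>S. c s * F s v) \<in> \<H> \<and>
    (AE w in N. \<Phi> (\<lambda>v. \<Sum>s\<in>S. c s * F s v) w = (\<Sum>s\<in>S. c s * \<Phi> (F s) w))"
  using fin ne F
proof (induction rule: finite_ne_induct)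
  case (singleton s)
  have "AE w in N. \<Phi> (\<lambda>v. c s * F s v + 0 * F s v) w = c s * \<Phi> (F s) w + 0 * \<Phi> (F s) w"
    by (rule L2_isometry_lincomb[OF iso]) (use singleton in auto)
  moreover have "(\<lambda>v. c s * F s v + 0 * F s v) \<in> \<H>" by (rule closed) (use singleton in auto)
  ultimately show ?case by simp
next
  case (insert s S)
  let ?G = "\<lambda>v. \<Sum>s\<in>S. c s * F s v"
  have IH: "?G \<in> \<H>" "AE w in N. \<Phi> ?G w = (\<Sum>s\<in>S. c s * \<Phi> (F s) w)" using insert by auto
  have s: "F s \<in> \<H>" using insert by simp
  have "AE w in N. \<Phi> (\<lambda>v. c s * F s v + 1 * ?G v) w = c s * \<Phi> (F s) w + 1 * \<Phi> ?G w"
    by (rule L2_isometry_lincomb[OF iso s IH(1)])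
  with IH(2) have "AE w in N. \<Phi> (\<lambda>v. c s * F s v + 1 * ?G v) w = (\<Sum>s\<in>insert s S. c s * \<Phi> (F s) w)"
    by eventually_elim (use insert in simp)
  moreover have "(\<lambda>v. c s * F s v + 1 * ?G v) \<in> \<H>" by (rule closed[OF s IH(1)])
  ultimately show ?case using insert by simp
qed

text \<open>By linearity and the norm clause, \<Phi> (X k) - \<Phi> X' tends to 0 in L^2, hence
  almost everywhere along a subsequence. As \<open>Y\<close> converges along the whole sequence, the
  subsequence is enough to identify its limit, and no domination of \<open>Y\<close> is called
  for.\<close>

lemma L2_isometry_limit:
  fixes \<Phi> :: "('v \<Rightarrow> 'k::{real_normed_field, second_countable_topology}) \<Rightarrow> 'w \<Rightarrow> 'k"
  assumes iso: "L2_isometry M \<H> N \<K> \<Phi>"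
    and closed: "\<And>F G a b. F \<in> \<H> \<Longrightarrow> G \<in> \<H> \<Longrightarrow> (\<lambda>v. a * F v + b * G v) \<in> \<H>"
    and K: "\<K> \<subseteq> L2 N"
    and X: "\<And>k. X k \<in> \<H>" "X' \<in> \<H>"
    and lim: "(\<lambda>k. L2_norm_sq M (\<lambda>v. X k v - X' v)) \<longlonglongrightarrow> 0"
    and Y: "\<And>k::nat. AE w in N. \<Phi> (X k) w = Y k w" "AE w in N. (\<lambda>k. Y k w) \<longlonglongrightarrow> Y' w"
  shows "AE w in N. \<Phi> X' w = Y' w"
proof -
  define \<Delta> where "\<Delta> k = \<Phi> (\<lambda>v. 1 * X k v + (- 1) * X' v)" for k
  have \<Delta>: "AE w in N. \<Delta> k w = 1 * \<Phi> (X k) w + (- 1) * \<Phi> X' w" for k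
    unfolding \<Delta>_def by (rule L2_isometry_lincomb[OF iso X])
  have dom: "(\<lambda>v. 1 * X k v + (- 1) * X' v) \<in> \<H>" for k by (rule closed[OF X])
  have "\<Delta> k \<in> \<K>" for k unfolding \<Delta>_def by (rule L2_isometry_in_range[OF iso dom])
  then have int: "integrable N (\<lambda>w. (norm (\<Delta> k w))\<^sup>2)" for k using K by (auto simp: L2_def)
  have "L2_norm_sq N (\<Delta> k) = L2_norm_sq M (\<lambda>v. X k v - X' v)" for k
  proof -
    have "L2_norm_sq N (\<Delta> k) = L2_norm_sq M (\<lambda>v. 1 * X k v + (- 1) * X' v)"
      unfolding \<Delta>_def by (rule L2_isometry_norm[OF iso dom])
    then show ?thesis by simp
  qed
  with lim have "(\<lambda>k. \<integral>w. norm ((norm (\<Delta> k w))\<^sup>2) \<partial>N) \<longlonglongrightarrow> 0"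
    by (simp add: L2_norm_sq_def)
  from tendsto_L1_AE_subseq[OF int this]
  obtain r :: "nat \<Rightarrow> nat" where r: "strict_mono r" "AE w in N. (\<lambda>k. (norm (\<Delta> (r k) w))\<^sup>2) \<longlonglongrightarrow> 0" by blast
  have "AE w in N. \<forall>k. \<Delta> k w = 1 * \<Phi> (X k) w + (- 1) * \<Phi> X' w" using \<Delta> by (simp add: AE_all_countable)
  moreover have "AE w in N. \<forall>k. \<Phi> (X k) w = Y k w" using Y(1) by (simp add: AE_all_countable)
  ultimately show ?thesis using r(2) Y(2)
  proof eventually_elim
    case (elim w)
    have "(\<lambda>k. sqrt ((norm (\<Delta> (r k) w))\<^sup>2)) \<longlonglongrightarrow> sqrt 0" by (intro tendsto_real_sqrt elim(3))
    then have "(\<lambda>k. \<Delta> (r k) w) \<longlonglongrightarrow> 0" by (simp add: tendsto_norm_zero_iff)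
    then have "(\<lambda>k. Y (r k) w - \<Phi> X' w) \<longlonglongrightarrow> 0" using elim(1,2) by simp
    then have "(\<lambda>k. Y (r k) w) \<longlonglongrightarrow> \<Phi> X' w" by (rule LIM_zero_cancel)
    moreover have "(\<lambda>k. Y (r k) w) \<longlonglongrightarrow> Y' w"
      using LIMSEQ_subseq_LIMSEQ[OF elim(4) r(1)] by (simp add: o_def)
    ultimately show ?case by (rule LIMSEQ_unique)
  qed
qed

section \<open>Measurability with respect to the generating process\<close>

lemma
  assumes X: "\<And>i. i \<in> I \<Longrightarrow> X i \<in> borel_measurable M"
  shows measurable_generated_algebra: "i \<in> I \<Longrightarrow> X i \<in> borel_measurable (generated_algebra M I X)"
    and subalgebra_generated_algebra: "subalgebra M (generated_algebra M I X)"
proof -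
  let ?E = "{X i -` B \<inter> space M | i B. i \<in> I \<and> B \<in> sets borel}"
  have E: "?E \<subseteq> Pow (space M)" by auto
  have sp: "space (generated_algebra M I X) = space M"
    unfolding generated_algebra_def by (rule space_measure_of[OF E])
  have sets: "sets (generated_algebra M I X) = sigma_sets (space M) ?E"
    unfolding generated_algebra_def by (rule sets_measure_of[OF E])
  show "X i \<in> borel_measurable (generated_algebra M I X)" if "i \<in> I"
    by (rule measurableI) (use that in \<open>auto simp: sp sets intro!: sigma_sets.Basic\<close>)
  have "?E \<subseteq> sets M" using X by (auto intro: measurable_sets)
  then show "subalgebra M (generated_algebra M I X)"
    unfolding subalgebra_def sp sets using sets.sigma_sets_subset by blast
qed

lemma L2_functionalsI:
  assumes "F \<in> L2 M" "F' \<in> borel_measurable (generated_algebra M I X)" "AE w in M. F w = F' w"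
  shows "F \<in> L2_functionals M I X"
  unfolding L2_functionals_def by (intro CollectI conjI bexI[of _ F'] assms)

lemma L2_functionalsE:
  assumes "F \<in> L2_functionals M I X"
  obtains F' where "F \<in> L2 M" "F' \<in> borel_measurable (generated_algebra M I X)" "AE w in M. F w = F' w"
  using assms unfolding L2_functionals_def by (elim CollectE conjE bexE)

lemma L2_functionals_lincomb:
  assumes "F \<in> L2_functionals M I X" "G \<in> L2_functionals M I X"
  shows "(\<lambda>v. a * F v + b * G v) \<in> L2_functionals M I X"
proof -
  obtain F' where F: "F \<in> L2 M" "AE w in M. F w = F' w"
    and [measurable]: "F' \<in> borel_measurable (generated_algebra M I X)"
    using assms(1) by (rule L2_functionalsE)
  obtain G' where G: "G \<in> L2 M" "AE w in M. G w = G' w"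
    and [measurable]: "G' \<in> borel_measurable (generated_algebra M I X)"
    using assms(2) by (rule L2_functionalsE)
  show ?thesis
  proof (rule L2_functionalsI)
    show "(\<lambda>v. a * F v + b * G v) \<in> L2 M" by (rule L2_lincomb[OF F(1) G(1)])
    show "(\<lambda>v. a * F' v + b * G' v) \<in> borel_measurable (generated_algebra M I X)" by measurable
    show "AE w in M. a * F w + b * G w = a * F' w + b * G' w"
      using F(2) G(2) by eventually_elim simp
  qed
qed

lemma of_real_in_L2_functionals:
  assumes X: "\<And>i. i \<in> I \<Longrightarrow> X i \<in> borel_measurable M"
    and g: "g \<in> borel_measurable (generated_algebra M I X)"
    and int: "integrable M (\<lambda>w. (g w)\<^sup>2)"
  shows "(\<lambda>w. of_real (g w) :: 'k::{real_normed_field, second_countable_topology}) \<in> L2_functionals M I X"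
proof -
  let ?G = "\<lambda>w. of_real (g w) :: 'k"
  have m: "?G \<in> borel_measurable (generated_algebra M I X)"
    by (rule measurable_compose[OF g borel_measurable_of_real])
  have "subalgebra M (generated_algebra M I X)" by (rule subalgebra_generated_algebra[OF X])
  then have "?G \<in> borel_measurable M" using m by (rule measurable_from_subalg)
  moreover have "integrable M (\<lambda>w. (norm (?G w))\<^sup>2)" using int by simp
  ultimately have "?G \<in> L2 M" by (simp add: L2_def)
  then show ?thesis by (rule L2_functionalsI[OF _ m]) simp
qed

text \<open>The underlying measure need not be complete, so measurability does not pass to
  \<open>G\<close> along the almost everywhere equality and is asked for separately.\<close>

lemma L2_functionals_cong_AE:
  assumes "F \<in> L2_functionals M I X" "AE w in M. F w = G w" "G \<in> borel_measurable M"
  shows "G \<in> L2_functionals M I X"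
proof -
  obtain F' where F: "F \<in> L2 M" "AE w in M. F w = F' w"
    and F': "F' \<in> borel_measurable (generated_algebra M I X)"
    using assms(1) by (rule L2_functionalsE)
  have [measurable]: "F \<in> borel_measurable M" using F(1) by (simp add: L2_def)
  note [measurable] = assms(3)
  have "integrable M (\<lambda>w. (norm (G w))\<^sup>2) \<longleftrightarrow> integrable M (\<lambda>w. (norm (F w))\<^sup>2)"
  proof (rule integrable_cong_AE)
    show "AE w in M. (norm (G w))\<^sup>2 = (norm (F w))\<^sup>2" using assms(2) by eventually_elim simp
  qed measurable
  then have "G \<in> L2 M" using F(1) assms(3) by (simp add: L2_def)
  moreover have "AE w in M. G w = F' w" using assms(2) F(2) by eventually_elim simp
  ultimately show ?thesis by (rule L2_functionalsI[OF _ F'])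
qed

section \<open>Gaussian white noise\<close>

lemma white_noise_measurable:
  assumes "gaussian_white_noise M \<mu> W" "h \<in> L2 \<mu>"
  shows "W h \<in> borel_measurable M"
proof -
  have "\<forall>h\<in>L2 \<mu>. W h \<in> borel_measurable M"
    using assms(1) unfolding gaussian_white_noise_def by (elim conjE)
  from this[rule_format, OF assms(2)] show ?thesis .
qed

lemma white_noise_lincomb:
  assumes "gaussian_white_noise M \<mu> W" "h \<in> L2 \<mu>" "g \<in> L2 \<mu>"
  shows "AE w in M. W (\<lambda>y. a * h y + b * g y) w = a * W h w + b * W g w"
proof -
  have "\<forall>h\<in>L2 \<mu>. \<forall>g\<in>L2 \<mu>. \<forall>a b. AE w in M. W (\<lambda>y. a * h y + b * g y) w = a * W h w + b * W g w"
    using assms(1) unfolding gaussian_white_noise_def by (elim conjE)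
  from this[rule_format, OF assms(2,3)] show ?thesis .
qed

lemma white_noise_char:
  assumes "gaussian_white_noise M \<mu> W" "h \<in> L2 \<mu>"
  shows "(\<integral>w. exp (\<i> * complex_of_real (W h w)) \<partial>M) = complex_of_real (exp (- L2_norm_sq \<mu> h / 2))"
proof -
  have "\<forall>h\<in>L2 \<mu>. (\<integral>w. exp (\<i> * complex_of_real (W h w)) \<partial>M) = complex_of_real (exp (- L2_norm_sq \<mu> h / 2))"
    using assms(1) unfolding gaussian_white_noise_def by (elim conjE)
  from this[rule_format, OF assms(2)] show ?thesis .
qed

text \<open>Completing the square: the integrand is a multiple of the normal density with mean
  \<open>c\<close>.\<close>

lemma integrable_exp_std_normal: "integrable std_normal_distribution (\<lambda>x. exp (c * x))"
proof -
  have "std_normal_density x * exp (c * x) = exp (c\<^sup>2 / 2) * normal_density c 1 x" for x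
  proof -
    have "- x\<^sup>2 / 2 + c * x = c\<^sup>2 / 2 + - (x - c)\<^sup>2 / 2"
      by (simp add: power2_eq_square algebra_simps diff_divide_distrib add_divide_distrib)
    then have "exp (- x\<^sup>2 / 2) * exp (c * x) = exp (c\<^sup>2 / 2) * exp (- (x - c)\<^sup>2 / 2)"
      by (simp only: exp_add[symmetric])
    then show ?thesis by (simp add: normal_density_def mult.left_commute mult.commute)
  qed
  then have "integrable lborel (\<lambda>x. std_normal_density x * exp (c * x))" by simp
  then show ?thesis by (subst integrable_density) auto
qed

text \<open>The definition gives one value of the characteristic function of \<open>W h\<close>, at
  1; the value at \<open>t\<close> is obtained from \<open>t * h\<close> and linearity. Writing the
  law as the image of a standard normal variable under scaling covers the degenerate case of norm 0
  as well.\<close>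

lemma white_noise_distr:
  assumes wn: "gaussian_white_noise M \<mu> W" and h: "h \<in> L2 \<mu>"
  shows "distr M borel (W h) = distr std_normal_distribution borel (\<lambda>x. sqrt (L2_norm_sq \<mu> h) * x)"
proof -
  interpret prob_space M using wn by (simp add: gaussian_white_noise_def)
  interpret N: real_distribution std_normal_distribution by (rule real_dist_normal_dist)
  have W: "W g \<in> borel_measurable M" if "g \<in> L2 \<mu>" for g by (rule white_noise_measurable[OF wn that])
  note [measurable] = W[OF h]
  have n0: "0 \<le> L2_norm_sq \<mu> h" by (simp add: L2_norm_sq_def)
  show ?thesis
  proof (rule Levy_uniqueness)
    show "real_distribution (distr M borel (W h))" by (rule real_distribution_distr) measurable
    show "real_distribution (distr std_normal_distribution borel (\<lambda>x. sqrt (L2_norm_sq \<mu> h) * x))"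
      by (rule N.real_distribution_distr) measurable
    show "char (distr M borel (W h)) = char (distr std_normal_distribution borel (\<lambda>x. sqrt (L2_norm_sq \<mu> h) * x))"
    proof
      fix t
      \<comment> \<open>The summand \<open>0 * h y\<close> gives the function the two-term form of
        the linearity clause.\<close>
      let ?g = "\<lambda>y. t * h y + 0 * h y"
      have g: "?g \<in> L2 \<mu>" by (rule L2_lincomb[OF h h])
      note [measurable] = W[OF g]
      have norm: "L2_norm_sq \<mu> ?g = t\<^sup>2 * L2_norm_sq \<mu> h"
        by (simp add: L2_norm_sq_def abs_mult power_mult_distrib)
      have "AE w in M. W ?g w = t * W h w + 0 * W h w"
        by (rule white_noise_lincomb[OF wn h h])
      then have ae: "AE w in M. W ?g w = t * W h w" by simp
      have "char (distr M borel (W h)) t = (\<integral>w. exp (\<i> * complex_of_real (t * W h w)) \<partial>M)"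
        unfolding char_def by (subst integral_distr) simp_all
      also have "\<dots> = (\<integral>w. exp (\<i> * complex_of_real (W ?g w)) \<partial>M)"
        by (rule integral_cong_AE) (measurable, use ae in \<open>auto elim: eventually_mono\<close>)
      also have "\<dots> = complex_of_real (exp (- L2_norm_sq \<mu> ?g / 2))"
        by (rule white_noise_char[OF wn g])
      also have "\<dots> = char std_normal_distribution (t * sqrt (L2_norm_sq \<mu> h))"
        unfolding char_std_normal_distribution norm using n0 by (simp add: power_mult_distrib)
      also have "\<dots> = char (distr std_normal_distribution borel (\<lambda>x. sqrt (L2_norm_sq \<mu> h) * x)) t"
        unfolding char_def by (subst integral_distr) (simp_all add: mult.assoc)
      finally show "char (distr M borel (W h)) t =
          char (distr std_normal_distribution borel (\<lambda>x. sqrt (L2_norm_sq \<mu> h) * x)) t" .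
    qed
  qed
qed

lemma white_noise_exp_integrable:
  assumes wn: "gaussian_white_noise M \<mu> W" and h: "h \<in> L2 \<mu>"
  shows "integrable M (\<lambda>v. exp (c * W h v))"
proof -
  have [measurable]: "W h \<in> borel_measurable M" by (rule white_noise_measurable[OF assms])
  have "integrable (distr std_normal_distribution borel (\<lambda>x. sqrt (L2_norm_sq \<mu> h) * x)) (\<lambda>x. exp (c * x))"
    by (subst integrable_distr_eq) (use integrable_exp_std_normal[of "c * sqrt (L2_norm_sq \<mu> h)"] in \<open>simp_all add: mult.assoc\<close>)
  then have "integrable (distr M borel (W h)) (\<lambda>x. exp (c * x))"
    unfolding white_noise_distr[OF assms] .
  then show ?thesis by (subst (asm) integrable_distr_eq) simp_all
qed

text \<open>No joint law is used: the sum of the absolute values is at most \<open>card I\<close>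
  times the largest one, and the exponential of that is at most a sum of exponentials of single
  Gaussian variables with both signs.\<close>

lemma white_noise_exp_abs_sum_integrable:
  assumes wn: "gaussian_white_noise M \<mu> W" and fin: "finite I" and h: "\<And>i. i \<in> I \<Longrightarrow> h i \<in> L2 \<mu>"
    and c: "0 \<le> c"
  shows "integrable M (\<lambda>v. exp (c * (\<Sum>i\<in>I. \<bar>W (h i) v\<bar>)))"
proof -
  interpret prob_space M using wn by (simp add: gaussian_white_noise_def)
  have W: "W (h i) \<in> borel_measurable M" if "i \<in> I" for i
    by (rule white_noise_measurable[OF wn h[OF that]])
  let ?d = "c * real (card I)"
  \<comment> \<open>The summand 1 takes care of empty \<open>I\<close>.\<close>
  have int: "integrable M (\<lambda>v. 1 + (\<Sum>i\<in>I. exp (?d * W (h i) v) + exp (- ?d * W (h i) v)))"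
    by (intro Bochner_Integration.integrable_add integrable_const Bochner_Integration.integrable_sum
        white_noise_exp_integrable[OF wn h])
  show ?thesis
  proof (rule Bochner_Integration.integrable_bound[OF int])
    show "(\<lambda>v. exp (c * (\<Sum>i\<in>I. \<bar>W (h i) v\<bar>))) \<in> borel_measurable M"
      using W by measurable
    show "AE v in M. norm (exp (c * (\<Sum>i\<in>I. \<bar>W (h i) v\<bar>))) \<le>
        norm (1 + (\<Sum>i\<in>I. exp (?d * W (h i) v) + exp (- ?d * W (h i) v)))"
    proof (intro AE_I2)
      fix v
      let ?e = "\<lambda>i. exp (?d * W (h i) v) + exp (- ?d * W (h i) v)"
      have pos: "0 \<le> (\<Sum>i\<in>I. ?e i)" by (intro sum_nonneg add_nonneg_nonneg) auto
      have "exp (c * (\<Sum>i\<in>I. \<bar>W (h i) v\<bar>)) \<le> 1 + (\<Sum>i\<in>I. ?e i)"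
      proof (cases "I = {}")
        case False
        define m where "m = Max ((\<lambda>i. \<bar>W (h i) v\<bar>) ` I)"
        have "m \<in> (\<lambda>i. \<bar>W (h i) v\<bar>) ` I" unfolding m_def using fin False by (intro Max_in) auto
        then obtain i where i: "i \<in> I" "m = \<bar>W (h i) v\<bar>" by blast
        have "(\<Sum>i\<in>I. \<bar>W (h i) v\<bar>) \<le> real (card I) * m"
          by (rule sum_bounded_above) (use fin in \<open>simp add: m_def\<close>)
        then have "c * (\<Sum>i\<in>I. \<bar>W (h i) v\<bar>) \<le> ?d * \<bar>W (h i) v\<bar>"
          using mult_left_mono[OF _ c] i(2) by (simp add: mult.assoc)
        then have "exp (c * (\<Sum>i\<in>I. \<bar>W (h i) v\<bar>)) \<le> exp (?d * \<bar>W (h i) v\<bar>)" by simp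
        also have "\<dots> \<le> ?e i" by (cases "W (h i) v \<ge> 0") auto
        also have "\<dots> \<le> (\<Sum>i\<in>I. ?e i)" by (rule member_le_sum) (use i fin in auto)
        finally show ?thesis by simp
      qed simp
      then show "norm (exp (c * (\<Sum>i\<in>I. \<bar>W (h i) v\<bar>))) \<le> norm (1 + (\<Sum>i\<in>I. ?e i))"
        using pos by simp
    qed
  qed
qed

lemma white_noise_sum:
  assumes wn: "gaussian_white_noise M \<mu> W" and fin: "finite I" and h: "\<And>i. i \<in> I \<Longrightarrow> h i \<in> L2 \<mu>"
  shows "AE v in M. W (\<lambda>y. \<Sum>i\<in>I. c i * h i y) v = (\<Sum>i\<in>I. c i * W (h i) v)"
  using fin h
proof (induction rule: finite_induct)
  case empty
  have z: "(\<lambda>y. 0) \<in> L2 \<mu>" by (simp add: L2_def)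
  \<comment> \<open>Linearity with both coefficients 0 shows that \<open>W\<close> vanishes almost
    everywhere on the zero function.\<close>
  have "AE v in M. W (\<lambda>y. 0 * 0 + 0 * 0) v = 0 * W (\<lambda>y. 0) v + 0 * W (\<lambda>y. 0) v"
    by (rule white_noise_lincomb[OF wn z z])
  then show ?case by simp
next
  case (insert i I)
  let ?g = "\<lambda>y. \<Sum>i\<in>I. c i * h i y"
  have g: "?g \<in> L2 \<mu>" and hi: "h i \<in> L2 \<mu>" using insert by (auto intro!: L2_sum)
  have "AE v in M. W (\<lambda>y. c i * h i y + 1 * ?g y) v = c i * W (h i) v + 1 * W ?g v"
    by (rule white_noise_lincomb[OF wn hi g])
  moreover have "AE v in M. W ?g v = (\<Sum>i\<in>I. c i * W (h i) v)" using insert by auto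
  ultimately show ?case by eventually_elim (use insert in simp)
qed

section \<open>Poisson processes\<close>

lemma poisson_process_prob_space:
  assumes "poisson_process N \<mu> Z"
  shows "prob_space N"
  using assms unfolding poisson_process_def by (elim conjE)

lemma poisson_process_subset:
  assumes "poisson_process N \<mu> Z" "w \<in> space N"
  shows "Z w \<subseteq> space \<mu>"
proof -
  have "\<forall>w\<in>space N. Z w \<subseteq> space \<mu>" using assms(1) unfolding poisson_process_def by (elim conjE)
  from this[rule_format, OF assms(2)] show ?thesis .
qed

lemma num_points_measurable:
  assumes "poisson_process N \<mu> Z" "A \<in> sets \<mu>"
  shows "num_points Z A \<in> borel_measurable N"
proof -
  have "\<forall>A\<in>sets \<mu>. num_points Z A \<in> borel_measurable N"
    using assms(1) unfolding poisson_process_def by (elim conjE)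
  from this[rule_format, OF assms(2)] show ?thesis .
qed

lemma num_points_distribution:
  assumes "poisson_process N \<mu> Z" "A \<in> sets \<mu>" "emeasure \<mu> A < \<infinity>"
  shows "measure N {w \<in> space N. num_points Z A w = of_nat k} =
     exp (- measure \<mu> A) * measure \<mu> A ^ k / fact k"
proof -
  have "\<forall>A\<in>sets \<mu>. emeasure \<mu> A < \<infinity> \<longrightarrow>
        (\<forall>k::nat. measure N {w \<in> space N. num_points Z A w = of_nat k}
                    = exp (- measure \<mu> A) * measure \<mu> A ^ k / fact k)"
    using assms(1) unfolding poisson_process_def by (elim conjE)
  from this[rule_format, OF assms(2,3)] show ?thesis .
qed

text \<open>The mean of a Poisson variable is its parameter. The definition supplies the
  probabilities of finite counts; since these sum to 1, an infinite count has probability 0.\<close>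

lemma nn_integral_num_points_le:
  assumes pp: "poisson_process N \<mu> Z" and A: "A \<in> sets \<mu>"
  shows "(\<integral>\<^sup>+w. num_points Z A w \<partial>N) \<le> emeasure \<mu> A"
proof (cases "emeasure \<mu> A < \<infinity>")
  case True
  interpret prob_space N by (rule poisson_process_prob_space[OF pp])
  define l where "l = measure \<mu> A"
  define E where "E k = {w \<in> space N. num_points Z A w = of_nat k}" for k :: nat
  define q where "q k = exp (- l) * (l ^ k / fact k)" for k :: nat
  have l0: "0 \<le> l" by (simp add: l_def)
  note [measurable] = num_points_measurable[OF pp A]
  have E[measurable]: "E k \<in> sets N" for k unfolding E_def by measurable
  have disj: "disjoint_family E" unfolding disjoint_family_on_def E_def by auto
  have P: "measure N (E k) = q k" for k
    using num_points_distribution[OF pp A True, of k] by (simp add: E_def q_def l_def)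
  have "(\<lambda>k. l ^ k / fact k) sums exp l"
    using exp_converges[of l] by (simp add: divide_inverse scaleR_conv_of_real mult.commute)
  from sums_mult[OF this, of "exp (- l)"] have q: "q sums 1"
    by (simp add: q_def[abs_def] exp_minus)
  have "(\<lambda>k. measure N (E k)) sums measure N (\<Union>k. E k)"
    by (rule finite_measure_UNION[OF _ disj]) auto
  then have "(\<lambda>k. q k) sums measure N (\<Union>k. E k)" unfolding P .
  then have "measure N (\<Union>k. E k) = 1" using q by (rule sums_unique2)
  then have ae: "AE w in N. w \<in> (\<Union>k. E k)" by (rule AE_prob_1)
  \<comment> \<open>Shifting the index cancels one factor of the factorial, so the mean is
    \<open>l\<close> times the total mass 1.\<close>
  have "(\<lambda>k. real (Suc k) * q (Suc k)) sums l"
  proof -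
    have "real (Suc k) * q (Suc k) = l * q k" for k
      by (simp add: q_def fact_Suc del: of_nat_Suc)
    then show ?thesis using sums_mult[OF q, of l] by simp
  qed
  then have kq: "(\<lambda>k. real k * q k) sums l"
    using sums_Suc[where f = "\<lambda>k. real k * q k"] by fastforce
  have "(\<integral>\<^sup>+w. num_points Z A w \<partial>N) = (\<integral>\<^sup>+w. (\<Sum>k. of_nat k * indicator (E k) w) \<partial>N)"
  proof (rule nn_integral_cong_AE, use ae in eventually_elim)
    case (elim w)
    then obtain k where k: "w \<in> E k" by blast
    have "(\<Sum>j. of_nat j * indicator (E j) w :: ennreal) = (\<Sum>j\<in>{k}. of_nat j * indicator (E j) w)"
    proof (rule suminf_finite)
      fix j assume "j \<notin> {k}"
      then have "w \<notin> E j" using k disj unfolding disjoint_family_on_def by blast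
      then show "(of_nat j * indicator (E j) w :: ennreal) = 0" by simp
    qed simp
    also have "\<dots> = num_points Z A w" using k by (simp add: E_def)
    finally show ?case by simp
  qed
  also have "\<dots> = (\<Sum>k. \<integral>\<^sup>+w. of_nat k * indicator (E k) w \<partial>N)"
    by (rule nn_integral_suminf) measurable
  also have "\<dots> = (\<Sum>k. ennreal (real k * q k))"
  proof (rule suminf_cong)
    fix k
    have "q k \<ge> 0" using l0 by (simp add: q_def)
    then have "ennreal (real k * q k) = of_nat k * ennreal (q k)"
      by (simp add: ennreal_mult ennreal_of_nat_eq_real_of_nat)
    moreover have "emeasure N (E k) = ennreal (q k)" by (simp add: emeasure_eq_measure P)
    ultimately show "(\<integral>\<^sup>+w. of_nat k * indicator (E k) w \<partial>N) = ennreal (real k * q k)"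
      by (simp add: nn_integral_cmult_indicator)
  qed
  also have "\<dots> = ennreal l"
    by (rule suminf_ennreal_eq[OF _ kq]) (use l0 in \<open>simp add: q_def\<close>)
  also have "\<dots> = emeasure \<mu> A" using True by (simp add: l_def emeasure_eq_ennreal_measure top.not_eq_extremum)
  finally show ?thesis by simp
next
  case False
  then have "emeasure \<mu> A = top" using top.not_eq_extremum[of "emeasure \<mu> A"] by simp
  then show ?thesis by simp
qed

text \<open>One half of Campbell's formula, the half on which almost sure summability rests. Sums
  over points are integrals against counting measure, so monotone convergence applies to them.
  Measurability is carried along because the outer integral splits over sums and limits only for
  measurable integrands.\<close>

lemma poisson_process_nn_sum:
  fixes f :: "'y \<Rightarrow> ennreal"
  assumes pp: "poisson_process N \<mu> Z" and f: "f \<in> borel_measurable \<mu>"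
  shows "(\<lambda>w. \<integral>\<^sup>+y. f y \<partial>count_space (Z w)) \<in> borel_measurable N \<and>
    (\<integral>\<^sup>+w. (\<integral>\<^sup>+y. f y \<partial>count_space (Z w)) \<partial>N) \<le> (\<integral>\<^sup>+y. f y \<partial>\<mu>)"
  using f
proof (induction rule: borel_measurable_induct)
  case (cong f g)
  \<comment> \<open>\<open>f\<close> and \<open>g\<close> agree on \<open>space \<mu>\<close> only;
    the points of the process lie in it.\<close>
  have eq: "(\<integral>\<^sup>+y. f y \<partial>count_space (Z w)) = (\<integral>\<^sup>+y. g y \<partial>count_space (Z w))" if "w \<in> space N" for w
    by (rule nn_integral_cong) (use cong(3) poisson_process_subset[OF pp that] in auto)
  have m: "(\<lambda>w. \<integral>\<^sup>+y. f y \<partial>count_space (Z w)) \<in> borel_measurable N \<longleftrightarrow>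
      (\<lambda>w. \<integral>\<^sup>+y. g y \<partial>count_space (Z w)) \<in> borel_measurable N"
    by (rule measurable_cong) (rule eq)
  have i: "(\<integral>\<^sup>+w. (\<integral>\<^sup>+y. f y \<partial>count_space (Z w)) \<partial>N) = (\<integral>\<^sup>+w. (\<integral>\<^sup>+y. g y \<partial>count_space (Z w)) \<partial>N)"
    by (rule nn_integral_cong) (rule eq)
  have "(\<integral>\<^sup>+y. f y \<partial>\<mu>) = (\<integral>\<^sup>+y. g y \<partial>\<mu>)" by (rule nn_integral_cong) (rule cong(3))
  then show ?case using cong(4) m i by simp
next
  case (set A)
  have "(\<integral>\<^sup>+y. indicator A y \<partial>count_space (Z w)) = num_points Z A w" for w
  proof -
    have "(\<integral>\<^sup>+y. indicator A y \<partial>count_space (Z w)) = (\<integral>\<^sup>+y. indicator A y * indicator (Z w) y \<partial>count_space UNIV)"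
      by (rule nn_integral_count_space_indicator) simp
    also have "\<dots> = (\<integral>\<^sup>+y. indicator (Z w \<inter> A) y \<partial>count_space UNIV)"
      by (rule nn_integral_cong) (auto split: split_indicator)
    finally show ?thesis by (simp add: num_points_def)
  qed
  then show ?case
    using num_points_measurable[OF pp set] nn_integral_num_points_le[OF pp set] set by simp
next
  case (mult u c)
  have m[measurable]: "(\<lambda>w. \<integral>\<^sup>+y. u y \<partial>count_space (Z w)) \<in> borel_measurable N" using mult by simp
  have "(\<integral>\<^sup>+w. c * (\<integral>\<^sup>+y. u y \<partial>count_space (Z w)) \<partial>N) \<le> c * (\<integral>\<^sup>+y. u y \<partial>\<mu>)"
    using mult by (simp add: nn_integral_cmult mult_left_mono)
  then show ?case using mult by (simp add: nn_integral_cmult)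
next
  case (add u v)
  have m[measurable]: "(\<lambda>w. \<integral>\<^sup>+y. u y \<partial>count_space (Z w)) \<in> borel_measurable N"
    "(\<lambda>w. \<integral>\<^sup>+y. v y \<partial>count_space (Z w)) \<in> borel_measurable N" using add by simp_all
  have "(\<integral>\<^sup>+w. (\<integral>\<^sup>+y. v y \<partial>count_space (Z w)) + (\<integral>\<^sup>+y. u y \<partial>count_space (Z w)) \<partial>N)
      \<le> (\<integral>\<^sup>+y. v y \<partial>\<mu>) + (\<integral>\<^sup>+y. u y \<partial>\<mu>)"
    using add by (simp add: nn_integral_add add_mono)
  then show ?case using add by (simp add: nn_integral_add)
next
  case (seq U)
  have m[measurable]: "(\<lambda>w. \<integral>\<^sup>+y. U i y \<partial>count_space (Z w)) \<in> borel_measurable N" for i using seq.IH by simp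
  have le: "(\<integral>\<^sup>+w. (\<integral>\<^sup>+y. U i y \<partial>count_space (Z w)) \<partial>N) \<le> (\<integral>\<^sup>+y. U i y \<partial>\<mu>)" for i using seq.IH by simp
  have eq: "(\<integral>\<^sup>+y. (SUP i. U i) y \<partial>count_space (Z w)) = (SUP i. \<integral>\<^sup>+y. U i y \<partial>count_space (Z w))" for w
    unfolding SUP_apply by (rule nn_integral_monotone_convergence_SUP[OF seq.hyps(3)]) simp
  have inc: "incseq (\<lambda>i w. \<integral>\<^sup>+y. U i y \<partial>count_space (Z w))"
    using seq.hyps(3) by (auto simp: incseq_def le_fun_def intro!: nn_integral_mono)
  have "(\<integral>\<^sup>+w. (SUP i. \<integral>\<^sup>+y. U i y \<partial>count_space (Z w)) \<partial>N) = (SUP i. \<integral>\<^sup>+w. (\<integral>\<^sup>+y. U i y \<partial>count_space (Z w)) \<partial>N)"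
    by (rule nn_integral_monotone_convergence_SUP[OF inc m])
  also have "\<dots> \<le> (SUP i. \<integral>\<^sup>+y. U i y \<partial>\<mu>)" by (rule SUP_mono) (use le in auto)
  also have "\<dots> = (\<integral>\<^sup>+y. (SUP i. U i y) \<partial>\<mu>)"
    by (rule nn_integral_monotone_convergence_SUP[OF seq.hyps(3,1), symmetric])
  finally show ?case unfolding eq by (simp add: SUP_apply image_comp)
qed

section \<open>Signed sums over the points of a configuration\<close>

lemma integrable_count_space_iff:
  fixes f :: "'y \<Rightarrow> real"
  shows "integrable (count_space A) f \<longleftrightarrow> (\<lambda>y. \<bar>f y\<bar>) summable_on A"
  using abs_summable_equivalent[of f A] by (simp add: Infinite_Set_Sum.abs_summable_on_def)

lemma summable_on_iff_nn_integral:
  fixes f :: "'y \<Rightarrow> real"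
  shows "(\<lambda>y. \<bar>f y\<bar>) summable_on A \<longleftrightarrow> (\<integral>\<^sup>+y. ennreal \<bar>f y\<bar> \<partial>count_space A) < \<infinity>"
  unfolding integrable_count_space_iff[symmetric] by (simp add: integrable_iff_bounded)

lemma poisson_AE_summable:
  assumes pp: "poisson_process N \<mu> Z" and f: "integrable \<mu> f"
  shows "AE w in N. (\<lambda>y. \<bar>f y\<bar> :: real) summable_on Z w"
proof -
  have fm: "(\<lambda>y. ennreal \<bar>f y\<bar>) \<in> borel_measurable \<mu>" using f by measurable
  note s = poisson_process_nn_sum[OF pp fm]
  have "(\<integral>\<^sup>+y. ennreal \<bar>f y\<bar> \<partial>\<mu>) < \<infinity>" using f by (simp add: integrable_iff_bounded)
  then have "(\<integral>\<^sup>+w. (\<integral>\<^sup>+y. ennreal \<bar>f y\<bar> \<partial>count_space (Z w)) \<partial>N) < \<infinity>"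
    using s by (auto intro: le_less_trans)
  then have "AE w in N. (\<integral>\<^sup>+y. ennreal \<bar>f y\<bar> \<partial>count_space (Z w)) \<noteq> \<infinity>"
    using s by (intro nn_integral_PInf_AE) auto
  then show ?thesis unfolding summable_on_iff_nn_integral
    by eventually_elim (simp add: top.not_eq_extremum)
qed

text \<open>The sum is the difference of its positive and negative parts, two nonnegative sums of
  known measurability. Where summability fails \<open>infsum\<close> takes its default value 0,
  which the \<open>if\<close> reproduces.\<close>

lemma poisson_infsum_measurable:
  fixes f :: "'y \<Rightarrow> real"
  assumes pp: "poisson_process N \<mu> Z" and f: "f \<in> borel_measurable \<mu>"
  shows "(\<lambda>w. \<Sum>\<^sub>\<infinity>y\<in>Z w. f y) \<in> borel_measurable N"
proof -
  have [measurable]: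
    "(\<lambda>w. \<integral>\<^sup>+y. ennreal \<bar>f y\<bar> \<partial>count_space (Z w)) \<in> borel_measurable N"
    "(\<lambda>w. \<integral>\<^sup>+y. ennreal (f y) \<partial>count_space (Z w)) \<in> borel_measurable N"
    "(\<lambda>w. \<integral>\<^sup>+y. ennreal (- f y) \<partial>count_space (Z w)) \<in> borel_measurable N"
    by (rule poisson_process_nn_sum[OF pp, THEN conjunct1]; use f in measurable)+
  have "(\<Sum>\<^sub>\<infinity>y\<in>Z w. f y) = (if (\<integral>\<^sup>+y. ennreal \<bar>f y\<bar> \<partial>count_space (Z w)) < \<infinity>
      then enn2real (\<integral>\<^sup>+y. ennreal (f y) \<partial>count_space (Z w)) - enn2real (\<integral>\<^sup>+y. ennreal (- f y) \<partial>count_space (Z w))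
      else 0)" for w
  proof (cases "(\<lambda>y. \<bar>f y\<bar>) summable_on Z w")
    case True
    then have i: "integrable (count_space (Z w)) f" by (simp add: integrable_count_space_iff)
    then have "infsum f (Z w) = integral\<^sup>L (count_space (Z w)) f"
      using infsetsum_infsum[of f "Z w"] by (simp add: Infinite_Set_Sum.abs_summable_on_def infsetsum_def)
    moreover have "(\<integral>\<^sup>+y. ennreal \<bar>f y\<bar> \<partial>count_space (Z w)) < \<infinity>"
      using True by (simp only: summable_on_iff_nn_integral)
    ultimately show ?thesis by (simp add: real_lebesgue_integral_def[OF i])
  next
    case False
    then have "\<not> f summable_on Z w" using summable_on_iff_abs_summable_on_real[of f "Z w"] by simp
    then show ?thesis using False by (simp add: infsum_not_exists summable_on_iff_nn_integral)
  qed
  then show ?thesis by simp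
qed

section \<open>The Hermite and Charlier functionals\<close>

lemma
  assumes g: "g permutes {1..n}"
  shows finite_cycles_of: "finite (cycles_of n g)"
    and cycle_card_pos: "c \<in> cycles_of n g \<Longrightarrow> 1 \<le> card c"
    and cycle_card_le: "c \<in> cycles_of n g \<Longrightarrow> card c \<le> n"
    and sum_card_cycles: "(\<Sum>c\<in>cycles_of n g. card c) = n"
proof -
  show fin: "finite (cycles_of n g)" by (simp add: cycles_of_def)
  have sub: "c \<subseteq> {1..n}" if "c \<in> cycles_of n g" for c
    using that permutes_orbit_subset[OF g] unfolding cycles_of_def by (elim imageE) simp
  have finc: "finite c" if "c \<in> cycles_of n g" for c
    using sub[OF that] by (rule finite_subset) simp
  show "1 \<le> card c" if c: "c \<in> cycles_of n g" for c
  proof -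
    have "c \<noteq> {}" using c orbit_nonempty[of g] unfolding cycles_of_def by (elim imageE) simp
    then have "0 < card c" using finc[OF c] by (simp add: card_gt_0_iff)
    then show ?thesis by simp
  qed
  show "card c \<le> n" if c: "c \<in> cycles_of n g" for c
    using card_mono[OF _ sub[OF c]] by simp
  have un: "\<Union>(cycles_of n g) = {1..n}"
  proof (rule equalityI)
    show "\<Union>(cycles_of n g) \<subseteq> {1..n}" using sub by (rule Union_least)
    show "{1..n} \<subseteq> \<Union>(cycles_of n g)"
      using self_in_orbit_permutes[OF g] unfolding cycles_of_def by (intro subsetI UN_I) auto
  qed
  have "pairwise disjnt (cycles_of n g)"
  proof (rule pairwiseI)
    fix c d assume "c \<in> cycles_of n g" "d \<in> cycles_of n g" and ne: "c \<noteq> d"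
    then obtain x y where "c = orbit g x" "d = orbit g y" unfolding cycles_of_def by (elim imageE)
    then show "disjnt c d" using orbits_eq_or_disjoint[OF g, of x y] ne by (simp add: disjnt_def)
  qed
  from card_Union_disjoint[OF this finc] show "(\<Sum>c\<in>cycles_of n g. card c) = n"
    unfolding un by simp
qed

lemma prod_cycles_by_length:
  fixes v :: "nat set \<Rightarrow> 'a::comm_ring_1"
  assumes g: "g permutes {1..n}"
  shows "(\<Prod>c\<in>cycles_of n g. v c) =
     (\<Prod>c\<in>cycles_of_length 1 n g. v c) * (\<Prod>k=2..n. \<Prod>c\<in>cycles_of_length k n g. v c)"
proof -
  \<comment> \<open>The lengths are listed as 1 together with \<open>{2..n}\<close>, so that
    \<open>n = 0\<close> is covered: then the factor for length 1 is an empty product.\<close>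
  have "card ` cycles_of n g \<subseteq> insert 1 {2..n}"
  proof (rule image_subsetI)
    fix c assume "c \<in> cycles_of n g"
    then show "card c \<in> insert 1 {2..n}"
      using cycle_card_pos[OF g, of c] cycle_card_le[OF g, of c] by auto
  qed
  from prod.group[OF finite_cycles_of[OF g] _ this, of v, symmetric]
  show ?thesis unfolding cycles_of_length_def by simp
qed

lemma charlier_functional_eq_perm_sum:
  "charlier_functional \<mu> Z n f w =
     perm_sum (charlier_weight f (\<lambda>i. \<integral>y. f i y \<partial>\<mu>) (Z w)) {1..n}"
  unfolding charlier_functional_def perm_sum_def
proof (rule sum.cong[OF refl])
  fix g assume "g \<in> {g. g permutes {1..n}}"
  then have g: "g permutes {1..n}" by simp
  let ?v = "\<lambda>c. if card c = 1 then \<Prod>i\<in>c. (\<Sum>\<^sub>\<infinity>y\<in>Z w. f i y) - (\<integral>y. f i y \<partial>\<mu>) else \<Sum>\<^sub>\<infinity>y\<in>Z w. \<Prod>i\<in>c. f i y"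
  let ?m = "\<lambda>i. \<integral>y. f i y \<partial>\<mu>"
  have w: "charlier_weight f ?m (Z w) c = (-1) ^ (card c - 1) * ?v c" for c
  proof (cases "card c = 1")
    case True
    then obtain i where "c = {i}" by (auto simp: card_1_singleton_iff)
    then show ?thesis by (simp add: charlier_weight_def)
  next
    case False
    then show ?thesis by (simp add: charlier_weight_def)
  qed
  \<comment> \<open>Cycle lengths sum to \<open>n\<close> and none is 0, so the natural subtractions
    on both sides are genuine and the sign splits over the cycles.\<close>
  have "(\<Sum>c\<in>cycles_of n g. card c - 1) = n - card (cycles_of n g)"
    using sum_subtractf_nat[of "cycles_of n g" "\<lambda>_. 1" card] cycle_card_pos[OF g] sum_card_cycles[OF g] by simp
  then have sign: "(\<Prod>c\<in>cycles_of n g. (-1) ^ (card c - 1)) = ((-1) ^ (n - card (cycles_of n g)) :: real)"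
    unfolding power_sum[symmetric] by simp
  have "(\<Prod>c\<in>cycles_of_length 1 n g. \<Prod>i\<in>c. (\<Sum>\<^sub>\<infinity>y\<in>Z w. f i y) - (\<integral>y. f i y \<partial>\<mu>)) = (\<Prod>c\<in>cycles_of_length 1 n g. ?v c)"
    by (rule prod.cong) (simp_all add: cycles_of_length_def)
  moreover have "(\<Prod>k=2..n. \<Prod>c\<in>cycles_of_length k n g. \<Sum>\<^sub>\<infinity>y\<in>Z w. \<Prod>i\<in>c. f i y) =
      (\<Prod>k=2..n. \<Prod>c\<in>cycles_of_length k n g. ?v c)"
    by (intro prod.cong refl) (auto simp: cycles_of_length_def)
  ultimately show "(-1) ^ (n - card (cycles_of n g)) *
        (\<Prod>c\<in>cycles_of_length 1 n g. \<Prod>i\<in>c. (\<Sum>\<^sub>\<infinity>y\<in>Z w. f i y) - (\<integral>y. f i y \<partial>\<mu>)) *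
        (\<Prod>k=2..n. \<Prod>c\<in>cycles_of_length k n g. \<Sum>\<^sub>\<infinity>y\<in>Z w. \<Prod>i\<in>c. f i y) =
      (\<Prod>c\<in>orbit g ` {1..n}. charlier_weight f ?m (Z w) c)"
    unfolding w prod.distrib cycles_of_def[symmetric] sign prod_cycles_by_length[OF g] by (simp only: mult.assoc)
qed

lemma hermite_functional_eq_perm_sum:
  "hermite_functional \<mu> W n f w =
     perm_sum (hermite_weight (\<lambda>c. \<integral>y. (\<Prod>j\<in>c. f j y) \<partial>\<mu>) (\<lambda>i. W (f i) w)) {1..n}"
proof -
  let ?\<beta> = "\<lambda>c. \<integral>y. (\<Prod>j\<in>c. f j y) \<partial>\<mu>"
  let ?h = "hermite_weight ?\<beta> (\<lambda>i. W (f i) w)"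
  have "perm_sum ?h {1..n} = (\<Sum>g\<in>involutions n. \<Prod>c\<in>cycles_of n g. ?h c)"
    unfolding perm_sum_def cycles_of_def[symmetric]
  proof (rule sum.mono_neutral_right)
    show "finite {g. g permutes {1..n}}" by (rule finite_permutations) simp
    show "involutions n \<subseteq> {g. g permutes {1..n}}" by (auto simp: involutions_def)
    show "\<forall>g\<in>{g. g permutes {1..n}} - involutions n. (\<Prod>c\<in>cycles_of n g. ?h c) = 0"
    proof
      fix g assume "g \<in> {g. g permutes {1..n}} - involutions n"
      then obtain c where g: "g permutes {1..n}" and c: "c \<in> cycles_of n g" "2 < card c"
        unfolding involutions_def by (auto simp: not_le)
      have "?h c = 0" using c(2) by (simp add: hermite_weight_def)
      then show "(\<Prod>c\<in>cycles_of n g. ?h c) = 0"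
        using c(1) by (intro prod_zero[OF finite_cycles_of[OF g]]) (rule bexI)
    qed
  qed
  also have "\<dots> = hermite_functional \<mu> W n f w"
    unfolding hermite_functional_def
  proof (rule sum.cong[OF refl])
    fix g assume "g \<in> involutions n"
    then have g: "g permutes {1..n}" and two: "\<And>c. c \<in> cycles_of n g \<Longrightarrow> card c \<le> 2"
      by (auto simp: involutions_def)
    have "cycles_of n g = cycles_of_length 1 n g \<union> cycles_of_length 2 n g"
    proof (intro equalityI subsetI)
      fix c assume c: "c \<in> cycles_of n g"
      then have "card c = 1 \<or> card c = 2" using two[OF c] cycle_card_pos[OF g c] by linarith
      then show "c \<in> cycles_of_length 1 n g \<union> cycles_of_length 2 n g" using c by (auto simp: cycles_of_length_def)
    qed (auto simp: cycles_of_length_def)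
    then have "(\<Prod>c\<in>cycles_of n g. ?h c) = (\<Prod>c\<in>cycles_of_length 1 n g \<union> cycles_of_length 2 n g. ?h c)"
      by (rule arg_cong)
    also have "\<dots> = (\<Prod>c\<in>cycles_of_length 1 n g. ?h c) * (\<Prod>c\<in>cycles_of_length 2 n g. ?h c)"
      by (rule prod.union_disjoint) (use finite_cycles_of[OF g] in \<open>auto simp: cycles_of_length_def\<close>)
    also have "(\<Prod>c\<in>cycles_of_length 1 n g. ?h c) = (\<Prod>c\<in>cycles_of_length 1 n g. \<Prod>i\<in>c. W (f i) w)"
      by (rule prod.cong) (simp_all add: cycles_of_length_def hermite_weight_def)
    also have "(\<Prod>c\<in>cycles_of_length 2 n g. ?h c) = (\<Prod>c\<in>cycles_of_length 2 n g. - ?\<beta> c)"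
      by (rule prod.cong) (simp_all add: cycles_of_length_def hermite_weight_def)
    finally show "(\<Prod>c\<in>cycles_of n g. ?h c) =
      (\<Prod>c\<in>cycles_of_length 1 n g. \<Prod>i\<in>c. W (f i) w) * (\<Prod>c\<in>cycles_of_length 2 n g. - ?\<beta> c)" .
  qed
  finally show ?thesis ..
qed

section \<open>Measurability of sums over permutations\<close>

lemma borel_measurable_hermite_weight:
  assumes "finite I" "\<And>i. i \<in> I \<Longrightarrow> x i \<in> borel_measurable A" "B \<subseteq> I"
  shows "(\<lambda>v. hermite_weight \<beta> (\<lambda>i. x i v) B) \<in> borel_measurable A"
proof (cases "card B = 1")
  case True
  have "(\<lambda>v. \<Prod>i\<in>B. x i v) \<in> borel_measurable A"
    by (rule borel_measurable_prod) (use assms in auto)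
  then show ?thesis using True by (simp add: hermite_weight_def)
qed (simp add: hermite_weight_def)

lemma borel_measurable_perm_sum:
  fixes w :: "'a \<Rightarrow> 'i set \<Rightarrow> real"
  assumes "\<And>B. B \<subseteq> I \<Longrightarrow> (\<lambda>v. w v B) \<in> borel_measurable A"
  shows "(\<lambda>v. perm_sum (w v) I) \<in> borel_measurable A"
  unfolding perm_sum_def
proof (intro borel_measurable_sum borel_measurable_prod)
  fix g c assume g: "g \<in> {g. g permutes I}" and c: "c \<in> orbit g ` I"
  from c obtain x where x: "c = orbit g x" "x \<in> I" by (rule imageE)
  show "(\<lambda>v. w v c) \<in> borel_measurable A"
    by (rule assms) (use g x permutes_orbit_subset[of g I x] in simp)
qed

lemma charlier_functional_measurable:
  assumes pp: "poisson_process N \<mu> Z" and f: "\<And>i. i \<in> {1..n} \<Longrightarrow> f i \<in> borel_measurable \<mu>"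
  shows "charlier_functional \<mu> Z n f \<in> borel_measurable N"
  unfolding charlier_functional_eq_perm_sum[abs_def]
proof (rule borel_measurable_perm_sum)
  fix B :: "nat set" assume B: "B \<subseteq> {1..n}"
  have "(\<lambda>y. \<Prod>i\<in>B. f i y) \<in> borel_measurable \<mu>"
    by (rule borel_measurable_prod) (use f B in auto)
  note [measurable] = poisson_infsum_measurable[OF pp this]
  show "(\<lambda>w. charlier_weight f (\<lambda>i. \<integral>y. f i y \<partial>\<mu>) (Z w) B) \<in> borel_measurable N"
    unfolding charlier_weight_def by measurable
qed

text \<open>The Poisson-side space enters only as a space of functionals of some family
  \<open>X\<close>. Integrability of the \<open>f i\<close> has two uses: it brings every vertex
  function within reach of the formula for exponentials, and it makes the sums over the points
  converge.\<close>

lemma isometry_hermite_charlier: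
  fixes \<Phi> :: "('v \<Rightarrow> 'k::{real_normed_field, second_countable_topology}) \<Rightarrow> 'w \<Rightarrow> 'k"
    and X :: "'j \<Rightarrow> 'w \<Rightarrow> 'b::topological_space"
    and f :: "nat \<Rightarrow> 'y \<Rightarrow> real"
  assumes pp: "poisson_process N \<mu> Z" and wn: "gaussian_white_noise M \<mu> W"
    and iso: "L2_isometry M (L2_white_noise M \<mu> W) N (L2_functionals N J X) \<Phi>"
    and exponential: "\<And>h. h \<in> L2 \<mu> \<Longrightarrow> integrable \<mu> h \<Longrightarrow>
        AE w in N. \<Phi> (\<lambda>v. of_real (exp (W h v - L2_norm_sq \<mu> h / 2))) w
           = of_real (infprod (\<lambda>y. 1 + h y) (Z w) * exp (- (\<integral>y. h y \<partial>\<mu>)))"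
    and f: "\<And>i. i \<in> {1..n} \<Longrightarrow> f i \<in> L2 \<mu>" "\<And>i. i \<in> {1..n} \<Longrightarrow> integrable \<mu> (f i)"
  shows "(\<lambda>v. of_real (hermite_functional \<mu> W n f v) :: 'k) \<in> L2_white_noise M \<mu> W"
    and "(\<lambda>w. of_real (charlier_functional \<mu> Z n f w) :: 'k) \<in> L2_functionals N J X"
    and "AE w in N. \<Phi> (\<lambda>v. of_real (hermite_functional \<mu> W n f v)) w
           = of_real (charlier_functional \<mu> Z n f w)"
proof -
  define I where "I = {1..n}"
  define \<epsilon> where "\<epsilon> k = inverse (real (Suc k))" for k
  define b where "b i j = (\<integral>y. f i y * f j y \<partial>\<mu>)" for i j
  define \<beta> where "\<beta> c = (\<integral>y. (\<Prod>j\<in>c. f j y) \<partial>\<mu>)" for c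
  define m where "m i = (\<integral>y. f i y \<partial>\<mu>)" for i
  define R where "R v = 1 + (\<Sum>i\<in>I. \<bar>W (f i) v\<bar>) + (\<Sum>i\<in>I. \<Sum>j\<in>I. \<bar>b i j\<bar>)" for v
  define E where "E k C v = exp (\<epsilon> k * (\<Sum>i\<in>C. W (f i) v) - (\<epsilon> k)\<^sup>2 * (\<Sum>i\<in>C. \<Sum>j\<in>C. b i j) / 2)" for k C v
  define D where "D k v = alternating_sum I (\<lambda>C. E k C v) / \<epsilon> k ^ card I" for k v
  define H where "H v = perm_sum (hermite_weight \<beta> (\<lambda>i. W (f i) v)) I" for v
  let ?A = "generated_algebra M (L2 \<mu>) W"
  interpret prob_space M using wn unfolding gaussian_white_noise_def by (elim conjE)
  have H: "hermite_functional \<mu> W n f = H"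
    unfolding H_def I_def \<beta>_def hermite_functional_eq_perm_sum[abs_def] ..
  have fin: "finite I" by (simp add: I_def)
  have fI: "f i \<in> L2 \<mu>" "integrable \<mu> (f i)" if "i \<in> I" for i using f that by (auto simp: I_def)
  have \<epsilon>: "0 < \<epsilon> k" "\<epsilon> k \<le> 1" for k by (simp_all add: \<epsilon>_def field_simps)
  have \<epsilon>0: "\<epsilon> \<longlonglongrightarrow> 0" unfolding \<epsilon>_def[abs_def] by (rule LIMSEQ_inverse_real_of_nat)
  have Wm: "W h \<in> borel_measurable M" if "h \<in> L2 \<mu>" for h by (rule white_noise_measurable[OF wn that])
  have WA: "W (f i) \<in> borel_measurable ?A" if "i \<in> I" for i
    by (rule measurable_generated_algebra[OF Wm fI(1)[OF that]])
  have sub: "subalgebra M ?A" by (rule subalgebra_generated_algebra[OF Wm])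
  have sym: "b i j = b j i" for i j by (simp add: b_def mult.commute)
  have \<beta>b: "\<beta> {i, j} = b i j" if "i \<noteq> j" for i j using that by (simp add: \<beta>_def b_def)
  note hd = hermite_difference[where b = b and \<beta> = \<beta> and x = "\<lambda>i. W (f i) v" for v, OF fin \<epsilon> \<epsilon>0 sym \<beta>b,
      folded E_def R_def H_def, folded D_def]

  \<comment> \<open>Dominates all quotients and their limit. Its square is a constant times the
    exponential of \<open>2 * real (Suc (card I))\<close> times the sum of the
    \<open>\<bar>W (f i) v\<bar>\<close>, hence integrable.\<close>
  define G where "G v = fact (card I) * exp (real (Suc (card I)) * R v)" for v
  have Dle: "\<bar>D k v\<bar> \<le> G v" and Dlim: "(\<lambda>k. D k v) \<longlonglongrightarrow> H v" and Hle: "\<bar>H v\<bar> \<le> G v" for k v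
    unfolding G_def using hd by blast+
  have HA[measurable]: "H \<in> borel_measurable ?A"
    unfolding H_def[abs_def] by (intro borel_measurable_perm_sum borel_measurable_hermite_weight[OF fin WA])
  have EA: "E k C \<in> borel_measurable ?A" if "C \<subseteq> I" for k C
  proof -
    have [measurable]: "(\<lambda>v. \<Sum>i\<in>C. W (f i) v) \<in> borel_measurable ?A"
      by (rule borel_measurable_sum) (use WA that in auto)
    show ?thesis unfolding E_def[abs_def] by measurable
  qed
  have DA: "D k \<in> borel_measurable ?A" for k
    unfolding D_def[abs_def] alternating_sum_def
    by (intro borel_measurable_divide borel_measurable_sum borel_measurable_times borel_measurable_const EA) auto
  have HM[measurable]: "H \<in> borel_measurable M" and DM[measurable]: "D k \<in> borel_measurable M" for k
    using measurable_from_subalg[OF sub HA] measurable_from_subalg[OF sub DA] by auto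
  have Gint: "integrable M (\<lambda>v. (G v)\<^sup>2)"
  proof -
    let ?c = "2 * real (Suc (card I))"
    let ?d = "(fact (card I))\<^sup>2 * exp (?c * (1 + (\<Sum>i\<in>I. \<Sum>j\<in>I. \<bar>b i j\<bar>)))"
    have "integrable M (\<lambda>v. ?d * exp (?c * (\<Sum>i\<in>I. \<bar>W (f i) v\<bar>)))"
      by (rule integrable_mult_right[OF white_noise_exp_abs_sum_integrable[OF wn fin fI(1)]]) auto
    moreover have "(G v)\<^sup>2 = ?d * exp (?c * (\<Sum>i\<in>I. \<bar>W (f i) v\<bar>))" for v
      unfolding G_def R_def power_mult_distrib exp_double[symmetric] mult.assoc exp_add[symmetric]
      by (simp only: distrib_left add_ac mult.assoc)
    ultimately show ?thesis by simp
  qed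
  have Hint: "integrable M (\<lambda>v. (H v)\<^sup>2)"
  proof (rule Bochner_Integration.integrable_bound[OF Gint])
    show "AE v in M. norm ((H v)\<^sup>2) \<le> norm ((G v)\<^sup>2)"
    proof (rule AE_I2)
      fix v
      show "norm ((H v)\<^sup>2) \<le> norm ((G v)\<^sup>2)"
        using power_mono[OF Hle[of v] abs_ge_zero, of 2] by simp
    qed
  qed measurable
  show HL: "(\<lambda>v. of_real (hermite_functional \<mu> W n f v) :: 'k) \<in> L2_white_noise M \<mu> W"
    unfolding H by (rule of_real_in_L2_functionals[OF Wm HA Hint])

  \<comment> \<open>The function at the vertex \<open>C\<close> of the cube of side
    \<open>\<epsilon> k\<close>; its normalized exponential is the term of the quotient that belongs
    to \<open>C\<close>.\<close>
  define h where "h k C y = (\<Sum>i\<in>C. \<epsilon> k * f i y)" for k C y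
  have hL: "h k C \<in> L2 \<mu>" if C: "C \<subseteq> I" for k C
    unfolding h_def[abs_def] by (rule L2_sum[OF finite_subset[OF C fin]]) (use C fI(1) in blast)
  have hint: "integrable \<mu> (h k C)" if C: "C \<subseteq> I" for k C
    unfolding h_def[abs_def]
    by (rule Bochner_Integration.integrable_sum, rule integrable_mult_right, rule fI(2)) (use C in blast)
  have hnorm: "L2_norm_sq \<mu> (h k C) = (\<epsilon> k)\<^sup>2 * (\<Sum>i\<in>C. \<Sum>j\<in>C. b i j)" if C: "C \<subseteq> I" for k C
  proof -
    have "(norm (h k C y))\<^sup>2 = (\<Sum>i\<in>C. \<Sum>j\<in>C. (\<epsilon> k)\<^sup>2 * (f i y * f j y))" for y
      by (simp add: h_def power2_eq_square sum_product mult_ac)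
    moreover have "has_bochner_integral \<mu> (\<lambda>y. \<Sum>i\<in>C. \<Sum>j\<in>C. (\<epsilon> k)\<^sup>2 * (f i y * f j y))
        (\<Sum>i\<in>C. \<Sum>j\<in>C. (\<epsilon> k)\<^sup>2 * b i j)"
    proof (rule has_bochner_integral_sum, rule has_bochner_integral_sum, rule has_bochner_integral_mult_right)
      fix i j assume "i \<in> C" "j \<in> C"
      then have "integrable \<mu> (\<lambda>y. f i y * f j y)" using C by (intro L2_mult_integrable fI(1)) auto
      then show "has_bochner_integral \<mu> (\<lambda>y. f i y * f j y) (b i j)"
        unfolding b_def by (rule has_bochner_integral_integrable)
    qed
    then have "(\<integral>y. (\<Sum>i\<in>C. \<Sum>j\<in>C. (\<epsilon> k)\<^sup>2 * (f i y * f j y)) \<partial>\<mu>) = (\<Sum>i\<in>C. \<Sum>j\<in>C. (\<epsilon> k)\<^sup>2 * b i j)"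
      by (rule has_bochner_integral_integral_eq)
    ultimately show ?thesis by (simp add: L2_norm_sq_def sum_distrib_left)
  qed
  \<comment> \<open>The noise is linear only almost everywhere, so the exponential of
    \<open>h k C\<close> and the explicit \<open>E k C\<close> may differ on a null set; \<Phi> of
    the two is compared through the congruence clause.\<close>
  have hW: "AE v in M. exp (W (h k C) v - L2_norm_sq \<mu> (h k C) / 2) = E k C v" if C: "C \<subseteq> I" for k C
  proof -
    have "AE v in M. W (h k C) v = (\<Sum>i\<in>C. \<epsilon> k * W (f i) v)"
      unfolding h_def[abs_def] by (rule white_noise_sum[OF wn]) (use C fin fI finite_subset in auto)
    then show ?thesis
      unfolding hnorm[OF C] E_def by eventually_elim (simp add: sum_distrib_left)
  qed
  have hexp: "integrable M (\<lambda>v. (exp (W (h k C) v - L2_norm_sq \<mu> (h k C) / 2))\<^sup>2)" if C: "C \<subseteq> I" for k C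
  proof -
    have "integrable M (\<lambda>v. exp (- L2_norm_sq \<mu> (h k C)) * exp (2 * W (h k C) v))"
      by (rule integrable_mult_right[OF white_noise_exp_integrable[OF wn hL[OF C]]])
    then show ?thesis unfolding exp_double[symmetric] exp_add[symmetric] by (simp add: algebra_simps)
  qed
  let ?E = "\<lambda>k C v. of_real (E k C v) :: 'k"
  have \<Phi>E: "?E k C \<in> L2_white_noise M \<mu> W \<and> (AE w in N. \<Phi> (?E k C) w =
      of_real (infprod (\<lambda>y. 1 + \<epsilon> k * (\<Sum>i\<in>C. f i y)) (Z w) * exp (- (\<epsilon> k * (\<Sum>i\<in>C. m i)))))"
    if C: "C \<subseteq> I" for k C
  proof -
    let ?e = "\<lambda>v. of_real (exp (W (h k C) v - L2_norm_sq \<mu> (h k C) / 2)) :: 'k"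
    have "W (h k C) \<in> borel_measurable ?A" by (rule measurable_generated_algebra[OF Wm hL[OF C]])
    then have "(\<lambda>v. exp (W (h k C) v - L2_norm_sq \<mu> (h k C) / 2)) \<in> borel_measurable ?A" by measurable
    from of_real_in_L2_functionals[OF Wm this hexp[OF C]]
    have e: "?e \<in> L2_white_noise M \<mu> W" .
    have ae: "AE v in M. ?e v = ?E k C v" using hW[OF C] by eventually_elim simp
    have EM: "?E k C \<in> borel_measurable M"
      by (rule measurable_compose[OF measurable_from_subalg[OF sub EA[OF C]] borel_measurable_of_real])
    have E: "?E k C \<in> L2_white_noise M \<mu> W" by (rule L2_functionals_cong_AE[OF e ae EM])
    have 1: "AE w in N. \<Phi> ?e w = \<Phi> (?E k C) w" by (rule L2_isometry_cong[OF iso e E ae])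
    have 2: "(\<integral>y. h k C y \<partial>\<mu>) = \<epsilon> k * (\<Sum>i\<in>C. m i)"
      unfolding h_def m_def
    proof (subst Bochner_Integration.integral_sum)
      show "integrable \<mu> (\<lambda>y. \<epsilon> k * f i y)" if "i \<in> C" for i
        using that C by (intro integrable_mult_right fI(2)) auto
    qed (simp add: sum_distrib_left)
    have 3: "h k C y = \<epsilon> k * (\<Sum>i\<in>C. f i y)" for y by (simp add: h_def sum_distrib_left)
    have "AE w in N. \<Phi> ?e w =
      of_real (infprod (\<lambda>y. 1 + \<epsilon> k * (\<Sum>i\<in>C. f i y)) (Z w) * exp (- (\<epsilon> k * (\<Sum>i\<in>C. m i))))"
      using exponential[OF hL[OF C] hint[OF C], of k] unfolding 2 unfolding 3 .
    with 1 have "AE w in N. \<Phi> (?E k C) w =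
      of_real (infprod (\<lambda>y. 1 + \<epsilon> k * (\<Sum>i\<in>C. f i y)) (Z w) * exp (- (\<epsilon> k * (\<Sum>i\<in>C. m i))))"
      by eventually_elim simp
    with E show ?thesis by (rule conjI)
  qed

  define Y where "Y k w = alternating_sum I (\<lambda>C. infprod (\<lambda>y. 1 + \<epsilon> k * (\<Sum>i\<in>C. f i y)) (Z w) *
      exp (- (\<epsilon> k * (\<Sum>i\<in>C. m i)))) / \<epsilon> k ^ card I" for k w
  define c :: "nat \<Rightarrow> nat set \<Rightarrow> 'k" where "c k C = of_real ((-1) ^ card (I - C) / \<epsilon> k ^ card I)" for k C
  have sumD: "(\<lambda>v. \<Sum>C\<in>Pow I. c k C * ?E k C v) = (\<lambda>v. of_real (D k v))" for k
    by (rule ext) (simp add: c_def D_def alternating_sum_def sum_divide_distrib)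
  have sumY: "(\<Sum>C\<in>Pow I. c k C * of_real (infprod (\<lambda>y. 1 + \<epsilon> k * (\<Sum>i\<in>C. f i y)) (Z w) *
      exp (- (\<epsilon> k * (\<Sum>i\<in>C. m i))))) = of_real (Y k w)" for k w
    by (simp add: c_def Y_def alternating_sum_def sum_divide_distrib)
  have \<Phi>D: "(\<lambda>v. of_real (D k v) :: 'k) \<in> L2_white_noise M \<mu> W \<and>
     (AE w in N. \<Phi> (\<lambda>v. of_real (D k v)) w = of_real (Y k w))" for k
  proof -
    have L: "(\<lambda>v. \<Sum>C\<in>Pow I. c k C * ?E k C v) \<in> L2_white_noise M \<mu> W \<and>
      (AE w in N. \<Phi> (\<lambda>v. \<Sum>C\<in>Pow I. c k C * ?E k C v) w = (\<Sum>C\<in>Pow I. c k C * \<Phi> (?E k C) w))"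
      by (rule L2_isometry_sum[OF iso L2_functionals_lincomb]) (use fin \<Phi>E in auto)
    have "AE w in N. \<forall>C\<in>Pow I. \<Phi> (?E k C) w =
      of_real (infprod (\<lambda>y. 1 + \<epsilon> k * (\<Sum>i\<in>C. f i y)) (Z w) * exp (- (\<epsilon> k * (\<Sum>i\<in>C. m i))))"
      using fin \<Phi>E by (intro AE_finite_allI) auto
    moreover have "AE w in N. \<Phi> (\<lambda>v. of_real (D k v)) w = (\<Sum>C\<in>Pow I. c k C * \<Phi> (?E k C) w)"
      using L unfolding sumD by (rule conjunct2)
    ultimately have "AE w in N. \<Phi> (\<lambda>v. of_real (D k v)) w = of_real (Y k w)"
    proof eventually_elim
      case (elim w)
      have "(\<Sum>C\<in>Pow I. c k C * \<Phi> (?E k C) w) = of_real (Y k w)"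
        unfolding sumY[symmetric] by (rule sum.cong[OF refl]) (use elim(1) in simp)
      then show ?case using elim(2) by simp
    qed
    then show ?thesis using L unfolding sumD by blast
  qed
  \<comment> \<open>The exceptional null set depends on the finitely many \<open>f i\<close> and not
    on \<open>k\<close>; outside it the whole sequence converges.\<close>
  have "AE w in N. \<forall>i\<in>I. (\<lambda>y. \<bar>f i y\<bar>) summable_on Z w"
    using fin poisson_AE_summable[OF pp fI(2)] by (intro AE_finite_allI)
  then have Ylim: "AE w in N. (\<lambda>k. of_real (Y k w) :: 'k) \<longlonglongrightarrow> of_real (charlier_functional \<mu> Z n f w)"
  proof eventually_elim
    case (elim w)
    have "(\<lambda>k. Y k w) \<longlonglongrightarrow> perm_sum (charlier_weight f m (Z w)) I"
      unfolding Y_def by (rule charlier_difference_tendsto[OF fin _ \<epsilon>(1) \<epsilon>0]) (use elim in blast)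
    also have "perm_sum (charlier_weight f m (Z w)) I = charlier_functional \<mu> Z n f w"
      unfolding charlier_functional_eq_perm_sum I_def m_def ..
    finally show ?case by (rule tendsto_of_real)
  qed
  have "(\<lambda>k. \<integral>v. (D k v - H v)\<^sup>2 \<partial>M) \<longlonglongrightarrow> (\<integral>v. 0 \<partial>M)"
  proof (rule integral_dominated_convergence[where w = "\<lambda>v. 4 * (G v)\<^sup>2"])
    show "integrable M (\<lambda>v. 4 * (G v)\<^sup>2)" using Gint by simp
    show "AE v in M. (\<lambda>k. (D k v - H v)\<^sup>2) \<longlonglongrightarrow> 0"
    proof (rule AE_I2)
      fix v
      have "(\<lambda>k. (D k v - H v)\<^sup>2) \<longlonglongrightarrow> (H v - H v)\<^sup>2" by (intro tendsto_intros Dlim)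
      then show "(\<lambda>k. (D k v - H v)\<^sup>2) \<longlonglongrightarrow> 0" by simp
    qed
    show "AE v in M. norm ((D k v - H v)\<^sup>2) \<le> 4 * (G v)\<^sup>2" for k
    proof (rule AE_I2)
      fix v
      have "\<bar>D k v - H v\<bar> \<le> 2 * G v" using Dle[of k v] Hle[of v] by linarith
      then have "\<bar>D k v - H v\<bar>\<^sup>2 \<le> (2 * G v)\<^sup>2" by (rule power_mono) simp
      then show "norm ((D k v - H v)\<^sup>2) \<le> 4 * (G v)\<^sup>2" by (simp add: power_mult_distrib)
    qed
  qed measurable
  then have lim: "(\<lambda>k. L2_norm_sq M (\<lambda>v. of_real (D k v) - of_real (H v) :: 'k)) \<longlonglongrightarrow> 0"
    by (simp add: L2_norm_sq_def flip: of_real_diff)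
  show ae: "AE w in N. \<Phi> (\<lambda>v. of_real (hermite_functional \<mu> W n f v)) w
           = of_real (charlier_functional \<mu> Z n f w)"
    unfolding H
  proof (rule L2_isometry_limit[OF iso L2_functionals_lincomb _ _ _ lim _ Ylim])
    show "L2_functionals N J X \<subseteq> L2 N" unfolding L2_functionals_def by blast
    show "(\<lambda>v. of_real (D k v) :: 'k) \<in> L2_white_noise M \<mu> W" for k by (rule conjunct1[OF \<Phi>D])
    show "(\<lambda>v. of_real (H v) :: 'k) \<in> L2_white_noise M \<mu> W" using HL unfolding H .
    show "AE w in N. \<Phi> (\<lambda>v. of_real (D k v)) w = of_real (Y k w)" for k by (rule conjunct2[OF \<Phi>D])
  qed
  \<comment> \<open>The single summands of the Charlier functional need not be square integrable.\<close>
  show "(\<lambda>w. of_real (charlier_functional \<mu> Z n f w) :: 'k) \<in> L2_functionals N J X"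
  proof (rule L2_functionals_cong_AE[OF L2_isometry_in_range[OF iso HL] ae])
    have "charlier_functional \<mu> Z n f \<in> borel_measurable N"
      by (rule charlier_functional_measurable[OF pp]) (use f in \<open>auto simp: L2_def\<close>)
    then show "(\<lambda>w. of_real (charlier_functional \<mu> Z n f w) :: 'k) \<in> borel_measurable N"
      by (rule measurable_compose[OF _ borel_measurable_of_real])
  qed
qed

section \<open>Levy measures\<close>

text \<open>Follows from 1 + s \<le> e^s and (1 - s/2)(1 + s) = 1 + s(1 - s)/2 \<ge> 1. It lets the
  integrability condition on a Levy measure control the function \<open>s\<close> near 0.\<close>

lemma one_minus_exp_ge:
  fixes s :: real
  assumes "0 \<le> s" "s \<le> 1"
  shows "s / 2 \<le> 1 - exp (- s)"
proof -
  have "1 + s \<le> exp s" by (rule exp_ge_add_one_self)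
  then have "exp (- s) \<le> 1 / (1 + s)"
    using assms by (simp add: exp_minus inverse_eq_divide frac_le)
  also have "\<dots> \<le> 1 - s / 2"
  proof -
    have "1 \<le> (1 - s / 2) * (1 + s)" using mult_left_mono[OF assms(2,1)] by (simp add: algebra_simps)
    then show ?thesis using assms by (simp add: pos_divide_le_eq)
  qed
  finally show ?thesis by simp
qed

lemma levy_measure_sets: "levy_measure \<Lambda> \<Longrightarrow> sets \<Lambda> = sets borel"
  by (simp add: levy_measure_def)

lemma levy_measure_AE_pos:
  assumes "levy_measure \<Lambda>"
  shows "AE s in \<Lambda>. 0 < s"
proof (rule AE_I)
  show "{s \<in> space \<Lambda>. \<not> 0 < s} \<subseteq> {..0}" by auto
  show "emeasure \<Lambda> {..0} = 0" using assms by (simp add: levy_measure_def)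
  show "{..0} \<in> sets \<Lambda>" using levy_measure_sets[OF assms] by simp
qed

text \<open>Markov's inequality: away from 0 the function 1 - e^(-s) is bounded below by a positive
  constant, so the half-lines \<open>{inverse (real (Suc m))..}\<close> have finite measure. They
  exhaust the positive reals, and the rest is null.\<close>

lemma levy_measure_sigma_finite:
  assumes levy: "levy_measure \<Lambda>"
  shows "sigma_finite_measure \<Lambda>"
proof
  have sets[measurable_cong]: "sets \<Lambda> = sets borel" by (rule levy_measure_sets[OF levy])
  have fin: "emeasure \<Lambda> {inverse (real (Suc m))..} \<noteq> \<infinity>" for m
  proof -
    define c where "c = 1 - exp (- inverse (real (Suc m)))"
    have c: "0 < c" unfolding c_def by simp
    have "ennreal c * emeasure \<Lambda> {inverse (real (Suc m))..} =
        (\<integral>\<^sup>+s. ennreal c * indicator {inverse (real (Suc m))..} s \<partial>\<Lambda>)"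
      by (simp add: nn_integral_cmult_indicator sets)
    also have "\<dots> \<le> (\<integral>\<^sup>+s. ennreal (1 - exp (- s)) \<partial>\<Lambda>)"
      by (intro nn_integral_mono) (auto simp: c_def split: split_indicator intro!: ennreal_leI)
    also have "\<dots> < \<infinity>" using levy by (simp add: levy_measure_def)
    finally show ?thesis using c by (auto simp: ennreal_mult_less_top)
  qed
  let ?A = "insert {..0} (range (\<lambda>m. {inverse (real (Suc m))..}))"
  show "\<exists>A. countable A \<and> A \<subseteq> sets \<Lambda> \<and> \<Union>A = space \<Lambda> \<and> (\<forall>a\<in>A. emeasure \<Lambda> a \<noteq> \<infinity>)"
  proof (intro exI[of _ ?A] conjI ballI)
    show "countable ?A" by simp
    show "?A \<subseteq> sets \<Lambda>" by (auto simp: sets)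
    have "s \<in> \<Union>?A" for s :: real
    proof (cases "s \<le> 0")
      case False
      then obtain m where "inverse (real (Suc m)) < s" using reals_Archimedean[of s] by auto
      then show ?thesis by (auto intro!: exI[of _ m])
    qed auto
    moreover have "space \<Lambda> = UNIV" using sets_eq_imp_space_eq[OF sets] by simp
    ultimately show "\<Union>?A = space \<Lambda>" by blast
    fix a assume "a \<in> ?A"
    then show "emeasure \<Lambda> a \<noteq> \<infinity>" using fin levy by (auto simp: levy_measure_def)
  qed
qed

lemma finite_moments_poly_integrable:
  assumes "finite_moments \<rho>"
  shows "integrable \<rho> (\<lambda>t. poly p t)"
  unfolding poly_altdef using assms
  by (intro Bochner_Integration.integrable_sum integrable_mult_right) (simp add: finite_moments_def)

text \<open>Square integrability is a moment of t^2 d\<Lambda>. For the first power the line is cut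
  at 1: below, |t p(t)| is at most a constant times t and so controlled by the condition on
  \<Lambda>; above, it is at most t^2 |p(t)|, again a matter of moments.\<close>

lemma levy_measure_poly:
  assumes levy: "levy_measure \<Lambda>" and mom: "finite_moments (density \<Lambda> (\<lambda>t. ennreal (t\<^sup>2)))"
  shows "integrable \<Lambda> (\<lambda>t. (t * poly p t)\<^sup>2)" and "integrable \<Lambda> (\<lambda>t. t * poly p t)"
proof -
  note [measurable_cong] = levy_measure_sets[OF levy]
  have pm[measurable]: "poly q \<in> borel_measurable borel" for q :: "real poly"
    by (intro borel_measurable_continuous_onI continuous_intros)
  have sq: "integrable \<Lambda> (\<lambda>t. t\<^sup>2 * poly q t)" for q
    using finite_moments_poly_integrable[OF mom, of q] by (subst (asm) integrable_real_density) auto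
  from sq[of "p * p"] show "integrable \<Lambda> (\<lambda>t. (t * poly p t)\<^sup>2)"
    by (simp add: power2_eq_square mult_ac)
  \<comment> \<open>Bounds the polynomial on (0, 1], where powers of \<open>t\<close> are at most
    1.\<close>
  define C where "C = (\<Sum>i\<le>degree p. \<bar>coeff p i\<bar>)"
  have C0: "0 \<le> C" by (simp add: C_def sum_nonneg)
  have e: "integrable \<Lambda> (\<lambda>t. 1 - exp (- t))"
  proof (rule integrableI_nonneg)
    show "AE t in \<Lambda>. 0 \<le> 1 - exp (- t)" using levy_measure_AE_pos[OF levy] by eventually_elim simp
    show "(\<integral>\<^sup>+t. ennreal (1 - exp (- t)) \<partial>\<Lambda>) < \<infinity>" using levy by (simp add: levy_measure_def)
  qed measurable
  show "integrable \<Lambda> (\<lambda>t. t * poly p t)"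
  proof (rule Bochner_Integration.integrable_bound)
    show "integrable \<Lambda> (\<lambda>t. 2 * C * (1 - exp (- t)) + \<bar>t\<^sup>2 * poly p t\<bar>)"
      using e sq[of p] by (intro Bochner_Integration.integrable_add integrable_mult_right integrable_abs)
    show "AE t in \<Lambda>. norm (t * poly p t) \<le> norm (2 * C * (1 - exp (- t)) + \<bar>t\<^sup>2 * poly p t\<bar>)"
      using levy_measure_AE_pos[OF levy]
    proof eventually_elim
      case (elim t)
      have e0: "0 \<le> 2 * C * (1 - exp (- t))" using C0 elim by simp
      have "\<bar>t * poly p t\<bar> \<le> 2 * C * (1 - exp (- t)) + \<bar>t\<^sup>2 * poly p t\<bar>"
      proof (cases "t \<le> 1")
        case True
        have "\<bar>poly p t\<bar> \<le> C"
          unfolding poly_altdef C_def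
        proof (rule order_trans[OF sum_abs sum_mono])
          fix i
          have "\<bar>t\<bar> ^ i \<le> 1" using elim True by (intro power_le_one) auto
          then show "\<bar>coeff p i * t ^ i\<bar> \<le> \<bar>coeff p i\<bar>"
            by (simp add: abs_mult power_abs mult_left_le)
        qed
        then have "\<bar>t * poly p t\<bar> \<le> t * C" using elim by (simp add: abs_mult)
        also have "\<dots> \<le> 2 * C * (1 - exp (- t))"
          using mult_left_mono[OF one_minus_exp_ge[of t], of "2 * C"] elim True C0 by (simp add: mult.commute)
        finally show ?thesis by simp
      next
        case False
        then have "t * 1 \<le> t * t" by (intro mult_left_mono) auto
        then have "\<bar>t * poly p t\<bar> \<le> \<bar>t\<^sup>2 * poly p t\<bar>"
          using elim by (simp add: abs_mult power2_eq_square mult_right_mono)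
        then show ?thesis using e0 by linarith
      qed
      then show ?case using e0 by simp
    qed
  qed measurable
qed

lemma integrable_pair_mult:
  fixes a :: "'x \<Rightarrow> real" and g :: "'t \<Rightarrow> real"
  assumes "pair_sigma_finite A B" and a: "integrable A a" and g: "integrable B g"
  shows "integrable (A \<Otimes>\<^sub>M B) (\<lambda>y. a (fst y) * g (snd y))"
proof -
  interpret pair_sigma_finite A B by fact
  have [measurable]: "a \<in> borel_measurable A" "g \<in> borel_measurable B" using a g by auto
  show ?thesis
  proof (rule Fubini_integrable)
    show "(\<lambda>y. a (fst y) * g (snd y)) \<in> borel_measurable (A \<Otimes>\<^sub>M B)" by measurable
    have "(\<lambda>x. \<integral>y. norm (a (fst (x, y)) * g (snd (x, y))) \<partial>B) = (\<lambda>x. \<bar>a x\<bar> * (\<integral>y. \<bar>g y\<bar> \<partial>B))"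
      by (simp add: abs_mult)
    then show "integrable A (\<lambda>x. \<integral>y. norm (a (fst (x, y)) * g (snd (x, y))) \<partial>B)"
      using a by simp
    show "AE x in A. integrable B (\<lambda>y. a (fst (x, y)) * g (snd (x, y)))"
      using g by simp
  qed
qed

lemma L2_finite_measure_integrable:
  fixes a :: "'x \<Rightarrow> real"
  assumes "finite_measure \<nu>" "a \<in> L2 \<nu>"
  shows "integrable \<nu> a"
proof -
  interpret finite_measure \<nu> by fact
  have "(\<lambda>x. 1 :: real) \<in> L2 \<nu>" by (simp add: L2_def)
  from L2_mult_integrable[OF assms(2) this] show ?thesis by simp
qed

theorem corollary3:
  fixes \<nu> :: "'x measure"
    and \<Lambda> :: "real measure"
    and M :: "'v measure" and W :: "('x \<times> real \<Rightarrow> real) \<Rightarrow> 'v \<Rightarrow> real"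
    and N :: "'w measure" and Z :: "'w \<Rightarrow> ('x \<times> real) set" and \<eta> :: "'w \<Rightarrow> 'x measure"
    and \<Phi> :: "('v \<Rightarrow> 'k::{real_normed_field, second_countable_topology}) \<Rightarrow> 'w \<Rightarrow> 'k"
    and P :: "nat \<Rightarrow> real poly"
    and n :: nat
    and a :: "nat \<Rightarrow> 'x \<Rightarrow> real"
    and f :: "nat \<Rightarrow> 'x \<times> real \<Rightarrow> real"
  assumes "standard_borel \<nu>" and "finite_measure \<nu>" and "continuous_measure \<nu>"
    and "levy_measure \<Lambda>"
    and "finite_moments (density \<Lambda> (\<lambda>t. ennreal (t\<^sup>2)))"
    and "moment_determinate (density \<Lambda> (\<lambda>t. ennreal (t\<^sup>2)))"
    and "generalized_subordinator N \<nu> \<Lambda> Z \<eta>"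
    and "gaussian_white_noise M (\<nu> \<Otimes>\<^sub>M \<Lambda>) W"
    and "canonical_isometry M W N \<nu> \<Lambda> Z \<eta> \<Phi>"
    and "orthogonal_polynomials (density \<Lambda> (\<lambda>t. ennreal (t\<^sup>2))) P"
    and "\<And>k. k \<in> {1..n} \<Longrightarrow> a k \<in> L2 \<nu>"
    and "\<And>k x t. k \<in> {1..n} \<Longrightarrow> f k (x, t) = a k x * t * poly (P (k - 1)) t"
  shows "(\<lambda>v. of_real (hermite_functional (\<nu> \<Otimes>\<^sub>M \<Lambda>) W n f v) :: 'k)
           \<in> L2_white_noise M (\<nu> \<Otimes>\<^sub>M \<Lambda>) W \<and>
         (\<lambda>w. of_real (charlier_functional (\<nu> \<Otimes>\<^sub>M \<Lambda>) Z n f w) :: 'k)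
           \<in> L2_random_measure N \<nu> \<eta> \<and>
         (AE w in N. \<Phi> (\<lambda>v. of_real (hermite_functional (\<nu> \<Otimes>\<^sub>M \<Lambda>) W n f v)) w
                       = of_real (charlier_functional (\<nu> \<Otimes>\<^sub>M \<Lambda>) Z n f w))"
proof -
  let ?\<mu> = "\<nu> \<Otimes>\<^sub>M \<Lambda>"
  note sets_\<Lambda> = levy_measure_sets[OF assms(4)]
  interpret \<nu>: finite_measure \<nu> by fact
  interpret \<Lambda>: sigma_finite_measure \<Lambda> by (rule levy_measure_sigma_finite[OF assms(4)])
  have psf: "pair_sigma_finite \<nu> \<Lambda>" ..
  \<comment> \<open>The factor \<open>t\<close> is kept with the polynomial: \<Lambda> may have
    infinite mass near 0, so it is the product with \<open>t\<close> that is integrable.\<close>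
  have f_eq: "f k = (\<lambda>y. a k (fst y) * (snd y * poly (P (k - 1)) (snd y)))" if "k \<in> {1..n}" for k
    by (rule ext) (use assms(12)[OF that] in \<open>simp add: split_paired_all case_prod_beta mult.assoc flip: surjective_pairing\<close>)
  have f1: "integrable ?\<mu> (f k)" if k: "k \<in> {1..n}" for k
    unfolding f_eq[OF k]
    by (rule integrable_pair_mult[OF psf L2_finite_measure_integrable[OF assms(2) assms(11)[OF k]]
          levy_measure_poly(2)[OF assms(4,5)]])
  have f2: "f k \<in> L2 ?\<mu>" if k: "k \<in> {1..n}" for k
  proof -
    have "integrable \<nu> (\<lambda>x. (a k x)\<^sup>2)" using assms(11)[OF k] by (simp add: L2_def)
    from integrable_pair_mult[OF psf this levy_measure_poly(1)[OF assms(4,5), of "P (k - 1)"]]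
    have "integrable ?\<mu> (\<lambda>y. (norm (f k y))\<^sup>2)"
      unfolding f_eq[OF k] by (simp add: power_mult_distrib)
    then show ?thesis using borel_measurable_integrable[OF f1[OF k]] by (simp add: L2_def)
  qed
  have pp: "poisson_process N ?\<mu> Z"
    using assms(7) unfolding generalized_subordinator_def by (elim conjE)
  have iso: "L2_isometry M (L2_white_noise M ?\<mu> W) N (L2_random_measure N \<nu> \<eta>) \<Phi>"
    using assms(9) unfolding canonical_isometry_def by (elim conjE)
  have ex: "\<forall>h \<in> L2 ?\<mu>. integrable ?\<mu> h \<longrightarrow>
        (AE w in N. \<Phi> (\<lambda>v. of_real (exp (W h v - L2_norm_sq ?\<mu> h / 2))) w
           = of_real (infprod (\<lambda>y. 1 + h y) (Z w) * exp (- (\<integral>y. h y \<partial>?\<mu>))))"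
    using assms(9) unfolding canonical_isometry_def by (elim conjE)
  note main = isometry_hermite_charlier[OF pp assms(8) iso ex[rule_format] f2 f1]
  show ?thesis by (intro conjI main)
qed

end
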